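(* Let $n,k,q$ be integers with $1\le q\le k\le n$. If $F\in L^1(\mathfrak{M}_{n,q+1})$, then $$\int_{\mathfrak{M}_{n,q+1}} F(\tilde{\mathbf{x}})\, d\tilde{\mathbf{x}}= c\int_{\mathcal{A}_{n,k}} d\tau\int_{\tau^{q+1}} F(\tilde{\mathbf{x}})\, \Delta_q^{\,n-k}(\tilde{\mathbf{x}})\, d_\tau\tilde{\mathbf{x}},\qquad c=\frac{(q!)^{n-k}\,\sigma_{n,q}}{\sigma_{k,q}},$$ where $\tilde{\mathbf{x}}=(x_0,x_1,\ldots,x_q)$, $\tau^{q+1}$ is the collection of $q+1$ copies of $\tau$, and $d_\tau\tilde{\mathbf{x}}=d_\tau x_0\cdots d_\tau x_q$ stands for the usual Lebesgue integration over $\tau^{q+1}$.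
   Context: $\mathfrak{M}_{n,q+1}$ is the space of real $n\times(q+1)$ matrices $\tilde{\mathbf{x}}=(x_0,x_1,\ldots,x_q)$ with columns $x_0,\dots,x_q\in\mathbb{R}^n$, identified with $(\mathbb{R}^n)^{q+1}$ and equipped with Lebesgue measure $d\tilde{\mathbf{x}}$; $L^1$ is taken with respect to this measure. $\Delta_q(\tilde{\mathbf{x}})=\Delta_q(x_0,x_1,\ldots,x_q)$ is the $q$-dimensional volume of the convex hull of $\{x_0,x_1,\ldots,x_q\}$; equivalently $\Delta_q(\tilde{\mathbf{x}})=\frac1{q!}\det(\mathbf{y}^T\mathbf{y})^{1/2}$, where $\mathbf{y}$ is the $n\times q$ matrix with columns $x_1-x_0,\dots,x_q-x_0$. $\Delta_q^{\,n-k}(\tilde{\mathbf{x}})$ denotes $(\Delta_q(\tilde{\mathbf{x}}))^{n-k}$. $\mathcal{A}_{n,k}$ is the Grassmannian bundle of affine $k$-planes $\tau$ in $\mathbb{R}^n$; each $\tau$ is written uniquely as $\tau=\xi+z$ with $\xi\in G_{n,k}$ (the Grassmann manifold of $k$-dimensional linear subspaces of $\mathbb{R}^n$) and $z\in\xi^\perp$, and the standard measure on $\mathcal{A}_{n,k}$ is $d\tau=d\xi\,dz$, with $d\xi$ the $O(n)$-invariant probability measure on $G_{n,k}$ and $dz$ Lebesgue measure on $\xi^\perp$. $d_\tau x_j$ is $k$-dimensional Lebesgue measure on $\tau$. For integers $m\ge q\ge1$, $$\sigma_{m,q}=\frac{2^q\pi^{mq/2}}{\Gamma_q(m/2)},\qquad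 \Gamma_q(\alpha)=\pi^{q(q-1)/4}\prod_{j=0}^{q-1}\Gamma(\alpha-j/2),$$ where $\Gamma$ is the Euler gamma function. *)

theory Defs
  imports "Jordan_Normal_Form.Determinant" "HOL-Probability.Probability"
begin

hide_const (open) Matrix.mat Matrix.vec Matrix.orthogonal Determinant.det

definition direction :: "(real^'n) set \<Rightarrow> (real^'n) set" where
  "direction \<tau> = {x - y | x y. x \<in> \<tau> \<and> y \<in> \<tau>}"

definition grassmannian :: "nat \<Rightarrow> (real^'n) set set" where
  "grassmannian k = {\<xi>. subspace \<xi> \<and> dim \<xi> = k}"

definition affine_grassmannian :: "nat \<Rightarrow> (real^'n) set set" where
  "affine_grassmannian k = {\<tau>. affine \<tau> \<and> aff_dim \<tau> = int k}"

text \<open>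
  The topology of the Grassmannian is the one for which \<open>\<xi> \<mapsto> P\<^sub>\<xi>\<close>, with \<open>P\<^sub>\<xi>\<close> the matrix of the
  orthogonal projection onto \<open>\<xi>\<close>, is an embedding into the space of matrices. Likewise an affine
  plane \<open>\<tau> = \<xi> + z\<close> with \<open>z\<close> orthogonal to \<open>\<xi>\<close> is determined by the pair \<open>(P\<^sub>\<xi>, z)\<close>, where \<open>z\<close> is
  the point of \<open>\<tau>\<close> closest to the origin. The Borel sets are therefore obtained by pulling back
  along these maps.
\<close>

definition borel_grassmannian :: "nat \<Rightarrow> (real^'n) set measure" where
  "borel_grassmannian k =
     vimage_algebra (grassmannian k) (\<lambda>\<xi>. matrix (closest_point \<xi>) :: real^'n^'n) borel"

definition borel_affine_grassmannian :: "nat \<Rightarrow> (real^'n) set measure" where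
  "borel_affine_grassmannian k =
     vimage_algebra (affine_grassmannian k)
       (\<lambda>\<tau>. (matrix (closest_point (direction \<tau>)) :: real^'n^'n, closest_point \<tau> 0)) borel"

text \<open>
  The two conditions below, invariance under \<open>O(n)\<close> and total mass 1, characterise a unique measure.
\<close>

definition invariant_probability_grassmannian :: "nat \<Rightarrow> (real^'n) set measure \<Rightarrow> bool" where
  "invariant_probability_grassmannian k \<mu> \<longleftrightarrow>
     prob_space \<mu> \<and> sets \<mu> = sets (borel_grassmannian k) \<and>
     (\<forall>g. orthogonal_transformation g \<longrightarrow> distr \<mu> \<mu> ((`) g) = \<mu>)"

text \<open>
  Lebesgue measure on a plane is transported from coordinates with respect to an orthonormal basis
  of its direction space, in the same way as \<open>lborel\<close> is constructed from the standard basis.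
  By rotation invariance the choice of the basis is immaterial. If the plane is a point, this is the
  unit mass at that point.
\<close>

definition orthonormal_basis :: "(real^'n) set \<Rightarrow> (real^'n) set" where
  "orthonormal_basis \<xi> =
     (SOME B. B \<subseteq> \<xi> \<and> pairwise orthogonal B \<and> (\<forall>b\<in>B. norm b = 1) \<and> span B = \<xi>)"

definition flat_lborel :: "(real^'n) set \<Rightarrow> (real^'n) measure" where
  "flat_lborel \<tau> =
     (let B = orthonormal_basis (direction \<tau>) in
      distr (\<Pi>\<^sub>M b\<in>B. (lborel :: real measure)) (restrict_space borel \<tau>)
        (\<lambda>c. closest_point \<tau> 0 + (\<Sum>b\<in>B. c b *\<^sub>R b)))"

text \<open>
  The measure \<open>d\<tau> = d\<xi> dz\<close> on affine planes \<open>\<tau> = \<xi> + z\<close>, \<open>z\<close> ranging over the orthogonal complement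
  of \<open>\<xi>\<close>, where \<open>d\<xi>\<close> is the given measure \<open>\<mu>\<close> on the Grassmannian.
\<close>

definition affine_grassmannian_measure ::
    "nat \<Rightarrow> (real^'n) set measure \<Rightarrow> (real^'n) set measure" where
  "affine_grassmannian_measure k \<mu> =
     measure_of (affine_grassmannian k) (sets (borel_affine_grassmannian k))
       (\<lambda>A. \<integral>\<^sup>+ \<xi>. (\<integral>\<^sup>+ z. indicator A ((+) z ` \<xi>) \<partial>flat_lborel (orthogonal_comp \<xi>)) \<partial>\<mu>)"

text \<open>
  A matrix with columns \<open>x\<^sub>0, \<dots>, x\<^sub>q\<close> in \<open>\<real>\<^sup>n\<close> is represented as the family of its columns. Completion
  turns Borel measurability into Lebesgue measurability.
\<close>

definition lebesgue_columns :: "nat \<Rightarrow> (nat \<Rightarrow> real^'n) measure" where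
  "lebesgue_columns q = completion (\<Pi>\<^sub>M j\<in>{0..q}. lborel)"

definition lebesgue_flat_columns :: "nat \<Rightarrow> (real^'n) set \<Rightarrow> (nat \<Rightarrow> real^'n) measure" where
  "lebesgue_flat_columns q \<tau> = completion (\<Pi>\<^sub>M j\<in>{0..q}. flat_lborel \<tau>)"

text \<open>
  The volume of the simplex with vertices \<open>x\<^sub>0, \<dots>, x\<^sub>q\<close>. The \<open>q \<times> q\<close> matrix is \<open>y\<^sup>T y\<close>, where \<open>y\<close>
  has the columns \<open>x\<^sub>1 - x\<^sub>0, \<dots>, x\<^sub>q - x\<^sub>0\<close>; its indices run from 0 to \<open>q - 1\<close>.
\<close>

definition simplex_volume :: "nat \<Rightarrow> (nat \<Rightarrow> real^'n) \<Rightarrow> real" where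
  "simplex_volume q x =
     sqrt (Determinant.det (Matrix.mat q q
       (\<lambda>(i, j). inner (x (Suc i) - x 0) (x (Suc j) - x 0)))) / fact q"

definition Siegel_Gamma :: "nat \<Rightarrow> real \<Rightarrow> real" where
  "Siegel_Gamma q \<alpha> =
     pi powr (real q * (real q - 1) / 4) * (\<Prod>j = 0..<q. Gamma (\<alpha> - real j / 2))"

definition stiefel_volume :: "nat \<Rightarrow> nat \<Rightarrow> real" where
  "stiefel_volume m q = 2 ^ q * pi powr (real m * real q / 2) / Siegel_Gamma q (real m / 2)"

end

theory Submission
  imports Defs
begin

(* Frees the bullet for the Euclidean inner product. *)
no_notation Matrix.scalar_prod (infix "\<bullet>" 70)

text \<open>
  Write \<open>n = CARD('n)\<close>. Two reductions turn the affine formula into a statement about \<open>q\<close> vectors in a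
  linear \<open>k\<close>-plane. If \<open>\<tau> = \<xi> + z\<close>, then \<open>x\<^sub>0\<close> ranges over \<open>\<xi> + z\<close> and \<open>z\<close> over the orthogonal
  complement of \<open>\<xi>\<close>, so together they sweep out the whole space; the differences \<open>y\<^sub>j = x\<^sub>j - x\<^sub>0\<close> range
  over \<open>\<xi>\<close>, and the simplex volume is \<open>|y| / q!\<close> with \<open>|y|\<close> the volume of the parallelotope spanned by
  \<open>y\<^sub>1, \<dots>, y\<^sub>q\<close>. What remains is the linear formula (\<open>linear_blaschke_petkantschin\<close>)

  \<open>\<integral> f(y) dy = c' \<integral> d\<mu>(\<xi>) \<integral>\<^bsub>\<xi>\<^sup>q\<^esub> f(y) |y|\<^sup>n\<^sup>-\<^sup>k dy\<close>.

  Both of its sides are unchanged when \<open>f\<close> is composed with a rotation, hence also when \<open>f\<close> is replaced by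
  its average over \<open>O(n)\<close>. The average is realised by the Gram-Schmidt frame of a Gaussian random matrix
  (\<open>orthogonal_average_invariant\<close>). So \<open>f\<close> may be assumed invariant under \<open>O(n)\<close>, and for such \<open>f\<close> the
  formula holds on every single plane \<open>\<xi>\<close>, without integrating over \<open>\<mu>\<close>
  (\<open>nn_integral_dimension_change\<close>). This is shown by induction on the number of vectors: by invariance the
  first vector matters only through its length \<open>r\<close>; polar coordinates in dimensions \<open>n\<close> and \<open>k\<close> differ by
  the factor \<open>r\<^sup>n\<^sup>-\<^sup>k\<close> and a quotient of sphere areas; and \<open>|y|\<close> is \<open>r\<close> times the volume of the
  remaining vectors projected along the first one. The quotients of sphere areas multiply up to the
  quotient of the Stiefel volumes.

  Measurability in \<open>\<xi>\<close> is the delicate point, since Lebesgue measure on a plane is given through an arbitrarily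
  chosen basis. It is bypassed by describing the measure on \<open>\<xi>\<close> through the orthogonal projection
  \<open>P\<close> alone: \<open>\<integral>\<^bsub>\<xi>\<^esub> f\<close> is the integral of \<open>f(P x) exp(-\<pi>|x - P x|\<^sup>2)\<close> over the whole space, because the
  Gaussian factor integrates to 1 over the orthogonal complement. Rotations, orthogonal sums and
  dependence on \<open>\<xi>\<close> are all read off from this formula by Fubini's theorem.

  Integrable complex functions are split into four nonnegative parts. A Lebesgue measurable function
  differs from a Borel function on a null set, and the formula for the indicator of this set shows that
  almost every plane meets it in a null set, up to points where the weight vanishes.
\<close>

section \<open>Gaussian weights and invariance of Lebesgue measure\<close>

text \<open>The factor \<open>\<pi>\<close> in the exponent makes the total mass equal to 1 in every dimension.\<close>
definition gauss :: "'a::euclidean_space \<Rightarrow> real" where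
  "gauss x = exp (- pi * (norm x)\<^sup>2)"

lemma gauss_nonneg [simp]: "0 \<le> gauss x"
  by (simp add: gauss_def)

lemma measurable_gauss [measurable]: "gauss \<in> borel_measurable borel"
  unfolding gauss_def by measurable

lemma gauss_orthogonal_add:
  assumes "x \<bullet> y = 0"
  shows "ennreal (gauss (x + y)) = ennreal (gauss x) * ennreal (gauss y)"
proof -
  have "(norm (x + y))\<^sup>2 = (norm x)\<^sup>2 + (norm y)\<^sup>2"
    using assms by (simp add: power2_norm_eq_inner inner_add inner_commute)
  then show ?thesis
    by (simp add: gauss_def ennreal_mult' [symmetric] exp_add [symmetric] algebra_simps)
qed

lemma nn_integral_lborel_translation:
  fixes f :: "'a::euclidean_space \<Rightarrow> ennreal"
  assumes [measurable]: "f \<in> borel_measurable borel"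
  shows "(\<integral>\<^sup>+x. f (a + x) \<partial>lborel) = (\<integral>\<^sup>+x. f x \<partial>lborel)"
proof -
  have "(\<integral>\<^sup>+x. f x \<partial>lborel) = (\<integral>\<^sup>+x. f x \<partial>distr lborel borel ((+) a))"
    by (simp add: lborel_distr_plus)
  also have "\<dots> = (\<integral>\<^sup>+x. f (a + x) \<partial>lborel)"
    by (subst nn_integral_distr) auto
  finally show ?thesis ..
qed

lemma nn_integral_gauss_real: "(\<integral>\<^sup>+(x::real). ennreal (exp (- pi * x\<^sup>2)) \<partial>lborel) = 1"
proof -
  have "exp (- pi * x\<^sup>2) = normal_density 0 (1 / sqrt (2 * pi)) x" for x :: real
    by (simp add: normal_density_def power_divide)
  moreover have "(\<integral>\<^sup>+x. ennreal (normal_density 0 (1 / sqrt (2 * pi)) x) \<partial>lborel) = 1"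
    by (subst nn_integral_eq_integral) (auto intro!: integrable_normal_density integral_normal_density)
  ultimately show ?thesis by simp
qed

lemma nn_integral_gauss: "(\<integral>\<^sup>+(x::'a::euclidean_space). ennreal (gauss x) \<partial>lborel) = 1"
proof -
  have "gauss x = (\<Prod>b\<in>Basis. exp (- pi * (x \<bullet> b)\<^sup>2))" for x :: 'a
    by (subst gauss_def, subst power2_norm_eq_inner, subst euclidean_inner)
      (simp add: power2_eq_square exp_sum [symmetric] sum_distrib_left sum_negf)
  then have "(\<integral>\<^sup>+(x::'a). ennreal (gauss x) \<partial>lborel)
      = (\<integral>\<^sup>+(x::'a). (\<Prod>b\<in>Basis. ennreal (exp (- pi * (x \<bullet> b)\<^sup>2))) \<partial>lborel)"
    by (simp add: prod_ennreal)
  also have "\<dots> = 1"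
    by (subst nn_integral_lborel_prod) (auto simp: nn_integral_gauss_real[simplified])
  finally show ?thesis .
qed

lemma nn_integral_gauss_shift:
  "(\<integral>\<^sup>+(x::'a::euclidean_space). ennreal (gauss (x - a)) \<partial>lborel) = 1"
  using nn_integral_lborel_translation[of "\<lambda>x. ennreal (gauss x)" "- a"] nn_integral_gauss
  by simp

lemma orthogonal_transformation_measurable:
  fixes g :: "'a::euclidean_space \<Rightarrow> 'a"
  assumes "orthogonal_transformation g"
  shows "g \<in> borel_measurable borel"
  using assms linear_continuous_on[of g UNIV] orthogonal_transformation_linear
  by (intro borel_measurable_continuous_onI) (auto simp: linear_linear)

text \<open>
  For \<open>x\<close> fixed, \<open>f(g y)\<close> and \<open>f(x + g y)\<close> have the same integral over \<open>y\<close>. Averaging over \<open>x\<close> with Gaussian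
  weight and exchanging the integrals moves \<open>g\<close> into the Gaussian, which does not see it.
\<close>
lemma nn_integral_lborel_orthogonal:
  fixes f :: "'a::euclidean_space \<Rightarrow> ennreal" and g :: "'a \<Rightarrow> 'a"
  assumes g: "orthogonal_transformation g" and [measurable]: "f \<in> borel_measurable borel"
  shows "(\<integral>\<^sup>+x. f (g x) \<partial>lborel) = (\<integral>\<^sup>+x. f x \<partial>lborel)"
proof -
  note [measurable] = orthogonal_transformation_measurable[OF g]
  have lin: "linear g" by (rule orthogonal_transformation_linear[OF g])
  obtain h where surj: "g (h z) = z" for z
    using orthogonal_transformation_surj[OF g] by (metis surj_def)
  have shift: "(\<integral>\<^sup>+y. f (x + g y) \<partial>lborel) = (\<integral>\<^sup>+y. f (g y) \<partial>lborel)" for x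
  proof -
    have "(\<integral>\<^sup>+y. f (x + g y) \<partial>lborel) = (\<integral>\<^sup>+y. f (g (h x + y)) \<partial>lborel)"
      by (simp add: linear_add[OF lin] surj)
    also have "\<dots> = (\<integral>\<^sup>+y. f (g y) \<partial>lborel)"
      by (rule nn_integral_lborel_translation) measurable
    finally show ?thesis .
  qed
  have "(\<integral>\<^sup>+y. f (g y) \<partial>lborel) = (\<integral>\<^sup>+x. ennreal (gauss x) * (\<integral>\<^sup>+y. f (g y) \<partial>lborel) \<partial>(lborel :: 'a measure))"
    by (simp add: nn_integral_multc nn_integral_gauss)
  also have "\<dots> = (\<integral>\<^sup>+x. \<integral>\<^sup>+y. gauss x * f (x + g y) \<partial>lborel \<partial>lborel)"
  proof (rule nn_integral_cong, goal_cases)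
    case (1 x)
    have "(\<integral>\<^sup>+y. gauss x * f (x + g y) \<partial>lborel) = gauss x * (\<integral>\<^sup>+y. f (x + g y) \<partial>lborel)"
      by (rule nn_integral_cmult) measurable
    then show ?case
      by (simp only: shift)
  qed
  also have "\<dots> = (\<integral>\<^sup>+y. \<integral>\<^sup>+x. gauss x * f (x + g y) \<partial>lborel \<partial>lborel)"
    by (rule lborel_pair.Fubini') simp
  also have "\<dots> = (\<integral>\<^sup>+y. \<integral>\<^sup>+x. gauss (x - g y) * f x \<partial>lborel \<partial>lborel)"
  proof (rule nn_integral_cong, goal_cases)
    case (1 y)
    show ?case
      using nn_integral_lborel_translation[of "\<lambda>x. gauss (x - g y) * f x" "g y"]
      by (simp add: add.commute)
  qed
  also have "\<dots> = (\<integral>\<^sup>+x. \<integral>\<^sup>+y. gauss (x - g y) * f x \<partial>lborel \<partial>lborel)"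
    by (rule lborel_pair.Fubini') simp
  also have "\<dots> = (\<integral>\<^sup>+x. f x \<partial>lborel)"
  proof (rule nn_integral_cong, goal_cases)
    case (1 x)
    have "gauss (x - g y) = gauss (y - h x)" for y
    proof -
      have "x - g y = g (h x - y)" by (simp add: linear_diff[OF lin] surj)
      then show ?thesis
        by (simp add: gauss_def orthogonal_transformation_norm[OF g] norm_minus_commute)
    qed
    then show ?case
      by (simp add: nn_integral_multc nn_integral_gauss_shift)
  qed
  finally show ?thesis .
qed

section \<open>Orthogonal projections\<close>

lemma
  fixes V :: "'a::euclidean_space set"
  assumes V: "subspace V"
  shows closest_point_subspace_in: "closest_point V x \<in> V"
    and closest_point_subspace_orthogonal: "v \<in> V \<Longrightarrow> (x - closest_point V x) \<bullet> v = 0"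
proof -
  have cl: "closed V" "convex V" "V \<noteq> {}"
    using V subspace_0[OF V] by (auto simp: closed_subspace subspace_imp_convex)
  show in_V: "closest_point V x \<in> V" for x using cl by (intro closest_point_in_set) auto
  have le: "(x - closest_point V x) \<bullet> w \<le> 0" if "w \<in> V" for w
    using closest_point_dot[OF cl(2,1), of "closest_point V x + w" x] in_V[of x] V that
    by (auto simp: subspace_add)
  show "(x - closest_point V x) \<bullet> v = 0" if "v \<in> V"
    using le[OF that] le[of "- v"] that V by (auto simp: subspace_neg)
qed

lemma closest_point_subspace_eq:
  fixes V :: "'a::euclidean_space set"
  assumes V: "subspace V" and y: "y \<in> V" and orth: "\<And>v. v \<in> V \<Longrightarrow> (x - y) \<bullet> v = 0"
  shows "closest_point V x = y"
proof -
  define d where "d = closest_point V x - y"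
  have d: "d \<in> V" using closest_point_subspace_in[OF V] y V by (auto simp: d_def subspace_diff)
  have "d \<bullet> d = (x - y) \<bullet> d - (x - closest_point V x) \<bullet> d"
    by (simp add: d_def inner_diff_left)
  then have "d \<bullet> d = 0" using orth[OF d] closest_point_subspace_orthogonal[OF V d] by simp
  then show ?thesis by (simp add: d_def)
qed

lemma closest_point_subspace_id [simp]:
  "subspace V \<Longrightarrow> v \<in> V \<Longrightarrow> closest_point V v = (v :: 'a::euclidean_space)"
  by (rule closest_point_subspace_eq) auto

lemma linear_closest_point_subspace:
  fixes V :: "'a::euclidean_space set"
  assumes V: "subspace V"
  shows "linear (closest_point V)"
proof (rule linearI)
  note o = closest_point_subspace_orthogonal[OF V] and i = closest_point_subspace_in[OF V]
  show "closest_point V (x + y) = closest_point V x + closest_point V y" for x y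
    using V o[of _ x] o[of _ y] i
    by (intro closest_point_subspace_eq) (auto simp: subspace_add inner_diff_left inner_add_left)
  show "closest_point V (r *\<^sub>R x) = r *\<^sub>R closest_point V x" for r x
    using V o[of _ x] i
    by (intro closest_point_subspace_eq)
      (auto simp: subspace_scale inner_diff_left simp flip: scaleR_diff_right)
qed

lemma measurable_closest_point_subspace:
  fixes V :: "'a::euclidean_space set"
  shows "subspace V \<Longrightarrow> closest_point V \<in> borel_measurable borel"
  using linear_continuous_on linear_closest_point_subspace linear_linear
  by (intro borel_measurable_continuous_onI) blast

lemma closest_point_orthogonal_zero:
  fixes V :: "'a::euclidean_space set"
  assumes "subspace V" "\<And>v. v \<in> V \<Longrightarrow> x \<bullet> v = 0"
  shows "closest_point V x = 0"
  by (rule closest_point_subspace_eq) (use assms in \<open>auto simp: subspace_0\<close>)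

lemma closest_point_orthogonal_image:
  fixes V :: "'a::euclidean_space set" and g :: "'a \<Rightarrow> 'a"
  assumes V: "subspace V" and g: "orthogonal_transformation g"
  shows "closest_point (g ` V) (g x) = g (closest_point V x)"
proof (rule closest_point_subspace_eq)
  have lin: "linear g" by (rule orthogonal_transformation_linear[OF g])
  show "subspace (g ` V)" by (rule linear_subspace_image[OF lin V])
  show "g (closest_point V x) \<in> g ` V" using closest_point_subspace_in[OF V] by auto
  fix v assume "v \<in> g ` V"
  then obtain w where w: "w \<in> V" "v = g w" by auto
  have "(g x - g (closest_point V x)) \<bullet> v = (x - closest_point V x) \<bullet> w"
    using g by (simp add: w linear_diff[OF lin, symmetric] orthogonal_transformation_def)
  then show "(g x - g (closest_point V x)) \<bullet> v = 0"
    using closest_point_subspace_orthogonal[OF V w(1)] by simp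
qed

definition orthogonal_sum :: "'a::euclidean_space set \<Rightarrow> 'a set \<Rightarrow> 'a set \<Rightarrow> bool" where
  "orthogonal_sum W Z V \<longleftrightarrow> subspace W \<and> subspace Z \<and> subspace V \<and> W \<subseteq> V \<and> Z \<subseteq> V \<and>
     (\<forall>w\<in>W. \<forall>z\<in>Z. w \<bullet> z = 0) \<and> (\<forall>v\<in>V. \<exists>w\<in>W. \<exists>z\<in>Z. v = w + z)"

lemma orthogonal_sumI:
  assumes "subspace W" "subspace Z" "subspace V" "W \<subseteq> V" "Z \<subseteq> V"
    "\<And>w z. w \<in> W \<Longrightarrow> z \<in> Z \<Longrightarrow> w \<bullet> z = 0"
    "\<And>v. v \<in> V \<Longrightarrow> \<exists>w\<in>W. v - w \<in> Z"
  shows "orthogonal_sum W Z V"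
  unfolding orthogonal_sum_def using assms by (auto, metis add_diff_cancel_left' add.commute diff_add_cancel)

lemma closest_point_orthogonal_sum:
  assumes "orthogonal_sum W Z V"
  shows "closest_point V x = closest_point W x + closest_point Z x"
proof -
  from assms have W: "subspace W" and Z: "subspace Z" and V: "subspace V" and "W \<subseteq> V" "Z \<subseteq> V"
    and orth: "\<And>w z. w \<in> W \<Longrightarrow> z \<in> Z \<Longrightarrow> w \<bullet> z = 0"
    and dec: "\<And>v. v \<in> V \<Longrightarrow> \<exists>w\<in>W. \<exists>z\<in>Z. v = w + z"
    by (auto simp: orthogonal_sum_def)
  show ?thesis
  proof (rule closest_point_subspace_eq[OF V])
    show "closest_point W x + closest_point Z x \<in> V"
      using closest_point_subspace_in[OF W] closest_point_subspace_in[OF Z] \<open>W \<subseteq> V\<close> \<open>Z \<subseteq> V\<close> V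
      by (auto intro!: subspace_add)
    fix v assume "v \<in> V"
    then obtain w z where v: "w \<in> W" "z \<in> Z" "v = w + z" using dec by blast
    have "(x - closest_point W x) \<bullet> w = 0" "(x - closest_point Z x) \<bullet> z = 0"
      "closest_point W x \<bullet> z = 0" "w \<bullet> closest_point Z x = 0"
      using v closest_point_subspace_orthogonal[OF W] closest_point_subspace_orthogonal[OF Z]
        orth closest_point_subspace_in[OF W] closest_point_subspace_in[OF Z] by auto
    then show "(x - (closest_point W x + closest_point Z x)) \<bullet> v = 0"
      by (simp add: v(3) inner_diff_left inner_diff_right inner_add_left inner_add_right inner_commute)
  qed
qed

lemma orthogonal_sum_complement:
  assumes W: "subspace W" and V: "subspace V" and "W \<subseteq> V"
  shows "orthogonal_sum W (V \<inter> orthogonal_comp W) V"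
proof (rule orthogonal_sumI)
  show "subspace (V \<inter> W\<^sup>\<bottom>)" using V by (simp add: subspace_inter subspace_orthogonal_comp)
  show "\<exists>w\<in>W. v - w \<in> V \<inter> W\<^sup>\<bottom>" if "v \<in> V" for v
    using that closest_point_subspace_in[OF W, of v] closest_point_subspace_orthogonal[OF W, of _ v]
      \<open>W \<subseteq> V\<close> V
    by (intro bexI[of _ "closest_point W v"])
      (auto simp: orthogonal_comp_def orthogonal_def inner_commute intro!: subspace_diff)
qed (use assms in \<open>auto simp: orthogonal_comp_def orthogonal_def\<close>)

lemma dim_orthogonal_sum:
  assumes "orthogonal_sum W Z V"
  shows "dim V = dim W + dim Z"
proof -
  from assms have "subspace W" "subspace Z" "W \<subseteq> V" "Z \<subseteq> V" "subspace V"
    and "\<And>v. v \<in> V \<Longrightarrow> \<exists>w\<in>W. \<exists>z\<in>Z. v = w + z" and o: "\<forall>w\<in>W. \<forall>z\<in>Z. w \<bullet> z = 0"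
    by (auto simp: orthogonal_sum_def)
  then have "V = {w + z |w z. w \<in> W \<and> z \<in> Z}"
    by (auto intro!: subspace_add) blast+
  moreover have "W \<inter> Z = {0}"
    using \<open>subspace W\<close> \<open>subspace Z\<close> o by (auto simp: subspace_0) (metis inner_eq_zero_iff)
  ultimately show ?thesis
    using dim_sums_Int[OF \<open>subspace W\<close> \<open>subspace Z\<close>] by simp
qed

section \<open>Lebesgue measure on a subspace\<close>

text \<open>
  Lebesgue measure on the subspace \<open>V\<close>, as a measure on the ambient space. Splitting
  \<open>x\<close> into its components in \<open>V\<close> and in the orthogonal complement, the Gaussian weight integrates to 1
  over the second component. In contrast to coordinates with respect to an orthonormal basis, this
  description involves no choice and depends on \<open>V\<close> only through the orthogonal projection.
\<close>
definition subspace_lborel :: "'a::euclidean_space set \<Rightarrow> 'a measure" where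
  "subspace_lborel V =
     distr (density lborel (\<lambda>x. ennreal (gauss (x - closest_point V x)))) borel (closest_point V)"

lemma sets_subspace_lborel [simp, measurable_cong]: "sets (subspace_lborel V) = sets borel"
  by (simp add: subspace_lborel_def)

lemma space_subspace_lborel [simp]: "space (subspace_lborel V) = UNIV"
  by (simp add: subspace_lborel_def)

lemma nn_integral_subspace_lborel:
  fixes V :: "'a::euclidean_space set" and f :: "'a \<Rightarrow> ennreal"
  assumes V: "subspace V" and [measurable]: "f \<in> borel_measurable borel"
  shows "(\<integral>\<^sup>+x. f x \<partial>subspace_lborel V)
    = (\<integral>\<^sup>+x. gauss (x - closest_point V x) * f (closest_point V x) \<partial>lborel)"
proof -
  have [measurable]: "closest_point V \<in> borel_measurable borel" using V by (rule measurable_closest_point_subspace)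
  show ?thesis
    unfolding subspace_lborel_def by (simp add: nn_integral_distr nn_integral_density)
qed

lemma subspace_lborel_UNIV [simp]: "subspace_lborel (UNIV :: 'a::euclidean_space set) = lborel"
  unfolding subspace_lborel_def
  by (simp add: gauss_def density_1 one_ennreal_def[symmetric] distr_id2 cong: distr_cong)

lemma AE_subspace_lborel:
  fixes V :: "'a::euclidean_space set"
  assumes V: "subspace V"
  shows "AE x in subspace_lborel V. x \<in> V"
proof -
  have [measurable]: "closest_point V \<in> borel_measurable borel" using V by (rule measurable_closest_point_subspace)
  have [measurable]: "V \<in> sets borel" using closed_subspace[OF V] by auto
  show ?thesis unfolding subspace_lborel_def
    by (subst AE_distr_iff) (auto simp: closest_point_subspace_in[OF V])
qed

text \<open>
  On the preimage of a ball of radius \<open>r\<close> the weight is at most \<open>exp(\<pi> r\<^sup>2)\<close> times the full Gaussian, which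
  is integrable.
\<close>
lemma emeasure_subspace_lborel_cball_finite:
  fixes V :: "'a::euclidean_space set"
  assumes V: "subspace V"
  shows "emeasure (subspace_lborel V) (cball 0 r) < \<infinity>"
proof -
  have [measurable]: "closest_point V \<in> borel_measurable borel" using V by (rule measurable_closest_point_subspace)
  have "emeasure (subspace_lborel V) (cball 0 r) = (\<integral>\<^sup>+x. (indicator (cball 0 r) x :: ennreal) \<partial>subspace_lborel V)"
    by simp
  also have "\<dots> = (\<integral>\<^sup>+x. gauss (x - closest_point V x) * (indicator (cball 0 r) (closest_point V x) :: ennreal) \<partial>lborel)"
    by (rule nn_integral_subspace_lborel[OF V]) (rule borel_measurable_indicator, simp)
  also have "\<dots> \<le> (\<integral>\<^sup>+x. ennreal (exp (pi * r\<^sup>2)) * gauss x \<partial>(lborel :: 'a measure))"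
  proof (intro nn_integral_mono, cases)
    fix x assume "closest_point V x \<in> cball 0 r"
    then have "norm (closest_point V x) ^ 2 \<le> r ^ 2" by (auto intro: power_mono)
    then have "pi * norm (closest_point V x) ^ 2 \<le> pi * r ^ 2" by simp
    moreover have "norm x ^ 2 = norm (x - closest_point V x) ^ 2 + norm (closest_point V x) ^ 2"
      using closest_point_subspace_orthogonal[OF V closest_point_subspace_in[OF V], of x x]
      by (simp add: power2_norm_eq_inner inner_diff_left inner_diff_right inner_commute)
    ultimately have "gauss (x - closest_point V x) \<le> exp (pi * r\<^sup>2) * gauss x"
      by (simp add: gauss_def exp_add[symmetric] algebra_simps)
    then show "ennreal (gauss (x - closest_point V x)) * indicator (cball 0 r) (closest_point V x)
       \<le> ennreal (exp (pi * r\<^sup>2)) * gauss x"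
      by (auto simp: indicator_def ennreal_mult'[symmetric] intro: ennreal_leI)
  qed auto
  also have "\<dots> < \<infinity>" by (simp add: nn_integral_cmult nn_integral_gauss)
  finally show ?thesis .
qed

lemma sigma_finite_subspace_lborel:
  fixes V :: "'a::euclidean_space set"
  assumes V: "subspace V"
  shows "sigma_finite_measure (subspace_lborel V)"
proof
  have "\<Union> (range (\<lambda>n. cball (0::'a) (real n))) = UNIV"
    by (auto simp: real_arch_simple)
  then show "\<exists>A. countable A \<and> A \<subseteq> sets (subspace_lborel V) \<and> \<Union> A = space (subspace_lborel V) \<and>
     (\<forall>a\<in>A. emeasure (subspace_lborel V) a \<noteq> \<infinity>)"
    using emeasure_subspace_lborel_cball_finite[OF V]
    by (intro exI[of _ "range (\<lambda>n. cball 0 (real n))"]) (auto simp: less_top[symmetric])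
qed

lemma nn_integral_subspace_lborel_translation:
  fixes V :: "'a::euclidean_space set" and f :: "'a \<Rightarrow> ennreal"
  assumes V: "subspace V" and v: "v \<in> V" and [measurable]: "f \<in> borel_measurable borel"
  shows "(\<integral>\<^sup>+x. f (v + x) \<partial>subspace_lborel V) = (\<integral>\<^sup>+x. f x \<partial>subspace_lborel V)"
proof -
  have [measurable]: "closest_point V \<in> borel_measurable borel" using V by (rule measurable_closest_point_subspace)
  have *: "closest_point V (v + x) = v + closest_point V x" for x
    using linear_add[OF linear_closest_point_subspace[OF V]] V v by simp
  show ?thesis
    using nn_integral_lborel_translation
      [of "\<lambda>x. gauss (x - closest_point V x) * f (closest_point V x)" v]
    by (simp add: nn_integral_subspace_lborel[OF V] *)
qed

lemma nn_integral_subspace_lborel_orthogonal: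
  fixes V :: "'a::euclidean_space set" and g :: "'a \<Rightarrow> 'a" and f :: "'a \<Rightarrow> ennreal"
  assumes V: "subspace V" and g: "orthogonal_transformation g" and [measurable]: "f \<in> borel_measurable borel"
  shows "(\<integral>\<^sup>+x. f (g x) \<partial>subspace_lborel V) = (\<integral>\<^sup>+x. f x \<partial>subspace_lborel (g ` V))"
proof -
  note [measurable] = orthogonal_transformation_measurable[OF g]
  have lin: "linear g" by (rule orthogonal_transformation_linear[OF g])
  have gV: "subspace (g ` V)" by (rule linear_subspace_image[OF lin V])
  have [measurable]: "closest_point V \<in> borel_measurable borel" 
    "closest_point (g ` V) \<in> borel_measurable borel" using V gV by (simp_all add: measurable_closest_point_subspace)
  have "(\<integral>\<^sup>+x. f x \<partial>subspace_lborel (g ` V))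
      = (\<integral>\<^sup>+x. gauss (g x - closest_point (g ` V) (g x)) * f (closest_point (g ` V) (g x)) \<partial>lborel)"
    by (subst nn_integral_lborel_orthogonal[OF g, 
          where f = "\<lambda>x. gauss (x - closest_point (g ` V) x) * f (closest_point (g ` V) x)"])
      (auto simp: nn_integral_subspace_lborel[OF gV])
  also have "\<dots> = (\<integral>\<^sup>+x. gauss (x - closest_point V x) * f (g (closest_point V x)) \<partial>lborel)"
    by (simp add: closest_point_orthogonal_image[OF V g] linear_diff[OF lin, symmetric]
        gauss_def orthogonal_transformation_norm[OF g])
  finally show ?thesis
    by (simp add: nn_integral_subspace_lborel[OF V, of "\<lambda>x. f (g x)"])
qed

lemma orthogonal_transformation_reflection:
  fixes V :: "'a::euclidean_space set"
  assumes V: "subspace V"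
  shows "orthogonal_transformation (\<lambda>x. x - 2 *\<^sub>R closest_point V x)"
proof -
  let ?P = "closest_point V"
  have lin: "linear ?P" by (rule linear_closest_point_subspace[OF V])
  have sym: "?P x \<bullet> y = ?P x \<bullet> ?P y" for x y
    using closest_point_subspace_orthogonal[OF V closest_point_subspace_in[OF V], of y x]
    by (simp add: inner_diff_left inner_diff_right inner_commute)
  have "linear (\<lambda>x. x - 2 *\<^sub>R ?P x)"
    by (rule linearI) (auto simp: linear_add[OF lin] linear_scale[OF lin] algebra_simps)
  moreover have "(x - 2 *\<^sub>R ?P x) \<bullet> (y - 2 *\<^sub>R ?P y) = x \<bullet> y" for x y
    using sym[of x y] sym[of y x] by (simp add: inner_diff_left inner_diff_right inner_commute)
  ultimately show ?thesis by (simp add: orthogonal_transformation_def)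
qed

text \<open>
  With \<open>P\<close>, \<open>Q\<close> the projections onto \<open>W\<close>, \<open>Z\<close>, the right-hand side is a double integral over \<open>x\<close> and \<open>y\<close> of
  \<open>f(P x + Q y)\<close> with two Gaussian weights. Two translations turn the argument of \<open>f\<close> into \<open>P x + Q x\<close>. By
  Pythagoras the weights then combine to the weight for \<open>V\<close> times a Gaussian in \<open>y - 2 Q y\<close>, which
  is a reflection of \<open>y\<close> and integrates to 1.
\<close>
lemma nn_integral_subspace_lborel_orthogonal_sum:
  fixes V :: "'a::euclidean_space set" and f :: "'a \<Rightarrow> ennreal"
  assumes sum: "orthogonal_sum W Z V" and [measurable]: "f \<in> borel_measurable borel"
  shows "(\<integral>\<^sup>+v. f v \<partial>subspace_lborel V) = (\<integral>\<^sup>+w. \<integral>\<^sup>+z. f (w + z) \<partial>subspace_lborel Z \<partial>subspace_lborel W)"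
proof -
  from sum have W: "subspace W" and Z: "subspace Z" and V: "subspace V"
    and orth: "\<And>w z. w \<in> W \<Longrightarrow> z \<in> Z \<Longrightarrow> w \<bullet> z = 0"
    by (auto simp: orthogonal_sum_def)
  let ?P = "closest_point W" and ?Q = "closest_point Z" and ?R = "closest_point V"
  have [measurable]: "?P \<in> borel_measurable borel" "?Q \<in> borel_measurable borel" 
    "?R \<in> borel_measurable borel" using W Z V by (simp_all add: measurable_closest_point_subspace)
  have R: "?R x = ?P x + ?Q x" for x by (rule closest_point_orthogonal_sum[OF sum])
  note Padd = linear_add[OF linear_closest_point_subspace[OF W]] linear_diff[OF linear_closest_point_subspace[OF W]]
    linear_scale[OF linear_closest_point_subspace[OF W]]
  note Qadd = linear_add[OF linear_closest_point_subspace[OF Z]] linear_diff[OF linear_closest_point_subspace[OF Z]]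
    linear_scale[OF linear_closest_point_subspace[OF Z]]
  have PQ [simp]: "?P (?Q x) = 0" for x
    by (rule closest_point_orthogonal_zero[OF W])
      (use orth closest_point_subspace_in[OF Z] in \<open>auto simp: inner_commute\<close>)
  have [simp]: "?Q (?Q x) = ?Q x" for x
    using closest_point_subspace_in[OF Z] Z by simp
  have [measurable]: "(\<lambda>x. \<integral>\<^sup>+z. f (x + z) \<partial>subspace_lborel Z) \<in> borel_measurable borel"
  proof -
    interpret sigma_finite_measure "subspace_lborel Z" by (rule sigma_finite_subspace_lborel[OF Z])
    show ?thesis by measurable
  qed
  have "(\<integral>\<^sup>+w. \<integral>\<^sup>+z. f (w + z) \<partial>subspace_lborel Z \<partial>subspace_lborel W)
      = (\<integral>\<^sup>+x. \<integral>\<^sup>+y. gauss (x - ?P x) * (gauss (y - ?Q y) * f (?P x + ?Q y)) \<partial>lborel \<partial>lborel)"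
    by (simp add: nn_integral_subspace_lborel[OF W] nn_integral_subspace_lborel[OF Z] nn_integral_cmult)
  \<comment> \<open>replace \<open>y\<close> by \<open>x + y\<close>\<close>
  also have "\<dots> = (\<integral>\<^sup>+x. \<integral>\<^sup>+y. gauss (x - ?P x) * (gauss (x + y - ?Q x - ?Q y) * f (?R x + ?Q y)) \<partial>lborel \<partial>lborel)"
  proof (rule nn_integral_cong, goal_cases)
    case (1 x)
    show ?case
      using nn_integral_lborel_translation[of "\<lambda>y. gauss (x - ?P x) * (gauss (y - ?Q y) * f (?P x + ?Q y))" x]
      by (simp add: Qadd R algebra_simps)
  qed
  also have "\<dots> = (\<integral>\<^sup>+y. \<integral>\<^sup>+x. gauss (x - ?P x) * (gauss (x + y - ?Q x - ?Q y) * f (?R x + ?Q y)) \<partial>lborel \<partial>lborel)"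
    by (rule lborel_pair.Fubini') simp
  \<comment> \<open>replace \<open>x\<close> by \<open>x - Q y\<close>, which leaves \<open>P x\<close> unchanged\<close>
  also have "\<dots> = (\<integral>\<^sup>+y. \<integral>\<^sup>+x. gauss (x - ?Q y - ?P x) * (gauss (x + y - ?Q x - ?Q y) * f (?R x)) \<partial>lborel \<partial>lborel)"
  proof (rule nn_integral_cong, goal_cases)
    case (1 y)
    show ?case
      using nn_integral_lborel_translation[of "\<lambda>x. gauss (x - ?P x) * (gauss (x + y - ?Q x - ?Q y) * f (?R x + ?Q y))" "- ?Q y"]
      by (simp add: Padd Qadd R algebra_simps)
  qed
  also have "\<dots> = (\<integral>\<^sup>+x. \<integral>\<^sup>+y. gauss (x - ?Q y - ?P x) * (gauss (x + y - ?Q x - ?Q y) * f (?R x)) \<partial>lborel \<partial>lborel)"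
    by (rule lborel_pair.Fubini') simp
  \<comment> \<open>Pythagoras, once to insert and once to absorb the Gaussian of \<open>Q x - Q y\<close>\<close>
  also have "\<dots> = (\<integral>\<^sup>+x. \<integral>\<^sup>+y. (gauss (x - ?R x) * f (?R x)) * gauss (x + (y - 2 *\<^sub>R ?Q y)) \<partial>lborel \<partial>lborel)"
  proof (intro nn_integral_cong)
    fix x y
    let ?a = "x - ?R x" and ?b = "?Q x - ?Q y" and ?c = "x + y - ?Q x - ?Q y"
    have "?a \<bullet> ?b = 0"
      using closest_point_subspace_in[OF Z] sum V
      by (intro closest_point_subspace_orthogonal[OF V]) (auto simp: orthogonal_sum_def intro!: subspace_diff)
    then have 1: "ennreal (gauss (?a + ?b)) = ennreal (gauss ?a) * ennreal (gauss ?b)" by (rule gauss_orthogonal_add)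
    have "?b \<bullet> ?c = (x - ?Q x) \<bullet> ?b + (y - ?Q y) \<bullet> ?b"
      by (simp add: inner_commute inner_diff_right inner_add_right inner_diff_left)
    also have "\<dots> = 0"
      using closest_point_subspace_in[OF Z] Z closest_point_subspace_orthogonal[OF Z]
      by (simp add: subspace_diff)
    finally have 2: "ennreal (gauss (?b + ?c)) = ennreal (gauss ?b) * ennreal (gauss ?c)" by (rule gauss_orthogonal_add)
    have 3: "?a + ?b = x - ?Q y - ?P x" "?b + ?c = x + (y - 2 *\<^sub>R ?Q y)"
      by (auto simp: R scaleR_2 algebra_simps)
    show "gauss (x - ?Q y - ?P x) * (gauss (x + y - ?Q x - ?Q y) * f (?R x))
      = gauss (x - ?R x) * f (?R x) * gauss (x + (y - 2 *\<^sub>R ?Q y))"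
      using 1 2 unfolding 3 by (simp add: ac_simps)
  qed
  also have "\<dots> = (\<integral>\<^sup>+x. gauss (x - ?R x) * f (?R x) * (\<integral>\<^sup>+y. gauss (x + (y - 2 *\<^sub>R ?Q y)) \<partial>lborel) \<partial>lborel)"
    by (simp add: nn_integral_cmult)
  also have "\<dots> = (\<integral>\<^sup>+x. gauss (x - ?R x) * f (?R x) \<partial>lborel)"
  proof (rule nn_integral_cong, goal_cases)
    case (1 x)
    have "(\<integral>\<^sup>+y. gauss (x + (y - 2 *\<^sub>R ?Q y)) \<partial>lborel) = (\<integral>\<^sup>+y. ennreal (gauss (x + y)) \<partial>lborel)"
      by (rule nn_integral_lborel_orthogonal[OF orthogonal_transformation_reflection[OF Z]]) simp
    also have "\<dots> = (\<integral>\<^sup>+(y::'a). ennreal (gauss y) \<partial>lborel)"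
      by (rule nn_integral_lborel_translation) simp
    finally show ?case
      by (simp add: nn_integral_gauss)
  qed
  finally show ?thesis by (simp add: nn_integral_subspace_lborel[OF V])
qed

lemma closest_point_span_unit:
  fixes e :: "'a::euclidean_space"
  assumes "norm e = 1"
  shows "closest_point (span {e}) x = (x \<bullet> e) *\<^sub>R e"
proof (rule closest_point_subspace_eq)
  show "(x \<bullet> e) *\<^sub>R e \<in> span {e}" by (simp add: span_mul span_base)
  fix v assume "v \<in> span {e}"
  then obtain c where "v = c *\<^sub>R e" by (auto simp: span_singleton)
  moreover have "e \<bullet> e = 1" using assms by (simp add: dot_square_norm)
  ultimately show "(x - (x \<bullet> e) *\<^sub>R e) \<bullet> v = 0"
    by (simp add: inner_diff_left)
qed simp

text \<open>
  The weight in the definition lives on the complement of the line. A one-dimensional Gaussian of mass 1,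
  centred at the coordinate of \<open>x\<close>, is inserted; translating \<open>x\<close> along the line completes the weight to a
  Gaussian in all of \<open>x\<close>, which integrates to 1 and leaves an integral over the line.
\<close>
lemma nn_integral_subspace_lborel_line:
  fixes e :: "'a::euclidean_space" and f :: "'a \<Rightarrow> ennreal"
  assumes e: "norm e = 1" and [measurable]: "f \<in> borel_measurable borel"
  shows "(\<integral>\<^sup>+x. f x \<partial>subspace_lborel (span {e})) = (\<integral>\<^sup>+s. f (s *\<^sub>R e) \<partial>lborel)"
proof -
  have ee: "e \<bullet> e = 1" using e by (simp add: dot_square_norm)
  let ?u = "\<lambda>x. x - (x \<bullet> e) *\<^sub>R e" and ?g = "\<lambda>s::real. ennreal (exp (- pi * s\<^sup>2))"
  have one: "(\<integral>\<^sup>+s. ?g (s - t) \<partial>lborel) = 1" for t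
    using nn_integral_lborel_translation[of ?g "- t"] nn_integral_gauss_real by simp
  have "(\<integral>\<^sup>+x. f x \<partial>subspace_lborel (span {e}))
      = (\<integral>\<^sup>+x. gauss (?u x) * f ((x \<bullet> e) *\<^sub>R e) * (\<integral>\<^sup>+s. ?g (s - x \<bullet> e) \<partial>lborel) \<partial>lborel)"
    unfolding one by (simp add: nn_integral_subspace_lborel closest_point_span_unit[OF e])
  also have "\<dots> = (\<integral>\<^sup>+x. \<integral>\<^sup>+s. gauss (?u x) * f ((x \<bullet> e) *\<^sub>R e) * ?g (s - x \<bullet> e) \<partial>lborel \<partial>lborel)"
    by (simp add: nn_integral_cmult)
  also have "\<dots> = (\<integral>\<^sup>+s. \<integral>\<^sup>+x. gauss (?u x) * f ((x \<bullet> e) *\<^sub>R e) * ?g (s - x \<bullet> e) \<partial>lborel \<partial>lborel)"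
    by (rule lborel_pair.Fubini') simp
  \<comment> \<open>replace \<open>x\<close> by \<open>x + s e\<close> for fixed \<open>s\<close>\<close>
  also have "\<dots> = (\<integral>\<^sup>+s. \<integral>\<^sup>+x. gauss x * f ((s + x \<bullet> e) *\<^sub>R e) \<partial>lborel \<partial>lborel)"
  proof (rule nn_integral_cong, goal_cases)
    case (1 s)
    have "(\<integral>\<^sup>+x. gauss (?u x) * f ((x \<bullet> e) *\<^sub>R e) * ?g (s - x \<bullet> e) \<partial>lborel)
        = (\<integral>\<^sup>+x. gauss (?u x) * f ((s + x \<bullet> e) *\<^sub>R e) * ?g (x \<bullet> e) \<partial>lborel)"
      using nn_integral_lborel_translation[of "\<lambda>x. gauss (?u x) * f ((x \<bullet> e) *\<^sub>R e) * ?g (s - x \<bullet> e)" "s *\<^sub>R e"]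
      by (simp add: inner_add_left ee algebra_simps)
    also have "\<dots> = (\<integral>\<^sup>+x. gauss x * f ((s + x \<bullet> e) *\<^sub>R e) \<partial>lborel)"
    proof (rule nn_integral_cong, goal_cases)
      case (1 x)
      have "ennreal (gauss (?u x + (x \<bullet> e) *\<^sub>R e)) = gauss (?u x) * ennreal (gauss ((x \<bullet> e) *\<^sub>R e))"
        by (rule gauss_orthogonal_add) (simp add: inner_diff_left ee)
      moreover have "gauss ((x \<bullet> e) *\<^sub>R e) = exp (- pi * (x \<bullet> e)\<^sup>2)" by (simp add: gauss_def e)
      ultimately show ?case
        by (simp add: ac_simps)
    qed
    finally show ?case .
  qed
  also have "\<dots> = (\<integral>\<^sup>+x. \<integral>\<^sup>+s. gauss x * f ((s + x \<bullet> e) *\<^sub>R e) \<partial>lborel \<partial>lborel)"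
    by (rule lborel_pair.Fubini') simp
  also have "\<dots> = (\<integral>\<^sup>+x. gauss x * (\<integral>\<^sup>+s. f ((x \<bullet> e + s) *\<^sub>R e) \<partial>lborel) \<partial>(lborel :: 'a measure))"
    by (simp add: nn_integral_cmult add.commute)
  also have "\<dots> = (\<integral>\<^sup>+x. gauss x * (\<integral>\<^sup>+s. f (s *\<^sub>R e) \<partial>lborel) \<partial>(lborel :: 'a measure))"
    using nn_integral_lborel_translation[of "\<lambda>s. f (s *\<^sub>R e)"] by simp
  also have "\<dots> = (\<integral>\<^sup>+s. f (s *\<^sub>R e) \<partial>lborel)"
    by (simp add: nn_integral_multc nn_integral_gauss)
  finally show ?thesis .
qed

section \<open>Products of measures\<close>

abbreviation tuples :: "nat \<Rightarrow> 'a measure \<Rightarrow> (nat \<Rightarrow> 'a) measure" where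
  "tuples q M \<equiv> PiM {..<q} (\<lambda>_. M)"

text \<open>
  Two measures on a product that agree on boxes are equal. This carries every
  one-vector substitution over to tuples of vectors: with a density \<open>w\<close> for the Gaussian description of
  a subspace, and with \<open>w = 1\<close> for rotations and translations.
\<close>
lemma nn_integral_PiM_transfer:
  assumes J: "finite J" and M: "sigma_finite_measure M" and N: "sigma_finite_measure N"
    and g [measurable]: "g \<in> M \<rightarrow>\<^sub>M N" and w [measurable]: "w \<in> borel_measurable M"
    and eq: "\<And>f. f \<in> borel_measurable N \<Longrightarrow> (\<integral>\<^sup>+x. f x \<partial>N) = (\<integral>\<^sup>+x. w x * f (g x) \<partial>M)"
    and f [measurable]: "f \<in> borel_measurable (\<Pi>\<^sub>M j\<in>J. N)"
  shows "(\<integral>\<^sup>+x. f x \<partial>(\<Pi>\<^sub>M j\<in>J. N)) = (\<integral>\<^sup>+x. (\<Prod>j\<in>J. w (x j)) * f (\<lambda>j\<in>J. g (x j)) \<partial>(\<Pi>\<^sub>M j\<in>J. M))"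
proof -
  interpret N: product_sigma_finite "\<lambda>_. N" by (simp add: product_sigma_finite_def N)
  interpret M: product_sigma_finite "\<lambda>_. M" by (simp add: product_sigma_finite_def M)
  let ?P = "distr (density (\<Pi>\<^sub>M j\<in>J. M) (\<lambda>x. \<Prod>j\<in>J. w (x j))) (\<Pi>\<^sub>M j\<in>J. N) (\<lambda>x. \<lambda>j\<in>J. g (x j))"
  have "?P = (\<Pi>\<^sub>M j\<in>J. N)"
  proof (rule N.PiM_eqI[OF J])
    fix A assume A: "\<And>j. j \<in> J \<Longrightarrow> A j \<in> sets N"
    then have [measurable]: "Pi\<^sub>E J A \<in> sets (\<Pi>\<^sub>M j\<in>J. N)" by (intro sets_PiM_I_finite J) auto
    have "emeasure ?P (Pi\<^sub>E J A) = (\<integral>\<^sup>+x. indicator (Pi\<^sub>E J A) x \<partial>?P)"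
      by simp
    also have "\<dots> = (\<integral>\<^sup>+x. (\<Prod>j\<in>J. w (x j)) * indicator (Pi\<^sub>E J A) (\<lambda>j\<in>J. g (x j)) \<partial>(\<Pi>\<^sub>M j\<in>J. M))"
      by (simp add: nn_integral_distr nn_integral_density del: nn_integral_indicator)
    also have "\<dots> = (\<integral>\<^sup>+x. (\<Prod>j\<in>J. w (x j) * indicator (A j) (g (x j))) \<partial>(\<Pi>\<^sub>M j\<in>J. M))"
    proof (rule nn_integral_cong, goal_cases)
      case (1 x)
      have "(indicator (Pi\<^sub>E J A) (\<lambda>j\<in>J. g (x j)) :: ennreal) = (\<Prod>j\<in>J. indicator (A j) (g (x j)))"
        using J by (auto simp: indicator_def PiE_iff prod_zero_iff split: if_splits intro!: prod.neutral[symmetric] prod_zero)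
      then show ?case
        by (simp add: prod.distrib)
    qed
    also have "\<dots> = (\<Prod>j\<in>J. \<integral>\<^sup>+x. w x * indicator (A j) (g x) \<partial>M)"
      using A by (intro M.product_nn_integral_prod J) simp
    also have "\<dots> = (\<Prod>j\<in>J. emeasure N (A j))"
    proof (rule prod.cong[OF refl])
      fix j assume "j \<in> J"
      then show "(\<integral>\<^sup>+x. w x * indicator (A j) (g x) \<partial>M) = emeasure N (A j)"
        using A[of j] eq[of "indicator (A j)"] by simp
    qed
    finally show "emeasure ?P (Pi\<^sub>E J A) = (\<Prod>j\<in>J. emeasure N (A j))" .
  qed simp
  then have "(\<integral>\<^sup>+x. f x \<partial>(\<Pi>\<^sub>M j\<in>J. N)) = (\<integral>\<^sup>+x. f x \<partial>?P)" by simp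
  also have "\<dots> = (\<integral>\<^sup>+x. (\<Prod>j\<in>J. w (x j)) * f (\<lambda>j\<in>J. g (x j)) \<partial>(\<Pi>\<^sub>M j\<in>J. M))"
    by (simp add: nn_integral_distr nn_integral_density)
  finally show ?thesis .
qed

lemma nn_integral_PiM_distr:
  assumes J: "finite J" and M: "sigma_finite_measure M" and N: "sigma_finite_measure N"
    and g [measurable]: "g \<in> M \<rightarrow>\<^sub>M N"
    and eq: "\<And>f. f \<in> borel_measurable N \<Longrightarrow> (\<integral>\<^sup>+x. f x \<partial>N) = (\<integral>\<^sup>+x. f (g x) \<partial>M)"
    and f [measurable]: "f \<in> borel_measurable (\<Pi>\<^sub>M j\<in>J. N)"
  shows "(\<integral>\<^sup>+x. f x \<partial>(\<Pi>\<^sub>M j\<in>J. N)) = (\<integral>\<^sup>+x. f (\<lambda>j\<in>J. g (x j)) \<partial>(\<Pi>\<^sub>M j\<in>J. M))"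
  using nn_integral_PiM_transfer[OF J M N g _ _ f, of "\<lambda>_. 1"] eq by simp

lemma space_PiM_UNIV: "space M = UNIV \<Longrightarrow> space (\<Pi>\<^sub>M j\<in>J. M) = extensional J"
  by (simp add: space_PiM PiE_UNIV_domain PiE_def)

lemma case_nat_extensional:
  "y \<in> extensional {..<q} \<Longrightarrow> case_nat x y \<in> extensional {..<Suc q}"
  by (auto simp: extensional_def split: nat.split)

lemma measurable_case_nat_PiM:
  assumes [measurable]: "f \<in> L \<rightarrow>\<^sub>M M" "g \<in> L \<rightarrow>\<^sub>M tuples q M"
  shows "(\<lambda>x. case_nat (f x) (g x)) \<in> L \<rightarrow>\<^sub>M tuples (Suc q) M"
proof (rule measurable_PiM_single')
  fix i assume i: "i \<in> {..<Suc q}"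
  show "(\<lambda>x. case_nat (f x) (g x) i) \<in> L \<rightarrow>\<^sub>M M"
  proof (cases i)
    case (Suc k)
    then have "k \<in> {..<q}" using i by auto
    then show ?thesis using Suc by simp
  qed simp
next
  show "(\<lambda>x i. case_nat (f x) (g x) i) \<in> space L \<rightarrow> ({..<Suc q} \<rightarrow>\<^sub>E space M)"
    using measurable_space[OF assms(1)] measurable_space[OF assms(2)]
    by (auto simp: space_PiM PiE_iff extensional_def split: nat.split)
qed

text \<open>
  Splitting off the component with index 0 and shifting the others down keeps the index sets
  of the form \<open>{..<q}\<close>, as needed for induction on \<open>q\<close>. Since \<open>y\<close> is undefined from \<open>q\<close> on, \<open>case_nat x y\<close> is
  undefined from \<open>Suc q\<close> on.
\<close>
lemma nn_integral_PiM_Suc: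
  assumes M: "sigma_finite_measure M"
    and f [measurable]: "f \<in> borel_measurable (tuples (Suc q) M)"
  shows "(\<integral>\<^sup>+x. f x \<partial>tuples (Suc q) M) = (\<integral>\<^sup>+x. \<integral>\<^sup>+y. f (case_nat x y) \<partial>tuples q M \<partial>M)"
proof -
  interpret M: sigma_finite_measure M by (rule M)
  interpret M: product_sigma_finite "\<lambda>_. M" by (simp add: product_sigma_finite_def M)
  interpret P: sigma_finite_measure "tuples q M" by (rule M.sigma_finite) simp
  have meas [measurable]: "(\<lambda>(x, y). case_nat x y) \<in> M \<Otimes>\<^sub>M tuples q M \<rightarrow>\<^sub>M tuples (Suc q) M"
    unfolding split_beta' by (rule measurable_case_nat_PiM) simp_all
  let ?P = "distr (M \<Otimes>\<^sub>M tuples q M) (tuples (Suc q) M) (\<lambda>(x, y). case_nat x y)"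
  have "?P = (tuples (Suc q) M)"
  proof (rule M.PiM_eqI)
    fix A assume A: "\<And>j. j \<in> {..<Suc q} \<Longrightarrow> A j \<in> sets M"
    have AS: "A (Suc j) \<in> sets M" if "j < q" for j using A that by auto
    have sub: "x \<in> space M" if "x \<in> A j" "j < Suc q" for x j
      using A[of j] that sets.sets_into_space by auto
    have "(\<lambda>(x, y). case_nat x y) -` Pi\<^sub>E {..<Suc q} A \<inter> space (M \<Otimes>\<^sub>M tuples q M)
        = A 0 \<times> (\<Pi>\<^sub>E j\<in>{..<q}. A (Suc j))" (is "?L = ?R")
    proof (rule Set.set_eqI, rule iffI)
      fix ab assume L: "ab \<in> ?L"
      obtain a b where ab: "ab = (a, b)" by (cases ab)
      have "case_nat a b j \<in> A j" if "j < Suc q" for j using L ab that by (auto simp: PiE_iff)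
      from this[of 0] this[of "Suc j" for j] L ab
      show "ab \<in> ?R" by (auto simp: space_pair_measure space_PiM PiE_iff)
    next
      fix ab assume R: "ab \<in> ?R"
      then obtain a b where ab: "ab = (a, b)" "a \<in> A 0" "b \<in> (\<Pi>\<^sub>E j\<in>{..<q}. A (Suc j))" by auto
      then have "case_nat a b \<in> Pi\<^sub>E {..<Suc q} A"
        by (auto simp: PiE_iff extensional_def split: nat.split)
      moreover have "ab \<in> space (M \<Otimes>\<^sub>M tuples q M)"
        using ab sub[of a 0] sub[of "b j" "Suc j" for j] by (auto simp: space_pair_measure space_PiM PiE_iff)
      ultimately show "ab \<in> ?L" using ab by simp
    qed
    moreover have "Pi\<^sub>E {..<Suc q} A \<in> sets (tuples (Suc q) M)"
      using A by (intro sets_PiM_I_finite) auto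
    ultimately have "emeasure ?P (Pi\<^sub>E {..<Suc q} A)
        = emeasure (M \<Otimes>\<^sub>M tuples q M) (A 0 \<times> (\<Pi>\<^sub>E j\<in>{..<q}. A (Suc j)))"
      by (simp add: emeasure_distr)
    also have "\<dots> = emeasure M (A 0) * (\<Prod>j\<in>{..<q}. emeasure M (A (Suc j)))"
      using A AS M.emeasure_PiM[of "{..<q}" "\<lambda>j. A (Suc j)"]
      by (subst P.emeasure_pair_measure_Times) (auto intro!: sets_PiM_I_finite)
    also have "\<dots> = (\<Prod>j\<in>{..<Suc q}. emeasure M (A j))"
      by (simp add: prod.lessThan_Suc_shift del: prod.lessThan_Suc)
    finally show "emeasure ?P (Pi\<^sub>E {..<Suc q} A) = (\<Prod>j\<in>{..<Suc q}. emeasure M (A j))" .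
  qed simp_all
  then have "(\<integral>\<^sup>+x. f x \<partial>tuples (Suc q) M) = (\<integral>\<^sup>+x. f x \<partial>?P)" by simp
  also have "\<dots> = (\<integral>\<^sup>+x. \<integral>\<^sup>+y. f (case_nat x y) \<partial>tuples q M \<partial>M)"
    by (subst nn_integral_distr) (auto simp: P.nn_integral_fst[symmetric] split_beta')
  finally show ?thesis .
qed

lemma sigma_finite_PiM_subspace_lborel:
  fixes V :: "'a::euclidean_space set"
  assumes "subspace V" "finite J"
  shows "sigma_finite_measure (\<Pi>\<^sub>M j\<in>J. subspace_lborel V)"
proof -
  interpret product_sigma_finite "\<lambda>_. subspace_lborel V"
    by (simp add: product_sigma_finite_def sigma_finite_subspace_lborel assms)
  show ?thesis by (rule sigma_finite) fact
qed

section \<open>Polar coordinates in a subspace\<close>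

text \<open>
  The Gaussian description agrees with coordinates in any orthonormal basis: the basis vectors are
  added one at a time, each contributing an orthogonal line.
\<close>
lemma nn_integral_span_orthonormal:
  fixes B :: "'a::euclidean_space set" and f :: "'a \<Rightarrow> ennreal"
  assumes "finite B" "pairwise orthogonal B" "\<And>b. b \<in> B \<Longrightarrow> norm b = 1"
    and "f \<in> borel_measurable borel"
  shows "(\<integral>\<^sup>+x. f x \<partial>subspace_lborel (span B)) = (\<integral>\<^sup>+c. f (\<Sum>b\<in>B. c b *\<^sub>R b) \<partial>(\<Pi>\<^sub>M b\<in>B. (lborel :: real measure)))"
  using assms
proof (induction B arbitrary: f rule: finite_induct)
  case empty
  note [measurable] = empty.prems(3)
  have "closest_point {0} x = 0" for x :: 'a by (rule closest_point_orthogonal_zero) auto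
  then show ?case
    by (simp add: nn_integral_subspace_lborel subspace_single_0 nn_integral_multc nn_integral_gauss
        PiM_empty nn_integral_count_space_finite)
next
  case (insert b B)
  note [measurable] = insert.prems(3)
  interpret product_sigma_finite "\<lambda>_. lborel :: real measure"
    by (simp add: product_sigma_finite_def sigma_finite_lborel)
  have nb: "norm b = 1" and pB: "pairwise orthogonal B" and nB: "\<And>b. b \<in> B \<Longrightarrow> norm b = 1"
    using insert.prems by (auto simp: pairwise_insert)
  have orth: "orthogonal b c" if "c \<in> B" for c
    using insert.prems(1) insert.hyps(2) that by (auto simp: pairwise_insert)
  have sum: "orthogonal_sum (span {b}) (span B) (span (insert b B))"
  proof (rule orthogonal_sumI)
    show "w \<bullet> z = 0" if "w \<in> span {b}" "z \<in> span B" for w z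
      using that orthogonal_to_span[OF that(2), of b] orth
      by (auto simp: span_singleton orthogonal_def)
    show "\<exists>w\<in>span {b}. v - w \<in> span B" if "v \<in> span (insert b B)" for v
      using that by (auto simp: span_breakdown_eq span_singleton)
  qed (auto intro!: span_mono)
  have "(\<integral>\<^sup>+x. f x \<partial>subspace_lborel (span (insert b B)))
      = (\<integral>\<^sup>+w. \<integral>\<^sup>+z. f (w + z) \<partial>subspace_lborel (span B) \<partial>subspace_lborel (span {b}))"
    by (rule nn_integral_subspace_lborel_orthogonal_sum[OF sum]) fact
  also have "\<dots> = (\<integral>\<^sup>+s. \<integral>\<^sup>+z. f (s *\<^sub>R b + z) \<partial>subspace_lborel (span B) \<partial>lborel)"
  proof (rule nn_integral_subspace_lborel_line[OF nb])
    interpret sigma_finite_measure "subspace_lborel (span B)" by (rule sigma_finite_subspace_lborel) simp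
    show "(\<lambda>x. \<integral>\<^sup>+z. f (x + z) \<partial>subspace_lborel (span B)) \<in> borel_measurable borel" by measurable
  qed
  also have "\<dots> = (\<integral>\<^sup>+s. \<integral>\<^sup>+c. f (s *\<^sub>R b + (\<Sum>b\<in>B. c b *\<^sub>R b)) \<partial>(\<Pi>\<^sub>M b\<in>B. (lborel :: real measure)) \<partial>lborel)"
    by (intro nn_integral_cong insert.IH[OF pB nB]) auto
  also have "\<dots> = (\<integral>\<^sup>+s. \<integral>\<^sup>+c. f (\<Sum>a\<in>insert b B. (c(b := s)) a *\<^sub>R a) \<partial>(\<Pi>\<^sub>M b\<in>B. (lborel :: real measure)) \<partial>lborel)"
  proof (intro nn_integral_cong)
    fix s and c :: "'a \<Rightarrow> real"
    have "(\<Sum>a\<in>B. (c(b := s)) a *\<^sub>R a) = (\<Sum>a\<in>B. c a *\<^sub>R a)"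
      using insert.hyps by (intro sum.cong) auto
    then show "f (s *\<^sub>R b + (\<Sum>b\<in>B. c b *\<^sub>R b)) = f (\<Sum>a\<in>insert b B. (c(b := s)) a *\<^sub>R a)"
      by (simp only: sum.insert[OF insert.hyps] fun_upd_same)
  qed
  also have "\<dots> = (\<integral>\<^sup>+c. f (\<Sum>b\<in>insert b B. c b *\<^sub>R b) \<partial>(\<Pi>\<^sub>M b\<in>insert b B. (lborel :: real measure)))"
    by (rule product_nn_integral_insert_rev[symmetric]) (use insert.hyps in auto)
  finally show ?case .
qed

lemma emeasure_subspace_lborel_cball:
  fixes V :: "'a::euclidean_space set"
  assumes V: "subspace V" and r: "r > 0"
  shows "emeasure (subspace_lborel V) (cball 0 r) = ennreal (unit_ball_vol (real (dim V)) * r ^ dim V)"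
proof -
  obtain B where B: "B \<subseteq> V" "pairwise orthogonal B" "\<And>x. x \<in> B \<Longrightarrow> norm x = 1"
    "independent B" "card B = dim V" "span B = V"
    using orthonormal_basis_subspace[OF V] by blast
  have fin: "finite B" using B(4) by (rule independent_imp_finite)
  have norm: "norm (\<Sum>b\<in>B. c b *\<^sub>R b) = sqrt (\<Sum>b\<in>B. (c b)\<^sup>2)" for c
  proof -
    have "(norm (\<Sum>b\<in>B. c b *\<^sub>R b))\<^sup>2 = (\<Sum>b\<in>B. (norm (c b *\<^sub>R b))\<^sup>2)"
      using B(2) fin by (intro norm_sum_Pythagorean) (auto simp: pairwise_def orthogonal_clauses)
    also have "\<dots> = (\<Sum>b\<in>B. (c b)\<^sup>2)" using B(3) by simp
    finally show ?thesis by (metis norm_ge_zero real_sqrt_unique)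
  qed
  let ?L = "\<Pi>\<^sub>M b\<in>B. (lborel :: real measure)"
  have "emeasure (subspace_lborel V) (cball 0 r) = (\<integral>\<^sup>+x. indicator (cball 0 r) x \<partial>subspace_lborel (span B))"
    by (simp add: B(6))
  also have "\<dots> = (\<integral>\<^sup>+c. indicator (cball 0 r) (\<Sum>b\<in>B. c b *\<^sub>R b) \<partial>?L)"
    by (rule nn_integral_span_orthonormal[OF fin B(2,3)]) (simp_all add: borel_measurable_indicator)
  also have "\<dots> = (\<integral>\<^sup>+c. indicator ({f. sqrt (\<Sum>i\<in>B. (f i)\<^sup>2) \<le> r} \<inter> space ?L) c \<partial>?L)"
    by (intro nn_integral_cong) (auto simp: norm indicator_def)
  also have "\<dots> = emeasure ?L ({f. sqrt (\<Sum>i\<in>B. (f i)\<^sup>2) \<le> r} \<inter> space ?L)"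
  proof (rule nn_integral_indicator)
    have "{c \<in> space ?L. sqrt (\<Sum>i\<in>B. (c i)\<^sup>2) \<le> r} \<in> sets ?L" by measurable
    then show "{f. sqrt (\<Sum>i\<in>B. (f i)\<^sup>2) \<le> r} \<inter> space ?L \<in> sets ?L"
      by (simp add: Collect_conj_eq Int_commute)
  qed
  also have "\<dots> = ennreal (unit_ball_vol (real (dim V)) * r ^ dim V)"
    using emeasure_cball_aux[OF fin r] by (simp add: B(5))
  finally show ?thesis .
qed

text \<open>The surface area of the unit sphere in dimension \<open>m\<close>. It equals \<open>stiefel_volume m 1\<close>.\<close>
definition sphere_area :: "nat \<Rightarrow> real" where
  "sphere_area m = 2 * pi powr (real m / 2) / Gamma (real m / 2)"

lemma sphere_area_pos: "m > 0 \<Longrightarrow> sphere_area m > 0"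
  by (simp add: sphere_area_def)

lemma sphere_area_unit_ball_vol:
  assumes "m > 0"
  shows "sphere_area m = real m * unit_ball_vol (real m)"
proof -
  have "Gamma (real m / 2 + 1) = real m / 2 * Gamma (real m / 2)"
    using assms by (intro Gamma_plus1) (auto elim!: nonpos_Ints_cases)
  moreover have "Gamma (real m / 2) > 0" using assms by (simp add: Gamma_real_pos)
  ultimately show ?thesis
    unfolding sphere_area_def unit_ball_vol_def using assms by (simp only:) simp
qed

text \<open>
  Both measures give the half-line up to \<open>r\<close> the volume of a ball of radius \<open>r\<close>. For
  \<open>r = 0\<close> the left-hand side is a limit of volumes of shrinking balls.
\<close>
lemma distr_norm_subspace_lborel:
  fixes Z :: "'a::euclidean_space set"
  assumes Z: "subspace Z" and m: "dim Z = Suc m"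
  shows "distr (subspace_lborel Z) borel norm
    = density lborel (\<lambda>r. ennreal (sphere_area (Suc m) * r ^ m) * indicator {0..} r)" (is "?M = ?N")
proof (rule measure_eqI_generator_eq[where E = "range atMost" and \<Omega> = UNIV and A = "\<lambda>n. {..real n}"])
  have pos: "emeasure ?M {..r} = ennreal (unit_ball_vol (Suc m) * r ^ Suc m)" if "r > 0" for r
  proof -
    have "norm -` {..r} = cball (0 :: 'a) r" by auto
    then show ?thesis
      using emeasure_subspace_lborel_cball[OF Z that] by (simp add: emeasure_distr m)
  qed
  have neg: "emeasure ?M {..r} = 0" if "r \<le> 0" for r
  proof -
    have "emeasure ?M {..r} \<le> ennreal (unit_ball_vol (Suc m) * (1 / Suc n) ^ Suc m)" for n
    proof -
      have "r \<le> 1 / Suc n" using that by (rule order_trans) simp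
      then have "emeasure ?M {..r} \<le> emeasure ?M {..1 / Suc n}" by (intro emeasure_mono) auto
      also have "\<dots> = ennreal (unit_ball_vol (Suc m) * (1 / Suc n) ^ Suc m)" by (rule pos) simp
      finally show ?thesis .
    qed
    moreover have "(\<lambda>n. ennreal (unit_ball_vol (Suc m) * (1 / Suc n) ^ Suc m)) \<longlonglongrightarrow> ennreal 0"
    proof -
      have "(\<lambda>n. 1 / real (Suc n)) \<longlonglongrightarrow> 0" by (rule lim_1_over_n[THEN LIMSEQ_Suc])
      then have "(\<lambda>n. unit_ball_vol (Suc m) * (1 / real (Suc n)) ^ Suc m) \<longlonglongrightarrow> unit_ball_vol (Suc m) * 0 ^ Suc m"
        by (intro tendsto_intros)
      then show ?thesis by (intro tendsto_ennrealI) simp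
    qed
    ultimately have "emeasure ?M {..r} \<le> ennreal 0" by (intro LIMSEQ_le_const) auto
    then show ?thesis by simp
  qed
  have N: "emeasure ?N {..r} = ennreal (unit_ball_vol (Suc m) * r ^ Suc m)" if "r \<ge> 0" for r
  proof -
    have "emeasure ?N {..r} = (\<integral>\<^sup>+x. ennreal (sphere_area (Suc m) * x ^ m) * indicator {0..r} x \<partial>lborel)"
      by (subst emeasure_density) (auto intro!: nn_integral_cong simp: indicator_def)
    also have "\<dots> = ennreal (unit_ball_vol (Suc m) * r ^ Suc m - unit_ball_vol (Suc m) * 0 ^ Suc m)"
    proof (rule nn_integral_FTC_Icc)
      fix x :: real assume "x \<in> {0..r}"
      show "DERIV (\<lambda>x. unit_ball_vol (Suc m) * x ^ Suc m) x :> sphere_area (Suc m) * x ^ m"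
        by (rule derivative_eq_intros refl | simp add: sphere_area_unit_ball_vol)+
      show "0 \<le> sphere_area (Suc m) * x ^ m"
        using \<open>x \<in> {0..r}\<close> sphere_area_pos[of "Suc m"] by simp
    qed (use that in auto)
    finally show ?thesis by simp
  qed
  have N0: "emeasure ?N {..r} = 0" if "r \<le> 0" for r
  proof -
    have "emeasure ?N {..r} \<le> emeasure ?N {..0}" using that by (intro emeasure_mono) auto
    then show ?thesis using N[of 0] by simp
  qed
  fix X :: "real set" assume "X \<in> range atMost"
  then obtain r where "X = {..r}" by auto
  then show "emeasure ?M X = emeasure ?N X"
    using pos[of r] N[of r] neg[of r] N0[of r] by (cases "r > 0") auto
next
  show "emeasure ?M {..real i} \<noteq> \<infinity>" for i
  proof -
    have "norm -` {..real i} = cball (0 :: 'a) (real i)" by auto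
    then show ?thesis using emeasure_subspace_lborel_cball_finite[OF Z, of "real i"]
      by (simp add: emeasure_distr)
  qed
  show "Int_stable (range atMost :: real set set)" by (auto simp: Int_stable_def)
  show "(\<Union>i. {..real i}) = UNIV" by (auto simp: real_arch_simple)
qed (auto simp: borel_eq_atMost)

lemma nn_integral_norm_subspace_lborel:
  fixes Z :: "'a::euclidean_space set" and p :: "real \<Rightarrow> ennreal"
  assumes Z: "subspace Z" and m: "dim Z = Suc m" and [measurable]: "p \<in> borel_measurable borel"
  shows "(\<integral>\<^sup>+x. p (norm x) \<partial>subspace_lborel Z)
    = (\<integral>\<^sup>+r. ennreal (sphere_area (Suc m) * r ^ m) * indicator {0..} r * p r \<partial>lborel)"
proof -
  have "(\<integral>\<^sup>+x. p (norm x) \<partial>subspace_lborel Z) = (\<integral>\<^sup>+r. p r \<partial>distr (subspace_lborel Z) borel norm)"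
    by (subst nn_integral_distr) auto
  then show ?thesis
    unfolding distr_norm_subspace_lborel[OF Z m] by (simp add: nn_integral_density)
qed

text \<open>
  In polar coordinates the two sides have the densities \<open>r\<^sup>d\<^sup>-\<^sup>1\<close> with \<open>d\<close> the respective dimension. This
  is the dimension change for a single vector, and the only place where the sphere areas enter.
\<close>
lemma nn_integral_norm_dimension_change:
  fixes Y Z :: "'a::euclidean_space set" and p :: "real \<Rightarrow> ennreal"
  assumes Z: "subspace Z" and Y: "subspace Y" and dim: "dim Y \<le> dim Z" "0 < dim Y"
    and [measurable]: "p \<in> borel_measurable borel"
  shows "(\<integral>\<^sup>+x. p (norm x) \<partial>subspace_lborel Z)
    = ennreal (sphere_area (dim Z) / sphere_area (dim Y)) *
      (\<integral>\<^sup>+x. ennreal (norm x ^ (dim Z - dim Y)) * p (norm x) \<partial>subspace_lborel Y)"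
proof -
  obtain k where k: "dim Y = Suc k" using dim(2) not0_implies_Suc by blast
  obtain m where m: "dim Z = Suc m" using dim not0_implies_Suc by (metis le_zero_eq not_gr_zero)
  let ?a = "sphere_area (Suc m)" and ?b = "sphere_area (Suc k)"
  have ab: "0 < ?a" "0 < ?b" by (auto intro: sphere_area_pos)
  have km: "r ^ k * r ^ (m - k) = r ^ m" for r :: real
    using dim k m by (simp flip: power_add)
  have "ennreal (?a / ?b) * (\<integral>\<^sup>+x. ennreal (norm x ^ (m - k)) * p (norm x) \<partial>subspace_lborel Y)
      = (\<integral>\<^sup>+r. ennreal (?a / ?b) * (ennreal (?b * r ^ k) * indicator {0..} r * (ennreal (r ^ (m - k)) * p r)) \<partial>lborel)"
    by (subst nn_integral_norm_subspace_lborel[OF Y k, of "\<lambda>r. ennreal (r ^ (m - k)) * p r"])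
      (auto simp: nn_integral_cmult)
  also have "\<dots> = (\<integral>\<^sup>+r. ennreal (?a * r ^ m) * indicator {0..} r * p r \<partial>lborel)"
  proof (intro nn_integral_cong)
    fix r :: real
    show "ennreal (?a / ?b) * (ennreal (?b * r ^ k) * indicator {0..} r * (ennreal (r ^ (m - k)) * p r))
      = ennreal (?a * r ^ m) * indicator {0..} r * p r"
    proof (cases "r \<ge> 0")
      case True
      then have "ennreal (?a / ?b) * (ennreal (?b * r ^ k) * ennreal (r ^ (m - k))) = ennreal (?a * r ^ m)"
        using ab by (simp add: ennreal_mult'[symmetric] km[symmetric] field_simps)
      then show ?thesis using True by (simp add: indicator_def mult.assoc[symmetric])
    qed simp
  qed
  finally show ?thesis
    by (simp add: k m nn_integral_norm_subspace_lborel[OF Z m])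
qed

section \<open>Volumes of parallelotopes\<close>

definition gram_det :: "nat \<Rightarrow> (nat \<Rightarrow> 'a::euclidean_space) \<Rightarrow> real" where
  "gram_det q y = Determinant.det (Matrix.mat q q (\<lambda>(i, j). y i \<bullet> y j))"

text \<open>The Gram determinant of \<open>q\<close> vectors is the square of the volume of the parallelotope spanned by them.\<close>
definition parallelotope_volume :: "nat \<Rightarrow> (nat \<Rightarrow> 'a::euclidean_space) \<Rightarrow> real" where
  "parallelotope_volume q y = sqrt (gram_det q y)"

lemma gram_det_cong: "(\<And>i j. i < q \<Longrightarrow> j < q \<Longrightarrow> x i \<bullet> x j = y i \<bullet> y j) \<Longrightarrow> gram_det q x = gram_det q y"
  unfolding gram_det_def by (intro arg_cong[where f = Determinant.det] eq_matI) auto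

lemma gram_det_0: "gram_det 0 y = 1"
  unfolding gram_det_def by (rule det_dim_zero) simp

text \<open>
  Base times height. With \<open>s\<^sub>j\<close> the component of \<open>y\<^sub>j\<^sub>+\<^sub>1\<close> along \<open>e\<close> and \<open>W\<close> the Gram matrix of the
  components \<open>w\<^sub>j\<close> orthogonal to \<open>e\<close>, the Gram matrix of \<open>y\<close> has the blocks \<open>r\<^sup>2\<close>, \<open>r s\<^sup>T\<close>, \<open>r s\<close>, \<open>s s\<^sup>T + W\<close>. It is
  the product of the lower triangular matrix with blocks \<open>r\<close>, \<open>s\<close>, \<open>1\<close> and the upper triangular one with
  blocks \<open>r\<close>, \<open>s\<^sup>T\<close>, \<open>W\<close>.
\<close>
lemma gram_det_Suc:
  fixes y :: "nat \<Rightarrow> 'a::euclidean_space"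
  assumes e: "norm e = 1" and y0: "y 0 = r *\<^sub>R e"
  shows "gram_det (Suc q) y = r\<^sup>2 * gram_det q (\<lambda>j. y (Suc j) - (y (Suc j) \<bullet> e) *\<^sub>R e)"
proof -
  have ee: "e \<bullet> e = 1" using e by (simp add: dot_square_norm)
  define w where "w = (\<lambda>j. y (Suc j) - (y (Suc j) \<bullet> e) *\<^sub>R e)"
  let ?s = "Matrix.mat q 1 (\<lambda>(i, j). y (Suc i) \<bullet> e)" and ?t = "Matrix.mat 1 q (\<lambda>(i, j). y (Suc j) \<bullet> e)"
  let ?r = "Matrix.mat 1 1 (\<lambda>_. r)" and ?W = "Matrix.mat q q (\<lambda>(i, j). w i \<bullet> w j)"
  let ?A = "four_block_mat ?r (0\<^sub>m 1 q) ?s (1\<^sub>m q)" and ?B = "four_block_mat ?r ?t (0\<^sub>m q 1) ?W"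
  have ww: "w i \<bullet> w j = y (Suc i) \<bullet> y (Suc j) - (y (Suc i) \<bullet> e) * (y (Suc j) \<bullet> e)" for i j
    by (simp add: w_def inner_diff_left inner_diff_right ee inner_commute)
  have "?A * ?B = four_block_mat (?r * ?r + 0\<^sub>m 1 q * 0\<^sub>m q 1) (?r * ?t + 0\<^sub>m 1 q * ?W)
      (?s * ?r + 1\<^sub>m q * 0\<^sub>m q 1) (?s * ?t + 1\<^sub>m q * ?W)"
    by (rule mult_four_block_mat) auto
  also have "\<dots> = Matrix.mat (Suc q) (Suc q) (\<lambda>(i, j). y i \<bullet> y j)"
    by (rule eq_matI) (auto simp: ww y0 ee inner_commute scalar_prod_def less_Suc_eq_0_disj
        power2_eq_square)
  finally have "gram_det (Suc q) y = Determinant.det (?A * ?B)" by (simp add: gram_det_def)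
  also have "\<dots> = Determinant.det ?A * Determinant.det ?B"
    by (rule det_mult[of _ "1 + q"]) (auto intro!: four_block_carrier_mat)
  also have "Determinant.det ?A = Determinant.det ?r * Determinant.det (1\<^sub>m q :: real Matrix.mat)"
    by (rule det_four_block_mat_upper_right_zero) auto
  also have "Determinant.det ?B = Determinant.det ?r * Determinant.det ?W"
    by (rule det_four_block_mat_lower_left_zero) auto
  also have "Determinant.det ?r = r" by (simp add: det_single)
  finally show ?thesis by (simp add: gram_det_def w_def power2_eq_square)
qed

lemma gram_det_nonneg:
  fixes y :: "nat \<Rightarrow> 'a::euclidean_space"
  shows "0 \<le> gram_det q y"
proof (induction q arbitrary: y)
  case 0
  show ?case by (simp add: gram_det_0)
next
  case (Suc q)
  obtain r and e :: 'a where "norm e = 1" "y 0 = r *\<^sub>R e"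
  proof (cases "y 0 = 0")
    case True
    obtain e :: 'a where "e \<in> Basis" using nonempty_Basis by blast
    then show ?thesis using that[of e 0] True by simp
  next
    case False
    then show ?thesis using that[of "y 0 /\<^sub>R norm (y 0)" "norm (y 0)"] by simp
  qed
  then show ?case using Suc.IH by (subst gram_det_Suc) auto
qed

lemma measurable_gram_det [measurable]:
  fixes f :: "'b \<Rightarrow> nat \<Rightarrow> 'a::euclidean_space"
  assumes "\<And>j. j < q \<Longrightarrow> (\<lambda>x. f x j) \<in> borel_measurable L"
  shows "(\<lambda>x. gram_det q (f x)) \<in> borel_measurable L"
proof -
  have *: "gram_det q y = (\<Sum>p | p permutes {0..<q}. signof p * (\<Prod>i = 0..<q. y i \<bullet> y (p i)))" for y :: "nat \<Rightarrow> 'a"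
    unfolding gram_det_def by (subst det_def') (auto simp: permutes_in_image intro!: sum.cong prod.cong)
  have "(\<lambda>x. f x (p i)) \<in> borel_measurable L" if "p permutes {0..<q}" "i \<in> {0..<q}" for p i
    using that assms permutes_in_image[of p "{0..<q}" i] by auto
  then show ?thesis
    unfolding * using assms
    by (intro borel_measurable_sum borel_measurable_times borel_measurable_const borel_measurable_prod
        borel_measurable_inner) auto
qed

lemma parallelotope_volume_nonneg [simp]: "0 \<le> parallelotope_volume q y"
  by (simp add: parallelotope_volume_def gram_det_nonneg)

lemma parallelotope_volume_0 [simp]: "parallelotope_volume 0 y = 1"
  by (simp add: parallelotope_volume_def gram_det_0)

lemma parallelotope_volume_Suc:
  assumes "norm e = 1" "y 0 = r *\<^sub>R e" "0 \<le> r"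
  shows "parallelotope_volume (Suc q) y =
    r * parallelotope_volume q (\<lambda>j. y (Suc j) - (y (Suc j) \<bullet> e) *\<^sub>R e)"
  unfolding parallelotope_volume_def using assms(3)
  by (simp only: gram_det_Suc[of e y r q, OF assms(1,2)] real_sqrt_mult real_sqrt_abs abs_of_nonneg)

lemma parallelotope_volume_cong:
  "(\<And>i j. i < q \<Longrightarrow> j < q \<Longrightarrow> x i \<bullet> x j = y i \<bullet> y j) \<Longrightarrow> parallelotope_volume q x = parallelotope_volume q y"
  unfolding parallelotope_volume_def by (subst gram_det_cong) auto

lemma measurable_parallelotope_volume [measurable]:
  assumes "\<And>j. j < q \<Longrightarrow> (\<lambda>x. f x j) \<in> borel_measurable L"
  shows "(\<lambda>x. parallelotope_volume q (f x)) \<in> borel_measurable L"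
  unfolding parallelotope_volume_def using measurable_gram_det[OF assms] by simp

lemma simplex_volume_eq:
  "simplex_volume q x = parallelotope_volume q (\<lambda>j. x (Suc j) - x 0) / fact q"
  by (simp add: simplex_volume_def parallelotope_volume_def gram_det_def)

section \<open>Invariant functions and change of dimension\<close>

lemma sets_PiM_subspace_lborel [simp, measurable_cong]:
  "sets (\<Pi>\<^sub>M j\<in>J. subspace_lborel V) = sets (\<Pi>\<^sub>M j\<in>J. borel)"
  by (rule sets_PiM_cong) auto

lemma space_PiM_subspace_lborel [simp]:
  "space (\<Pi>\<^sub>M j\<in>J. subspace_lborel V) = extensional J"
  by (simp add: space_PiM_UNIV)

lemma borel_measurable_nn_integral_PiM_subspace:
  fixes V :: "'a::euclidean_space set"
  assumes "subspace V" "finite J" and [measurable]: "case_prod f \<in> borel_measurable (L \<Otimes>\<^sub>M (\<Pi>\<^sub>M j\<in>J. borel))"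
  shows "(\<lambda>x. \<integral>\<^sup>+y. f x y \<partial>(\<Pi>\<^sub>M j\<in>J. subspace_lborel V)) \<in> borel_measurable L"
proof -
  interpret sigma_finite_measure "\<Pi>\<^sub>M j\<in>J. subspace_lborel V"
    by (rule sigma_finite_PiM_subspace_lborel) fact+
  show ?thesis by measurable
qed

text \<open>
  Invariance under the orthogonal transformations that fix \<open>W\<close> pointwise. The restriction to \<open>{..<q}\<close> keeps
  the transformed tuple in the space of the product measure.
\<close>
definition stabilizer_invariant :: "'a::euclidean_space set \<Rightarrow> nat \<Rightarrow> ((nat \<Rightarrow> 'a) \<Rightarrow> ennreal) \<Rightarrow> bool" where
  "stabilizer_invariant W q h \<longleftrightarrow>
     (\<forall>g y. orthogonal_transformation g \<longrightarrow> (\<forall>w\<in>W. g w = w) \<longrightarrow> y \<in> extensional {..<q} \<longrightarrow>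
        h (\<lambda>j\<in>{..<q}. g (y j)) = h y)"

text \<open>The reflection in the hyperplane orthogonal to \<open>b - c\<close>.\<close>
lemma reflection_exchanging:
  fixes V :: "'a::euclidean_space set"
  assumes V: "subspace V" and "b \<in> V" "c \<in> V" "norm b = norm c"
  obtains g where "orthogonal_transformation g" "g b = c" "g ` V = V"
    "\<And>a. a \<bullet> b = 0 \<Longrightarrow> a \<bullet> c = 0 \<Longrightarrow> g a = a"
proof
  define v where "v = b - c"
  define g where "g = (\<lambda>x. x - 2 *\<^sub>R closest_point (span {v}) x)"
  show "orthogonal_transformation g"
    unfolding g_def by (rule orthogonal_transformation_reflection) simp
  have "v \<bullet> v = 2 * (b \<bullet> v)"
    using assms(4) by (simp add: v_def inner_diff_left inner_diff_right inner_commute norm_eq)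
  then have half: "(b - (1/2) *\<^sub>R v) \<bullet> v = 0" by (simp add: inner_diff_left)
  have "closest_point (span {v}) b = (1/2) *\<^sub>R v"
  proof (rule closest_point_subspace_eq)
    show "(b - (1/2) *\<^sub>R v) \<bullet> u = 0" if "u \<in> span {v}" for u
      using that half by (auto simp: span_singleton)
  qed (auto intro: span_mul span_base)
  then show "g b = c" by (simp add: g_def v_def)
  show "g a = a" if "a \<bullet> b = 0" "a \<bullet> c = 0" for a
  proof -
    have "closest_point (span {v}) a = 0"
    proof (rule closest_point_orthogonal_zero)
      show "a \<bullet> u = 0" if "u \<in> span {v}" for u
        using that \<open>a \<bullet> b = 0\<close> \<open>a \<bullet> c = 0\<close> by (auto simp: span_singleton v_def inner_diff_right)
    qed simp
    then show ?thesis by (simp add: g_def)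
  qed
  have "span {v} \<subseteq> V" using assms by (intro span_minimal) (auto simp: v_def subspace_diff)
  then have gV: "g x \<in> V" if "x \<in> V" for x
    using that closest_point_subspace_in[of "span {v}" x] V
    by (auto simp: g_def intro!: subspace_diff subspace_scale)
  moreover have "g (g x) = x" for x
    using closest_point_subspace_in[of "span {v}" x]
    by (simp add: g_def linear_diff[OF linear_closest_point_subspace] linear_add[OF linear_closest_point_subspace]
        scaleR_2)
  ultimately show "g ` V = V" by (metis image_subset_iff subsetI subset_antisym imageI)
qed

lemma nn_integral_PiM_subspace_lborel_orthogonal:
  fixes V :: "'a::euclidean_space set" and g :: "'a \<Rightarrow> 'a"
  assumes V: "subspace V" and J: "finite J" and g: "orthogonal_transformation g"
    and f [measurable]: "f \<in> borel_measurable (\<Pi>\<^sub>M j\<in>J. borel)"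
  shows "(\<integral>\<^sup>+y. f (\<lambda>j\<in>J. g (y j)) \<partial>(\<Pi>\<^sub>M j\<in>J. subspace_lborel V)) = (\<integral>\<^sup>+y. f y \<partial>(\<Pi>\<^sub>M j\<in>J. subspace_lborel (g ` V)))"
proof (rule nn_integral_PiM_distr[OF J, symmetric])
  have gV: "subspace (g ` V)" by (rule linear_subspace_image[OF orthogonal_transformation_linear[OF g] V])
  show "sigma_finite_measure (subspace_lborel V)" "sigma_finite_measure (subspace_lborel (g ` V))"
    using V gV by (simp_all add: sigma_finite_subspace_lborel)
  show "g \<in> subspace_lborel V \<rightarrow>\<^sub>M subspace_lborel (g ` V)"
    using orthogonal_transformation_measurable[OF g] by measurable
  show "(\<integral>\<^sup>+x. f x \<partial>subspace_lborel (g ` V)) = (\<integral>\<^sup>+x. f (g x) \<partial>subspace_lborel V)"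
    if "f \<in> borel_measurable (subspace_lborel (g ` V))" for f
    using nn_integral_subspace_lborel_orthogonal[OF V g, of f] that by (simp cong: measurable_cong_sets)
qed measurable

text \<open>
  Write the first vector as \<open>a + b\<close> with \<open>a\<close> in \<open>W\<close> and \<open>b\<close> orthogonal to \<open>W\<close>. A reflection that fixes \<open>W\<close>
  pointwise and preserves \<open>V\<close> takes \<open>b\<close> to the multiple of \<open>e\<close> of the same length. By invariance of \<open>h\<close> and of
  Lebesgue measure on \<open>V\<close>, the integral over the remaining vectors does not change.
\<close>
lemma nn_integral_radial_first_vector:
  fixes V :: "'a::euclidean_space set"
  assumes W: "subspace W" and V: "subspace V" and "W \<subseteq> V"
    and e: "e \<in> V \<inter> orthogonal_comp W" "norm e = 1"
    and h [measurable]: "h \<in> borel_measurable (tuples (Suc q) borel)"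
    and inv: "stabilizer_invariant W (Suc q) h"
  shows "(\<integral>\<^sup>+y. h y \<partial>tuples (Suc q) (subspace_lborel V))
    = (\<integral>\<^sup>+a. \<integral>\<^sup>+b. \<integral>\<^sup>+y. h (case_nat (a + norm b *\<^sub>R e) y) \<partial>tuples q (subspace_lborel V)
        \<partial>subspace_lborel (V \<inter> orthogonal_comp W) \<partial>subspace_lborel W)"
proof -
  let ?VV = "tuples q (subspace_lborel V)" and ?Z = "V \<inter> orthogonal_comp W"
  define p where "p x = (\<integral>\<^sup>+y. h (case_nat x y) \<partial>?VV)" for x
  note [measurable] = measurable_case_nat_PiM
  have [measurable]: "p \<in> borel_measurable borel"
    unfolding p_def by (rule borel_measurable_nn_integral_PiM_subspace[OF V]) (simp, measurable)
  have Z: "subspace ?Z" using V by (simp add: subspace_inter subspace_orthogonal_comp)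
  have eq: "p (a + b) = p (a + norm b *\<^sub>R e)" if a: "a \<in> W" and b: "b \<in> ?Z" for a b
  proof -
    obtain g where g: "orthogonal_transformation g" "g b = norm b *\<^sub>R e" "g ` ?Z = ?Z"
      and fixed: "\<And>a. a \<bullet> b = 0 \<Longrightarrow> a \<bullet> norm b *\<^sub>R e = 0 \<Longrightarrow> g a = a"
    proof (rule reflection_exchanging[OF Z b])
      show "norm b *\<^sub>R e \<in> ?Z" using e Z by (intro subspace_scale)
      show "norm b = norm (norm b *\<^sub>R e)" using e by simp
    qed blast
    note lin = orthogonal_transformation_linear[OF g(1)]
    have gW: "g w = w" if "w \<in> W" for w
      by (rule fixed) (use that b e in \<open>auto simp: orthogonal_comp_def orthogonal_def inner_commute\<close>)
    have gV: "g ` V = V"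
    proof -
      have "g v \<in> V \<and> v \<in> g ` V" if v: "v \<in> V" for v
      proof -
        obtain w z where wz: "w \<in> W" "z \<in> ?Z" "v = w + z"
          using orthogonal_sum_complement[OF W V \<open>W \<subseteq> V\<close>] v unfolding orthogonal_sum_def by blast
        have "g z \<in> ?Z" "z \<in> g ` ?Z" using wz g(3) by auto
        then obtain z' where z': "z' \<in> ?Z" "z = g z'" by auto
        have "g v = w + g z" "v = g (w + z')" by (auto simp: wz linear_add[OF lin] gW z'(2)[symmetric])
        moreover have "w + g z \<in> V" "w + z' \<in> V"
          using \<open>g z \<in> ?Z\<close> z' wz \<open>W \<subseteq> V\<close> V by (auto intro!: subspace_add)
        ultimately show ?thesis by auto
      qed
      then show ?thesis by auto
    qed
    have gab: "g (a + b) = a + norm b *\<^sub>R e" by (simp add: linear_add[OF lin] gW a g)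
    have "p (a + norm b *\<^sub>R e) = (\<integral>\<^sup>+y. h (case_nat (g (a + b)) y) \<partial>tuples q (subspace_lborel (g ` V)))"
      by (simp add: p_def gab gV)
    also have "\<dots> = (\<integral>\<^sup>+y. h (case_nat (g (a + b)) (\<lambda>j\<in>{..<q}. g (y j))) \<partial>?VV)"
      by (rule nn_integral_PiM_subspace_lborel_orthogonal[OF V _ g(1), symmetric]) (simp, measurable)
    also have "\<dots> = p (a + b)"
      unfolding p_def
    proof (rule nn_integral_cong, goal_cases)
      case (1 y)
      then have y: "case_nat (a + b) y \<in> extensional {..<Suc q}" by (simp add: case_nat_extensional)
      have "case_nat (g (a + b)) (\<lambda>j\<in>{..<q}. g (y j)) = (\<lambda>j\<in>{..<Suc q}. g (case_nat (a + b) y j))"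
        by (auto simp: fun_eq_iff split: nat.split)
      then show ?case
        using inv g(1) gW y unfolding stabilizer_invariant_def by simp
    qed
    finally show ?thesis ..
  qed
  have "(\<integral>\<^sup>+y. h y \<partial>tuples (Suc q) (subspace_lborel V)) = (\<integral>\<^sup>+x. p x \<partial>subspace_lborel V)"
    unfolding p_def by (rule nn_integral_PiM_Suc[OF sigma_finite_subspace_lborel[OF V]]) measurable
  also have "\<dots> = (\<integral>\<^sup>+a. \<integral>\<^sup>+b. p (a + b) \<partial>subspace_lborel ?Z \<partial>subspace_lborel W)"
    by (rule nn_integral_subspace_lborel_orthogonal_sum[OF orthogonal_sum_complement[OF W V \<open>W \<subseteq> V\<close>]]) measurable
  also have "\<dots> = (\<integral>\<^sup>+a. \<integral>\<^sup>+b. p (a + norm b *\<^sub>R e) \<partial>subspace_lborel ?Z \<partial>subspace_lborel W)"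
  proof (rule nn_integral_cong_AE, goal_cases)
    case 1
    show ?case
      using AE_subspace_lborel[OF W]
    proof eventually_elim
      case (elim a)
      show ?case
      proof (rule nn_integral_cong_AE, goal_cases)
        case 1
        show ?case
          using AE_subspace_lborel[OF Z] by eventually_elim (rule eq[OF elim])
      qed
    qed
  qed
  finally show ?thesis unfolding p_def .
qed

text \<open>The quotient of the Stiefel volumes for \<open>n\<close> and \<open>k\<close>, see \<open>stiefel_volume_quotient\<close> below.\<close>
definition dimension_change_const :: "nat \<Rightarrow> nat \<Rightarrow> nat \<Rightarrow> real" where
  "dimension_change_const n k q = (\<Prod>j<q. sphere_area (n - j) / sphere_area (k - j))"

lemma dimension_change_const_Suc:
  "dimension_change_const n k (Suc q) =
     sphere_area n / sphere_area k * dimension_change_const (n - 1) (k - 1) q"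
  unfolding dimension_change_const_def by (subst prod.lessThan_Suc_shift) simp

lemma dimension_change_const_pos:
  "q \<le> k \<Longrightarrow> k \<le> n \<Longrightarrow> 0 < dimension_change_const n k q"
  unfolding dimension_change_const_def by (intro prod_pos) (auto intro!: divide_pos_pos sphere_area_pos)

text \<open>
  Vectors that have already been processed span \<open>W\<close>; the others are measured modulo \<open>W\<close>. In the induction
  step the first vector is reduced to \<open>a + r e\<close> with \<open>e\<close> a unit vector orthogonal to \<open>W\<close>
  (\<open>nn_integral_radial_first_vector\<close>). Once it is fixed, the integrand is invariant under the stabilizer of
  \<open>W' = W + \<real>e\<close>, so the induction hypothesis replaces \<open>V\<close> by \<open>U\<close> for the other vectors, and polar
  coordinates replace \<open>V\<close> by \<open>U\<close> for the first. The two powers \<open>r\<^sup>m\<close> and \<open>(volume modulo W')\<^sup>m\<close> combine to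
  \<open>(volume modulo W)\<^sup>m\<close>, and the radial reduction is undone inside \<open>U\<close> for the weighted integrand \<open>h'\<close>.
  Working with all of \<open>V\<close> and \<open>U\<close> at every stage avoids splitting the remaining vectors along \<open>e\<close>.
\<close>
lemma nn_integral_dimension_change_relative:
  fixes U V W :: "'a::euclidean_space set"
  assumes "subspace W" and U: "subspace U" and V: "subspace V" and "W \<subseteq> U" "U \<subseteq> V"
    and "q \<le> dim U - dim W"
    and "h \<in> borel_measurable (tuples q borel)"
    and "stabilizer_invariant W q h"
  shows "(\<integral>\<^sup>+y. h y \<partial>tuples q (subspace_lborel V)) =
    ennreal (dimension_change_const (dim V - dim W) (dim U - dim W) q) *
    (\<integral>\<^sup>+y. ennreal (parallelotope_volume q (\<lambda>j. y j - closest_point W (y j)) ^ (dim V - dim U)) * h y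
       \<partial>tuples q (subspace_lborel U))"
  using assms
proof (induction q arbitrary: W h)
  case 0
  then show ?case
    by (simp add: PiM_empty nn_integral_count_space_finite dimension_change_const_def)
next
  case (Suc q)
  note W = Suc.prems(1) and WU = Suc.prems(4) and UV = Suc.prems(5)
  note h [measurable] = Suc.prems(7) and inv = Suc.prems(8)
  note [measurable] = measurable_case_nat_PiM
  let ?m = "dim V - dim U" and ?n = "dim V - dim W" and ?k = "dim U - dim W"
  let ?UU = "tuples q (subspace_lborel U)" and ?VV = "tuples q (subspace_lborel V)"
  let ?Y = "U \<inter> orthogonal_comp W" and ?Z = "V \<inter> orthogonal_comp W"
  have Y: "subspace ?Y" and Z: "subspace ?Z"
    using U V by (simp_all add: subspace_inter subspace_orthogonal_comp)
  have dimY: "dim ?Y = ?k" and dimZ: "dim ?Z = ?n"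
    using dim_orthogonal_sum[OF orthogonal_sum_complement[OF W U WU]]
      dim_orthogonal_sum[OF orthogonal_sum_complement[OF W V]] WU UV by auto
  have dims: "dim W \<le> dim U" "dim U \<le> dim V" using WU UV by (auto intro: dim_subset)
  obtain e where e: "e \<in> ?Y" "norm e = 1"
  proof -
    have "dim ?Y \<noteq> 0" using dimY Suc.prems(6) by simp
    then obtain y where "y \<in> ?Y" "y \<noteq> 0" by (auto simp: dim_eq_0)
    then show ?thesis using subspace_scale[OF Y, of y "inverse (norm y)"] by (intro that[of "y /\<^sub>R norm y"]) auto
  qed
  have eW: "w \<bullet> e = 0" if "w \<in> W" for w
    using e that by (auto simp: orthogonal_comp_def orthogonal_def inner_commute)
  define W' where "W' = span (insert e W)"
  have sum: "orthogonal_sum W (span {e}) W'"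
  proof (rule orthogonal_sumI)
    show "\<exists>w\<in>W. v - w \<in> span {e}" if "v \<in> W'" for v
    proof -
      obtain c where c: "v - c *\<^sub>R e \<in> span W" using \<open>v \<in> W'\<close> by (auto simp: W'_def span_breakdown_eq)
      then show ?thesis
        using W by (intro bexI[of _ "v - c *\<^sub>R e"]) (auto simp: span_singleton span_eq_iff[THEN iffD2])
    qed
    show "w \<bullet> z = 0" if "w \<in> W" "z \<in> span {e}" for w z
      using that eW by (auto simp: span_singleton)
    show "W \<subseteq> W'" by (auto simp: W'_def intro: span_base)
    show "span {e} \<subseteq> W'" unfolding W'_def by (rule span_mono) auto
  qed (use W in \<open>auto simp: W'_def\<close>)
  have W': "subspace W'" and cpW': "closest_point W' x = closest_point W x + (x \<bullet> e) *\<^sub>R e" for x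
    using closest_point_orthogonal_sum[OF sum] closest_point_span_unit[OF e(2)] by (auto simp: W'_def)
  have W'U: "W' \<subseteq> U" unfolding W'_def using WU e(1) U by (intro span_minimal) auto
  have "e \<noteq> 0" using e(2) by auto
  then have dimW': "dim W' = Suc (dim W)"
    using dim_orthogonal_sum[OF sum] by simp
  define C where "C = dimension_change_const (?n - 1) (?k - 1) q"
  define wt where "wt = (\<lambda>y. ennreal (parallelotope_volume q (\<lambda>j. y j - closest_point W' (y j)) ^ ?m))"
  define I where "I a r = (\<integral>\<^sup>+y. wt y * h (case_nat (a + r *\<^sub>R e) y) \<partial>?UU)" for a r
  have IH: "(\<integral>\<^sup>+y. h (case_nat (a + r *\<^sub>R e) y) \<partial>?VV) = ennreal C * I a r" if a: "a \<in> W" for a r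
  proof -
    have "stabilizer_invariant W' q (\<lambda>y. h (case_nat (a + r *\<^sub>R e) y))"
      unfolding stabilizer_invariant_def
    proof (intro allI impI)
      fix g and y :: "nat \<Rightarrow> 'a"
      assume g: "orthogonal_transformation g" "\<forall>w\<in>W'. g w = w" and y: "y \<in> extensional {..<q}"
      have "a + r *\<^sub>R e \<in> W'" unfolding W'_def
        using a by (intro span_add span_mul) (auto intro: span_base)
      then have "case_nat (a + r *\<^sub>R e) (\<lambda>j\<in>{..<q}. g (y j)) = (\<lambda>j\<in>{..<Suc q}. g (case_nat (a + r *\<^sub>R e) y j))"
        using g(2) by (auto simp: fun_eq_iff split: nat.split)
      moreover have "\<forall>w\<in>W. g w = w" using g(2) by (auto simp: W'_def intro: span_base)
      ultimately show "h (case_nat (a + r *\<^sub>R e) (\<lambda>j\<in>{..<q}. g (y j))) = h (case_nat (a + r *\<^sub>R e) y)"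
        using inv g(1) case_nat_extensional[OF y] unfolding stabilizer_invariant_def by simp
    qed
    moreover have "(\<lambda>y. h (case_nat (a + r *\<^sub>R e) y)) \<in> borel_measurable (tuples q borel)" by measurable
    ultimately show ?thesis
      using Suc.IH[OF W' U V W'U UV, of "\<lambda>y. h (case_nat (a + r *\<^sub>R e) y)"] Suc.prems(6)
      by (simp add: dimW' I_def wt_def C_def)
  qed
  have [measurable]: "closest_point W' \<in> borel_measurable borel" "closest_point W \<in> borel_measurable borel"
    using W W' by (simp_all add: measurable_closest_point_subspace)
  have wt [measurable]: "wt \<in> borel_measurable (tuples q borel)"
    unfolding wt_def by measurable
  define h' where "h' x = ennreal (parallelotope_volume (Suc q) (\<lambda>j. x j - closest_point W (x j)) ^ ?m) * h x" for x
  have h' [measurable]: "h' \<in> borel_measurable (tuples (Suc q) borel)"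
    unfolding h'_def by measurable
  have h'_case: "h' (case_nat (a + r *\<^sub>R e) y) = ennreal (r ^ ?m) * (wt y * h (case_nat (a + r *\<^sub>R e) y))"
    if a: "a \<in> W" and r: "0 \<le> r" for a r y
  proof -
    have "closest_point W e = 0" by (rule closest_point_orthogonal_zero[OF W]) (use eW in \<open>simp add: inner_commute\<close>)
    then have "closest_point W (a + r *\<^sub>R e) = a"
      using a W by (simp add: linear_add[OF linear_closest_point_subspace] linear_scale[OF linear_closest_point_subspace])
    moreover have "closest_point W x \<bullet> e = 0" for x using eW closest_point_subspace_in[OF W] by auto
    ultimately have "parallelotope_volume (Suc q) (\<lambda>j. case_nat (a + r *\<^sub>R e) y j - closest_point W (case_nat (a + r *\<^sub>R e) y j))
      = r * parallelotope_volume q (\<lambda>j. y j - closest_point W' (y j))"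
      by (subst parallelotope_volume_Suc[OF e(2) _ r]) (simp_all add: cpW' inner_diff_left algebra_simps)
    then show ?thesis
      using r by (simp add: h'_def wt_def power_mult_distrib ennreal_mult' mult.assoc)
  qed
  have inv': "stabilizer_invariant W (Suc q) h'"
    unfolding stabilizer_invariant_def
  proof (intro allI impI)
    fix g and y :: "nat \<Rightarrow> 'a"
    assume g: "orthogonal_transformation g" "\<forall>w\<in>W. g w = w" and y: "y \<in> extensional {..<Suc q}"
    have lin: "linear g" by (rule orthogonal_transformation_linear[OF g(1)])
    have "g ` W = W" using g(2) by auto
    then have "closest_point W (g x) = g (closest_point W x)" for x
      using closest_point_orthogonal_image[OF W g(1), of x] by simp
    then have "g x - closest_point W (g x) = g (x - closest_point W x)" for x
      by (simp add: linear_diff[OF lin])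
    then have "parallelotope_volume (Suc q) (\<lambda>j. (\<lambda>j\<in>{..<Suc q}. g (y j)) j - closest_point W ((\<lambda>j\<in>{..<Suc q}. g (y j)) j))
      = parallelotope_volume (Suc q) (\<lambda>j. y j - closest_point W (y j))"
      using g(1) by (intro parallelotope_volume_cong) (simp add: orthogonal_transformation_def)
    moreover have "h (\<lambda>j\<in>{..<Suc q}. g (y j)) = h y"
      using inv g y unfolding stabilizer_invariant_def by blast
    ultimately show "h' (\<lambda>j\<in>{..<Suc q}. g (y j)) = h' y" unfolding h'_def by simp
  qed
  define c where "c = sphere_area ?n / sphere_area ?k"
  have "0 < ?k" "0 < ?n" using Suc.prems(6) dims by auto
  then have c: "0 \<le> c" by (simp add: c_def sphere_area_pos less_imp_le)
  have "(\<integral>\<^sup>+y. h y \<partial>tuples (Suc q) (subspace_lborel V))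
     = (\<integral>\<^sup>+a. \<integral>\<^sup>+b. \<integral>\<^sup>+y. h (case_nat (a + norm b *\<^sub>R e) y) \<partial>?VV \<partial>subspace_lborel ?Z \<partial>subspace_lborel W)"
    by (rule nn_integral_radial_first_vector[OF W V _ _ e(2) h inv]) (use e(1) WU UV in auto)
  also have "\<dots> = (\<integral>\<^sup>+a. ennreal (c * C) * (\<integral>\<^sup>+b. \<integral>\<^sup>+y. h' (case_nat (a + norm b *\<^sub>R e) y) \<partial>?UU \<partial>subspace_lborel ?Y) \<partial>subspace_lborel W)"
  proof (rule nn_integral_cong_AE, goal_cases)
    case 1
    show ?case
      using AE_subspace_lborel[OF W]
    proof eventually_elim
      case (elim a)
      have [measurable]: "I a \<in> borel_measurable borel"
        unfolding I_def by (rule borel_measurable_nn_integral_PiM_subspace[OF U]) (simp, measurable)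
      have "(\<integral>\<^sup>+b. \<integral>\<^sup>+y. h (case_nat (a + norm b *\<^sub>R e) y) \<partial>?VV \<partial>subspace_lborel ?Z)
          = (\<integral>\<^sup>+b. ennreal C * I a (norm b) \<partial>subspace_lborel ?Z)"
        by (simp add: IH[OF elim])
      also have "\<dots> = ennreal c * (\<integral>\<^sup>+b. ennreal (norm b ^ ?m) * (ennreal C * I a (norm b)) \<partial>subspace_lborel ?Y)"
        using nn_integral_norm_dimension_change[OF Z Y, of "\<lambda>r. ennreal C * I a r"] dims \<open>0 < ?k\<close>
        by (simp add: dimY dimZ c_def)
      also have "\<dots> = ennreal c * (ennreal C * (\<integral>\<^sup>+b. ennreal (norm b ^ ?m) * I a (norm b) \<partial>subspace_lborel ?Y))"
        by (subst nn_integral_cmult[symmetric]) (auto simp: ac_simps)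
      also have "\<dots> = ennreal (c * C) * (\<integral>\<^sup>+b. ennreal (norm b ^ ?m) * I a (norm b) \<partial>subspace_lborel ?Y)"
        using c by (simp add: ennreal_mult' mult.assoc)
      also have "(\<lambda>b. ennreal (norm b ^ ?m) * I a (norm b)) = (\<lambda>b. \<integral>\<^sup>+y. h' (case_nat (a + norm b *\<^sub>R e) y) \<partial>?UU)"
        unfolding I_def by (subst nn_integral_cmult[symmetric]) (simp_all add: h'_case[OF elim])
      finally show ?case .
    qed
  qed
  also have "\<dots> = ennreal (c * C) * (\<integral>\<^sup>+a. \<integral>\<^sup>+b. \<integral>\<^sup>+y. h' (case_nat (a + norm b *\<^sub>R e) y) \<partial>?UU \<partial>subspace_lborel ?Y \<partial>subspace_lborel W)"
  proof (rule nn_integral_cmult)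
    interpret sigma_finite_measure "subspace_lborel ?Y" by (rule sigma_finite_subspace_lborel[OF Y])
    have "(\<lambda>(a, b). \<integral>\<^sup>+y. h' (case_nat (a + norm b *\<^sub>R e) y) \<partial>?UU) \<in> borel_measurable (borel \<Otimes>\<^sub>M borel)"
      unfolding split_beta' by (rule borel_measurable_nn_integral_PiM_subspace[OF U]) (simp, measurable)
    then show "(\<lambda>a. \<integral>\<^sup>+b. \<integral>\<^sup>+y. h' (case_nat (a + norm b *\<^sub>R e) y) \<partial>?UU \<partial>subspace_lborel ?Y) \<in> borel_measurable (subspace_lborel W)"
      by measurable
  qed
  also have "(\<integral>\<^sup>+a. \<integral>\<^sup>+b. \<integral>\<^sup>+y. h' (case_nat (a + norm b *\<^sub>R e) y) \<partial>?UU \<partial>subspace_lborel ?Y \<partial>subspace_lborel W)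
      = (\<integral>\<^sup>+y. h' y \<partial>tuples (Suc q) (subspace_lborel U))"
    by (rule nn_integral_radial_first_vector[OF W U WU e h' inv', symmetric])
  finally show ?case
    by (simp add: h'_def c_def C_def dimension_change_const_Suc)
qed

text \<open>The case \<open>W = 0\<close>, where the stabilizer is the full orthogonal group.\<close>
lemma nn_integral_dimension_change:
  fixes U :: "'a::euclidean_space set"
  assumes U: "subspace U" and q: "q \<le> dim U"
    and h: "h \<in> borel_measurable (tuples q borel)"
    and inv: "\<And>g y. orthogonal_transformation g \<Longrightarrow> y \<in> extensional {..<q} \<Longrightarrow> h (\<lambda>j\<in>{..<q}. g (y j)) = h y"
  shows "(\<integral>\<^sup>+y. h y \<partial>tuples q (lborel :: 'a measure)) =
    ennreal (dimension_change_const DIM('a) (dim U) q) *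
    (\<integral>\<^sup>+y. ennreal (parallelotope_volume q y ^ (DIM('a) - dim U)) * h y \<partial>tuples q (subspace_lborel U))"
proof -
  have "closest_point {0} x = 0" for x :: 'a by (rule closest_point_orthogonal_zero) auto
  moreover have "stabilizer_invariant {0} q h" using inv by (simp add: stabilizer_invariant_def)
  ultimately show ?thesis
    using nn_integral_dimension_change_relative[of "{0}" U UNIV q h] U q h by (simp add: subspace_0)
qed

section \<open>Averaging over the orthogonal group\<close>

text \<open>If a vector lies in the span of its predecessors, the division by 0 makes its value 0.\<close>
function gram_schmidt :: "(nat \<Rightarrow> 'a::euclidean_space) \<Rightarrow> nat \<Rightarrow> 'a" where
  "gram_schmidt X i =
     (let v = X i - (\<Sum>j<i. (X i \<bullet> gram_schmidt X j) *\<^sub>R gram_schmidt X j) in v /\<^sub>R norm v)"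
  by pat_completeness auto
termination by (relation "Wellfounded.measure snd") auto

declare gram_schmidt.simps [simp del]

lemma gram_schmidt_cong:
  "(\<And>j. j \<le> i \<Longrightarrow> X j = Y j) \<Longrightarrow> gram_schmidt X i = gram_schmidt Y i"
proof (induction i rule: less_induct)
  case (less i)
  have "gram_schmidt X j = gram_schmidt Y j" if "j < i" for j
    using less.prems that by (intro less.IH) auto
  then have "(\<Sum>j<i. (Y i \<bullet> gram_schmidt X j) *\<^sub>R gram_schmidt X j)
      = (\<Sum>j<i. (Y i \<bullet> gram_schmidt Y j) *\<^sub>R gram_schmidt Y j)"
    by (intro sum.cong) auto
  moreover have "X i = Y i" using less.prems by simp
  ultimately show ?case by (simp only: gram_schmidt.simps[of _ i])
qed

lemma gram_schmidt_orthogonal: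
  fixes g :: "'a::euclidean_space \<Rightarrow> 'a"
  assumes g: "orthogonal_transformation g"
  shows "gram_schmidt (\<lambda>j. g (X j)) i = g (gram_schmidt X i)"
proof (induction i rule: less_induct)
  case (less i)
  have lin: "linear g" by (rule orthogonal_transformation_linear[OF g])
  have dot: "g x \<bullet> g y = x \<bullet> y" for x y using g by (simp add: orthogonal_transformation_def)
  let ?Y = "\<lambda>j. g (X j)"
  have "(\<Sum>j<i. (g (X i) \<bullet> gram_schmidt ?Y j) *\<^sub>R gram_schmidt ?Y j)
      = (\<Sum>j<i. (g (X i) \<bullet> g (gram_schmidt X j)) *\<^sub>R g (gram_schmidt X j))"
    using less.IH by (intro sum.cong) auto
  then have "g (X i) - (\<Sum>j<i. (g (X i) \<bullet> gram_schmidt ?Y j) *\<^sub>R gram_schmidt ?Y j)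
      = g (X i - (\<Sum>j<i. (X i \<bullet> gram_schmidt X j) *\<^sub>R gram_schmidt X j))"
    by (simp add: dot linear_diff[OF lin] linear_sum[OF lin] linear_scale[OF lin])
  then show ?case
    by (simp only: gram_schmidt.simps[of _ i] Let_def orthogonal_transformation_norm[OF g] linear_scale[OF lin])
qed

lemma measurable_gram_schmidt:
  fixes f :: "'b \<Rightarrow> nat \<Rightarrow> 'a::euclidean_space"
  assumes "\<And>j. j \<le> i \<Longrightarrow> (\<lambda>x. f x j) \<in> borel_measurable L"
  shows "(\<lambda>x. gram_schmidt (f x) i) \<in> borel_measurable L"
  using assms
proof (induction i rule: less_induct)
  case (less i)
  have [measurable]: "(\<lambda>x. gram_schmidt (f x) j) \<in> borel_measurable L" if "j \<in> {..<i}" for j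
    using that less.prems by (intro less.IH) auto
  have [measurable]: "(\<lambda>x. f x i) \<in> borel_measurable L" using less.prems by simp
  show ?case by (subst gram_schmidt.simps) (unfold Let_def, measurable)
qed

lemma gram_schmidt_orthonormal:
  fixes X :: "nat \<Rightarrow> 'a::euclidean_space"
  assumes "\<And>j. j < i \<Longrightarrow> norm (gram_schmidt X j) = 1" and "k < i"
  shows "gram_schmidt X i \<bullet> gram_schmidt X k = 0"
  using assms
proof (induction i arbitrary: k rule: less_induct)
  case (less i)
  let ?u = "gram_schmidt X"
  have orth: "?u j \<bullet> ?u k = (if j = k then 1 else 0)" if "j < i" for j
  proof (cases j k rule: linorder_cases)
    case less
    then show ?thesis using less.IH[of k j] less.prems by (simp add: inner_commute)
  next
    case equal
    then show ?thesis using less.prems by (simp add: dot_square_norm)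
  next
    case greater
    then show ?thesis using less.IH[of j k] less.prems that by simp
  qed
  have "(X i - (\<Sum>j<i. (X i \<bullet> ?u j) *\<^sub>R ?u j)) \<bullet> ?u k
      = X i \<bullet> ?u k - (\<Sum>j<i. (X i \<bullet> ?u j) * (if j = k then 1 else 0))"
    by (auto simp: inner_diff_left inner_sum_left orth intro!: sum.cong)
  also have "\<dots> = 0" using less.prems(2) by (simp add: if_distrib cong: if_cong)
  finally show ?case by (subst gram_schmidt.simps) (simp add: Let_def)
qed

text \<open>
  The law of a Gaussian vector. Any rotation invariant probability measure that vanishes on proper subspaces
  would serve as the source of randomness below.
\<close>
definition gaussian :: "'a::euclidean_space measure" where
  "gaussian = density lborel (\<lambda>x. ennreal (gauss x))"

lemma sets_gaussian [simp, measurable_cong]: "sets gaussian = sets borel"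
  by (simp add: gaussian_def)

lemma space_gaussian [simp]: "space gaussian = UNIV"
  by (simp add: gaussian_def)

lemma prob_space_gaussian: "prob_space (gaussian :: 'a::euclidean_space measure)"
  by (rule prob_spaceI) (simp add: gaussian_def emeasure_density nn_integral_gauss)

lemma prob_space_PiM_gaussian:
  "finite J \<Longrightarrow> prob_space (\<Pi>\<^sub>M j\<in>J. (gaussian :: 'a::euclidean_space measure))"
  by (intro prob_space_PiM prob_space_gaussian)

lemma nn_integral_PiM_gaussian_orthogonal:
  fixes g :: "'a::euclidean_space \<Rightarrow> 'a"
  assumes J: "finite J" and g: "orthogonal_transformation g"
    and f [measurable]: "f \<in> borel_measurable (\<Pi>\<^sub>M j\<in>J. borel)"
  shows "(\<integral>\<^sup>+X. f X \<partial>(\<Pi>\<^sub>M j\<in>J. gaussian)) = (\<integral>\<^sup>+X. f (\<lambda>j\<in>J. g (X j)) \<partial>(\<Pi>\<^sub>M j\<in>J. gaussian))"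
proof (rule nn_integral_PiM_distr[OF J])
  interpret prob_space "gaussian :: 'a measure" by (rule prob_space_gaussian)
  show "sigma_finite_measure (gaussian :: 'a measure)" "sigma_finite_measure (gaussian :: 'a measure)"
    by (rule sigma_finite_measure_axioms)+
  note [measurable] = orthogonal_transformation_measurable[OF g]
  show "g \<in> gaussian \<rightarrow>\<^sub>M gaussian" by measurable
  show "(\<integral>\<^sup>+x. f x \<partial>gaussian) = (\<integral>\<^sup>+x. f (g x) \<partial>gaussian)" if "f \<in> borel_measurable gaussian" for f
  proof -
    have [measurable]: "f \<in> borel_measurable borel" using that by simp
    have "gauss (g x) = gauss x" for x by (simp add: gauss_def orthogonal_transformation_norm[OF g])
    then show ?thesis
      using nn_integral_lborel_orthogonal[OF g, of "\<lambda>x. ennreal (gauss x) * f x"]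
      by (simp add: gaussian_def nn_integral_density)
  qed
  show "f \<in> borel_measurable (\<Pi>\<^sub>M j\<in>J. gaussian)" by measurable
qed

lemma AE_gaussian_not_in_span:
  fixes S :: "'a::euclidean_space set"
  assumes "finite S" "card S < DIM('a)"
  shows "AE x in gaussian. x \<notin> span S"
proof -
  have "dim (span S) < DIM('a)" using dim_le_card'[OF assms(1)] assms(2) by simp
  then have "negligible (span S)" by (rule negligible_lowdim)
  moreover have [measurable]: "span S \<in> sets borel" using closed_subspace[of "span S"] by auto
  ultimately have "span S \<in> null_sets lborel"
    by (auto simp: negligible_iff_null_sets null_sets_completion_iff)
  then have "AE x in lborel. x \<notin> span S" by (rule AE_not_in)
  then show ?thesis unfolding gaussian_def by (subst AE_density) auto
qed

text \<open>
  Given the other vectors, the one with index \<open>i\<close> almost surely avoids the span of its at most \<open>i < DIM('a)\<close>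
  predecessors, and then its normalisation succeeds.
\<close>
lemma AE_gram_schmidt:
  "AE X in (tuples DIM('a) (gaussian :: 'a::euclidean_space measure)).
     \<forall>i<DIM('a). norm (gram_schmidt X i) = 1"
proof -
  let ?N = "DIM('a)"
  interpret prob_space "gaussian :: 'a measure" by (rule prob_space_gaussian)
  interpret product_sigma_finite "\<lambda>_. gaussian :: 'a measure"
    by (simp add: product_sigma_finite_def sigma_finite_measure_axioms)
  have "AE X in (tuples ?N (gaussian :: 'a measure)). norm (gram_schmidt X i) = 1" if i: "i < ?N" for i
  proof -
    define I where "I = {..<?N} - {i}"
    have I: "finite I" "i \<notin> I" "{..<?N} = insert i I" using i by (auto simp: I_def)
    let ?M = "tuples ?N (gaussian :: 'a measure)"
    have [measurable]: "(\<lambda>X. gram_schmidt X i) \<in> borel_measurable ?M"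
      using i by (intro measurable_gram_schmidt) auto
    have "emeasure ?M {X \<in> space ?M. norm (gram_schmidt X i) \<noteq> 1}
        = (\<integral>\<^sup>+X. indicator {X \<in> space ?M. norm (gram_schmidt X i) \<noteq> 1} X \<partial>?M)"
      by (subst nn_integral_indicator) auto
    also have "\<dots> = (\<integral>\<^sup>+X. \<integral>\<^sup>+z. indicator {X \<in> space ?M. norm (gram_schmidt X i) \<noteq> 1} (X(i := z)) \<partial>gaussian \<partial>(\<Pi>\<^sub>M j\<in>I. gaussian))"
      unfolding I(3) by (rule product_nn_integral_insert[OF I(1,2)]) (unfold I(3)[symmetric], measurable)
    also have "\<dots> = (\<integral>\<^sup>+X. 0 \<partial>(\<Pi>\<^sub>M j\<in>I. (gaussian :: 'a measure)))"
    proof (rule nn_integral_cong, goal_cases)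
      case (1 X)
      let ?S = "gram_schmidt X ` {..<i}"
      have "card ?S < ?N" using card_image_le[of "{..<i}" "gram_schmidt X"] i by simp
      then have "AE z in gaussian. z \<notin> span ?S" by (intro AE_gaussian_not_in_span) auto
      then have "AE z in gaussian. indicator {X \<in> space ?M. norm (gram_schmidt X i) \<noteq> 1} (X(i := z)) = (0 :: ennreal)"
      proof eventually_elim
        case (elim z)
        have "gram_schmidt (X(i := z)) j = gram_schmidt X j" if "j < i" for j
          using that by (intro gram_schmidt_cong) auto
        then have "(\<Sum>j<i. (z \<bullet> gram_schmidt (X(i := z)) j) *\<^sub>R gram_schmidt (X(i := z)) j) \<in> span ?S"
          by (auto intro!: span_sum span_mul intro: span_base)
        then have "z \<noteq> (\<Sum>j<i. (z \<bullet> gram_schmidt (X(i := z)) j) *\<^sub>R gram_schmidt (X(i := z)) j)"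
          using elim by auto
        then have "norm (gram_schmidt (X(i := z)) i) = 1"
          by (subst gram_schmidt.simps) (simp add: Let_def)
        then show ?case by simp
      qed
      then show ?case
        by (subst nn_integral_cong_AE) auto
    qed
    finally show ?thesis by (subst AE_iff_measurable[OF _ refl]) auto
  qed
  then show ?thesis by (auto simp: AE_all_countable)
qed

definition basis_enum :: "nat \<Rightarrow> 'a::euclidean_space" where
  "basis_enum = (SOME b. bij_betw b {..<DIM('a)} Basis)"

lemma bij_betw_basis_enum: "bij_betw basis_enum {..<DIM('a)} (Basis :: 'a::euclidean_space set)"
proof -
  have "\<exists>b. bij_betw b {..<DIM('a)} (Basis :: 'a set)" by (rule finite_same_card_bij) auto
  then show ?thesis unfolding basis_enum_def by (rule someI_ex)
qed

text \<open>
  The linear map that takes the Gram-Schmidt frame of \<open>X\<close> to the standard basis. It is a random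
  orthogonal transformation, and since \<open>frame_map (g X) = frame_map X \<circ> g\<^sup>-\<^sup>1\<close>, its law is invariant
  under multiplication from the right. This is all of Haar measure on \<open>O(n)\<close> that is needed.
\<close>
definition frame_map :: "(nat \<Rightarrow> 'a::euclidean_space) \<Rightarrow> 'a \<Rightarrow> 'a" where
  "frame_map X y = (\<Sum>i<DIM('a). (gram_schmidt X i \<bullet> y) *\<^sub>R basis_enum i)"

lemma frame_map_equivariant:
  assumes "orthogonal_transformation g"
  shows "frame_map (\<lambda>j\<in>{..<DIM('a)}. g (X j)) (g y) = frame_map X (y :: 'a::euclidean_space)"
proof -
  have "gram_schmidt (\<lambda>j\<in>{..<DIM('a)}. g (X j)) i = g (gram_schmidt X i)" if "i < DIM('a)" for i
    using that gram_schmidt_orthogonal[OF assms, of X i]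
    by (subst gram_schmidt_cong[of _ _ "\<lambda>j. g (X j)"]) auto
  then show ?thesis
    using assms by (simp add: frame_map_def orthogonal_transformation_def)
qed

text \<open>
  The map \<open>T\<close> that takes the standard basis to the frame preserves inner products by Parseval's identity
  and is therefore invertible; \<open>frame_map X\<close> is its inverse.
\<close>
lemma orthogonal_transformation_frame_map:
  fixes X :: "nat \<Rightarrow> 'a::euclidean_space"
  assumes X: "\<forall>i<DIM('a). norm (gram_schmidt X i) = 1"
  shows "orthogonal_transformation (frame_map X)"
proof -
  let ?u = "gram_schmidt X" and ?N = "DIM('a)"
  define T where "T y = (\<Sum>i<?N. (basis_enum i \<bullet> y) *\<^sub>R ?u i)" for y :: 'a
  have u: "?u i \<bullet> ?u j = (if i = j then 1 else 0)" if "i < ?N" "j < ?N" for i j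
    using gram_schmidt_orthonormal[of i X j] gram_schmidt_orthonormal[of j X i] X that
    by (cases i j rule: linorder_cases) (auto simp: inner_commute dot_square_norm)
  have uT: "?u i \<bullet> T y = basis_enum i \<bullet> y" if "i < ?N" for i y
  proof -
    have "?u i \<bullet> T y = (\<Sum>j<?N. (basis_enum j \<bullet> y) * (if i = j then 1 else 0))"
      unfolding T_def inner_sum_right inner_scaleR_right using that by (intro sum.cong) (auto simp: u)
    then show ?thesis using that by (simp add: if_distrib cong: if_cong)
  qed
  have Basis_sum: "(\<Sum>i<?N. h (basis_enum i)) = (\<Sum>b\<in>Basis. h b)" for h :: "'a \<Rightarrow> 'c::comm_monoid_add"
    by (rule sum.reindex_bij_betw[OF bij_betw_basis_enum])
  have T_dot: "T x \<bullet> T y = x \<bullet> y" for x y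
  proof -
    have "T x \<bullet> T y = (\<Sum>i<?N. (basis_enum i \<bullet> x) * (basis_enum i \<bullet> y))"
      by (subst (1) T_def) (simp add: inner_sum_left uT)
    also have "\<dots> = (\<Sum>b\<in>Basis. (b \<bullet> x) * (b \<bullet> y))" by (rule Basis_sum)
    also have "\<dots> = x \<bullet> y" by (subst euclidean_inner) (intro sum.cong, auto simp: inner_commute)
    finally show ?thesis .
  qed
  have "linear T"
    by (rule linearI) (simp_all add: T_def inner_add_right scaleR_add_left sum.distrib scaleR_sum_right)
  then have "orthogonal_transformation T" using T_dot by (simp add: orthogonal_transformation_def)
  then have surj: "\<exists>x'. x = T x'" for x using orthogonal_transformation_surj by (metis surjD)
  have frame_T: "frame_map X (T z) = z" for z
  proof -
    have "frame_map X (T z) = (\<Sum>i<?N. (basis_enum i \<bullet> z) *\<^sub>R basis_enum i)"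
      unfolding frame_map_def by (intro sum.cong) (auto simp: uT)
    also have "\<dots> = (\<Sum>b\<in>Basis. (b \<bullet> z) *\<^sub>R b)" by (rule Basis_sum)
    also have "\<dots> = z" by (simp add: inner_commute[of _ z] euclidean_representation)
    finally show ?thesis .
  qed
  have "frame_map X x \<bullet> frame_map X y = x \<bullet> y" for x y
    using surj[of x] surj[of y] by (auto simp: frame_T T_dot)
  moreover have "linear (frame_map X)"
    by (rule linearI) (simp_all add: frame_map_def inner_add_right scaleR_add_left sum.distrib scaleR_sum_right)
  ultimately show ?thesis by (simp add: orthogonal_transformation_def)
qed

lemma measurable_frame_map [measurable]:
  fixes f :: "'b \<Rightarrow> nat \<Rightarrow> 'a::euclidean_space"
  assumes f: "f \<in> L \<rightarrow>\<^sub>M tuples DIM('a) borel" and [measurable]: "h \<in> borel_measurable L"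
  shows "(\<lambda>x. frame_map (f x) (h x)) \<in> borel_measurable L"
proof -
  have [measurable]: "(\<lambda>x. gram_schmidt (f x) i) \<in> borel_measurable L" if "i \<in> {..<DIM('a)}" for i
  proof (rule measurable_gram_schmidt)
    fix j assume "j \<le> i"
    then have "j \<in> {..<DIM('a)}" using that by auto
    then show "(\<lambda>x. f x j) \<in> borel_measurable L" using f by measurable
  qed
  show ?thesis unfolding frame_map_def by measurable
qed

definition orthogonal_average :: "nat \<Rightarrow> ((nat \<Rightarrow> 'a::euclidean_space) \<Rightarrow> ennreal) \<Rightarrow> (nat \<Rightarrow> 'a) \<Rightarrow> ennreal" where
  "orthogonal_average q f y =
     (\<integral>\<^sup>+X. f (\<lambda>j\<in>{..<q}. frame_map X (y j)) \<partial>tuples DIM('a) gaussian)"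

text \<open>Replace the Gaussian matrix \<open>X\<close> by \<open>g X\<close>, which has the same law.\<close>
lemma orthogonal_average_invariant:
  fixes g :: "'a::euclidean_space \<Rightarrow> 'a"
  assumes g: "orthogonal_transformation g" and [measurable]: "f \<in> borel_measurable (tuples q borel)"
  shows "orthogonal_average q f (\<lambda>j\<in>{..<q}. g (y j)) = orthogonal_average q f y"
proof -
  let ?G = "tuples DIM('a) (gaussian :: 'a measure)"
  have restr: "(\<lambda>j\<in>{..<q}. frame_map X ((\<lambda>j\<in>{..<q}. g (y j)) j)) = (\<lambda>j\<in>{..<q}. frame_map X (g (y j)))" for X
    by auto
  have "orthogonal_average q f (\<lambda>j\<in>{..<q}. g (y j)) = (\<integral>\<^sup>+X. f (\<lambda>j\<in>{..<q}. frame_map X (g (y j))) \<partial>?G)"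
    by (simp only: orthogonal_average_def restr)
  also have "\<dots> = (\<integral>\<^sup>+X. f (\<lambda>j\<in>{..<q}. frame_map (\<lambda>i\<in>{..<DIM('a)}. g (X i)) (g (y j))) \<partial>?G)"
    by (rule nn_integral_PiM_gaussian_orthogonal[OF _ g]) (simp, measurable)
  also have "\<dots> = orthogonal_average q f y"
    by (simp add: frame_map_equivariant[OF g] orthogonal_average_def)
  finally show ?thesis .
qed

section \<open>Measurability on the Grassmannian\<close>

lemma measurable_matrix_vector_mult [measurable]:
  fixes A :: "'b \<Rightarrow> real^'n^'m" and x :: "'b \<Rightarrow> real^'n"
  assumes "A \<in> borel_measurable L" "x \<in> borel_measurable L"
  shows "(\<lambda>l. A l *v x l) \<in> borel_measurable L"
proof (rule borel_measurable_continuous_Pair[OF assms])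
  show "continuous_on UNIV (\<lambda>p. (fst p :: real^'n^'m) *v (snd p :: real^'n))"
    unfolding matrix_vector_mult_def by (intro continuous_intros continuous_on_vec_lambda)
qed

lemma matrix_of_linear_apply: "linear f \<Longrightarrow> matrix f *v x = f x" for f :: "real^'n \<Rightarrow> real^'m"
  using matrix_vector_mul(2)[of f] by metis

text \<open>
  The Gaussian description turns the moving domain of integration into a fixed one with an integrand that is
  jointly measurable in the point and the projection matrix; Fubini's theorem does the rest.
\<close>
lemma borel_measurable_nn_integral_PiM_moving_subspace:
  fixes V :: "'b \<Rightarrow> (real^'n) set"
  assumes V: "\<And>l. l \<in> space L \<Longrightarrow> subspace (V l)" and J: "finite J"
    and A [measurable]: "(\<lambda>l. matrix (closest_point (V l)) :: real^'n^'n) \<in> borel_measurable L"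
    and f [measurable]: "case_prod f \<in> borel_measurable (L \<Otimes>\<^sub>M (\<Pi>\<^sub>M j\<in>J. borel))"
  shows "(\<lambda>l. \<integral>\<^sup>+y. f l y \<partial>(\<Pi>\<^sub>M j\<in>J. subspace_lborel (V l))) \<in> borel_measurable L"
proof -
  define A where "A l = (matrix (closest_point (V l)) :: real^'n^'n)" for l
  have A_meas [measurable]: "A \<in> borel_measurable L" unfolding A_def by (rule A)
  interpret product_sigma_finite "\<lambda>_. lborel :: (real^'n) measure"
    by (simp add: product_sigma_finite_def sigma_finite_lborel)
  interpret P: sigma_finite_measure "\<Pi>\<^sub>M j\<in>J. (lborel :: (real^'n) measure)"
    by (rule sigma_finite[OF J])
  have eq: "(\<integral>\<^sup>+y. f l y \<partial>(\<Pi>\<^sub>M j\<in>J. subspace_lborel (V l)))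
     = (\<integral>\<^sup>+x. (\<Prod>j\<in>J. ennreal (gauss (x j - A l *v x j))) * f l (\<lambda>j\<in>J. A l *v x j) \<partial>(\<Pi>\<^sub>M j\<in>J. lborel))"
    if l: "l \<in> space L" for l
  proof (rule nn_integral_PiM_transfer[OF J sigma_finite_lborel sigma_finite_subspace_lborel[OF V[OF l]]])
    have A_app: "A l *v x = closest_point (V l) x" for x
      unfolding A_def by (rule matrix_of_linear_apply[OF linear_closest_point_subspace[OF V[OF l]]])
    show "(\<lambda>x. A l *v x) \<in> lborel \<rightarrow>\<^sub>M subspace_lborel (V l)" by measurable
    show "(\<lambda>x. ennreal (gauss (x - A l *v x))) \<in> borel_measurable lborel" by measurable
    show "(\<integral>\<^sup>+x. f x \<partial>subspace_lborel (V l)) = (\<integral>\<^sup>+x. ennreal (gauss (x - A l *v x)) * f (A l *v x) \<partial>lborel)"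
      if "f \<in> borel_measurable (subspace_lborel (V l))" for f
      using nn_integral_subspace_lborel[OF V[OF l], of f] that by (simp add: A_app cong: measurable_cong_sets)
    show "f l \<in> borel_measurable (\<Pi>\<^sub>M j\<in>J. subspace_lborel (V l))"
      using l by measurable
  qed
  have [measurable]: "case_prod f \<in> borel_measurable (L \<Otimes>\<^sub>M (\<Pi>\<^sub>M j\<in>J. lborel))"
  proof -
    have "sets (L \<Otimes>\<^sub>M (\<Pi>\<^sub>M j\<in>J. (lborel :: (real^'n) measure))) = sets (L \<Otimes>\<^sub>M (\<Pi>\<^sub>M j\<in>J. borel))"
      by (intro sets_pair_measure_cong sets_PiM_cong) auto
    then show ?thesis using f by (simp cong: measurable_cong_sets)
  qed
  have "(\<lambda>l. \<integral>\<^sup>+x. (\<Prod>j\<in>J. ennreal (gauss (x j - A l *v x j))) * f l (\<lambda>j\<in>J. A l *v x j) \<partial>(\<Pi>\<^sub>M j\<in>J. lborel))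
      \<in> borel_measurable L"
    by measurable
  then show ?thesis by (subst measurable_cong[OF eq])
qed

lemma space_borel_grassmannian [simp]: "space (borel_grassmannian k) = grassmannian k"
  by (simp add: borel_grassmannian_def)

lemma measurable_projection_matrix:
  "(\<lambda>\<xi>. matrix (closest_point \<xi>) :: real^'n^'n) \<in> borel_measurable (borel_grassmannian k)"
  unfolding borel_grassmannian_def by (rule measurable_vimage_algebra1) simp

lemma invariant_probability_grassmannianD:
  fixes \<mu> :: "(real^'n) set measure"
  assumes "invariant_probability_grassmannian k \<mu>"
  shows "prob_space \<mu>" "sets \<mu> = sets (borel_grassmannian k)" "space \<mu> = grassmannian k"
    "\<And>\<xi>. \<xi> \<in> space \<mu> \<Longrightarrow> subspace \<xi>"
    "(\<lambda>\<xi>. matrix (closest_point \<xi>) :: real^'n^'n) \<in> borel_measurable \<mu>"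
proof -
  show "prob_space \<mu>" and sets: "sets \<mu> = sets (borel_grassmannian k)"
    using assms by (simp_all add: invariant_probability_grassmannian_def)
  show "space \<mu> = grassmannian k" using sets_eq_imp_space_eq[OF sets] by simp
  then show "\<And>\<xi>. \<xi> \<in> space \<mu> \<Longrightarrow> subspace \<xi>" by (simp add: grassmannian_def)
  show "(\<lambda>\<xi>. matrix (closest_point \<xi>) :: real^'n^'n) \<in> borel_measurable \<mu>"
    unfolding measurable_cong_sets[OF sets refl] by (rule measurable_projection_matrix)
qed

text \<open>
  The projection matrix of the image of \<open>\<xi>\<close> under \<open>g\<close> is \<open>g P g\<^sup>T\<close>, a continuous function of the projection
  matrix \<open>P\<close> of \<open>\<xi>\<close>.
\<close>
lemma measurable_orthogonal_image_grassmannian: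
  fixes g :: "real^'n \<Rightarrow> real^'n"
  assumes g: "orthogonal_transformation g"
  shows "(`) g \<in> borel_grassmannian k \<rightarrow>\<^sub>M borel_grassmannian k"
proof -
  note lin = orthogonal_transformation_linear[OF g]
  have img: "g ` \<xi> \<in> grassmannian k" if "\<xi> \<in> grassmannian k" for \<xi>
    using that linear_subspace_image[OF lin] dim_image_eq[OF lin] orthogonal_transformation_inj[OF g]
    by (auto simp: grassmannian_def inj_on_subset)
  have eq: "(matrix (closest_point (g ` \<xi>)) :: real^'n^'n)
      = matrix g ** matrix (closest_point \<xi>) ** transpose (matrix g)" if "\<xi> \<in> grassmannian k" for \<xi>
  proof -
    have \<xi>: "subspace \<xi>" using that by (simp add: grassmannian_def)
    have og: "orthogonal_matrix (matrix g)" using g by (simp add: orthogonal_transformation_matrix)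
    then have gg: "g (transpose (matrix g) *v x) = x" for x
    proof -
      have "g (transpose (matrix g) *v x) = (matrix g ** transpose (matrix g)) *v x"
        by (simp only: matrix_of_linear_apply[OF lin, symmetric] matrix_vector_mul_assoc)
      then show ?thesis using og unfolding orthogonal_matrix_def by simp
    qed
    have "closest_point (g ` \<xi>) x = (matrix g ** matrix (closest_point \<xi>) ** transpose (matrix g)) *v x" for x
    proof -
      have "closest_point (g ` \<xi>) x = g (closest_point \<xi> (transpose (matrix g) *v x))"
        using closest_point_orthogonal_image[OF \<xi> g, of "transpose (matrix g) *v x"] by (simp only: gg)
      also have "\<dots> = matrix g *v (matrix (closest_point \<xi>) *v (transpose (matrix g) *v x))"
        by (simp add: matrix_of_linear_apply[OF lin] matrix_of_linear_apply[OF linear_closest_point_subspace[OF \<xi>]])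
      finally show ?thesis by (simp only: matrix_vector_mul_assoc matrix_mul_assoc)
    qed
    then have "closest_point (g ` \<xi>) = (*v) (matrix g ** matrix (closest_point \<xi>) ** transpose (matrix g))" by auto
    then show ?thesis by (simp only: matrix_of_matrix_vector_mul)
  qed
  have cont: "continuous_on UNIV (\<lambda>A. matrix g ** A ** transpose (matrix g) :: real^'n^'n)"
    unfolding matrix_matrix_mult_def by (intro continuous_intros continuous_on_vec_lambda)
  show ?thesis
    unfolding borel_grassmannian_def
  proof (rule measurable_vimage_algebra2)
    have "(\<lambda>\<xi>. matrix g ** matrix (closest_point \<xi>) ** transpose (matrix g) :: real^'n^'n) \<in> borel_measurable (borel_grassmannian k)"
      using measurable_compose[OF measurable_projection_matrix borel_measurable_continuous_onI[OF cont]] .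
    then show "(\<lambda>\<xi>. matrix (closest_point (g ` \<xi>)) :: real^'n^'n) \<in> borel_measurable
        (vimage_algebra (grassmannian k) (\<lambda>\<xi>. matrix (closest_point \<xi>) :: real^'n^'n) borel)"
      unfolding borel_grassmannian_def[symmetric] by (subst measurable_cong[OF eq]) auto
  qed (use img in auto)
qed

section \<open>The linear formula\<close>

text \<open>
  Both sides are invariant under composing \<open>f\<close> with a rotation: the left one because Lebesgue measure is, the
  right one because \<open>\<mu>\<close> is. Hence both are unchanged when \<open>f\<close> is replaced by its orthogonal average, for which
  \<open>nn_integral_dimension_change\<close> evaluates the inner integral: it has the same value on every
  plane \<open>\<xi>\<close>, and \<open>\<mu>\<close> has total mass 1.
\<close>
lemma linear_blaschke_petkantschin:
  fixes \<mu> :: "(real^'n) set measure"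
  assumes q: "q \<le> k" and k: "k \<le> CARD('n)" and \<mu>: "invariant_probability_grassmannian k \<mu>"
    and f [measurable]: "f \<in> borel_measurable (tuples q borel)"
  shows "(\<integral>\<^sup>+y. f y \<partial>tuples q (lborel :: (real^'n) measure)) =
    ennreal (dimension_change_const CARD('n) k q) *
    (\<integral>\<^sup>+\<xi>. \<integral>\<^sup>+y. ennreal (parallelotope_volume q y ^ (CARD('n) - k)) * f y \<partial>tuples q (subspace_lborel \<xi>) \<partial>\<mu>)"
proof -
  interpret \<mu>: prob_space \<mu> by (rule invariant_probability_grassmannianD[OF \<mu>])
  note sets_\<mu> [measurable_cong] = invariant_probability_grassmannianD(2)[OF \<mu>]
    and space_\<mu> = invariant_probability_grassmannianD(3)[OF \<mu>]
    and sub = invariant_probability_grassmannianD(4)[OF \<mu>]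
    and P_meas [measurable] = invariant_probability_grassmannianD(5)[OF \<mu>]
  have inv: "distr \<mu> \<mu> ((`) g) = \<mu>" if "orthogonal_transformation g" for g
    using \<mu> that by (auto simp: invariant_probability_grassmannian_def)
  have dim: "dim \<xi> = k" if "\<xi> \<in> space \<mu>" for \<xi>
    using that by (simp add: space_\<mu> grassmannian_def)
  let ?m = "CARD('n) - k" and ?C = "ennreal (dimension_change_const CARD('n) k q)"
  let ?L = "tuples q (lborel :: (real^'n) measure)"
  let ?\<Xi> = "\<lambda>\<xi>. tuples q (subspace_lborel (\<xi> :: (real^'n) set))"
  let ?G = "tuples CARD('n) (gaussian :: (real^'n) measure)"
  interpret G: prob_space ?G by (rule prob_space_PiM_gaussian) simp
  interpret L: sigma_finite_measure ?L
    using sigma_finite_PiM_subspace_lborel[of "UNIV :: (real^'n) set" "{..<q}"] by simp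
  have sets_L [measurable_cong]: "sets ?L = sets (tuples q borel)" by (rule sets_PiM_cong) auto
  have sets_G [measurable_cong]: "sets ?G = sets (tuples CARD('n) borel)" by (rule sets_PiM_cong) auto
  define w where "w y = ennreal (parallelotope_volume q y ^ ?m)" for y :: "nat \<Rightarrow> real^'n"
  have w [measurable]: "w \<in> borel_measurable (tuples q borel)"
    unfolding w_def by measurable
  define act where "act X y = (\<lambda>j\<in>{..<q}. frame_map X (y j))" for X and y :: "nat \<Rightarrow> real^'n"
  have act_meas [measurable]: "(\<lambda>p. act (F p) (H p)) \<in> M \<rightarrow>\<^sub>M tuples q borel"
    if [measurable]: "F \<in> M \<rightarrow>\<^sub>M tuples CARD('n) borel" "H \<in> M \<rightarrow>\<^sub>M tuples q borel" for F H and M :: "'z measure"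
    unfolding act_def
  proof (rule measurable_restrict)
    have F: "F \<in> M \<rightarrow>\<^sub>M tuples (DIM(real^'n)) borel" using that by simp
    show "(\<lambda>x. frame_map (F x) (H x j)) \<in> borel_measurable M" if "j \<in> {..<q}" for j
      by (rule measurable_frame_map[OF F]) (use that in measurable)
  qed
  have D: "DIM(real^'n) = CARD('n)" by simp
  let ?A = "orthogonal_average q f"
  have A_def: "?A y = (\<integral>\<^sup>+X. f (act X y) \<partial>?G)" for y by (simp add: orthogonal_average_def act_def)
  have A_meas [measurable]: "?A \<in> borel_measurable (tuples q borel)"
    unfolding A_def by measurable
  define \<nu> where "\<nu> h = (\<integral>\<^sup>+\<xi>. \<integral>\<^sup>+y. w y * h y \<partial>?\<Xi> \<xi> \<partial>\<mu>)" for h :: "(nat \<Rightarrow> real^'n) \<Rightarrow> ennreal"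
  have inner_meas: "(\<lambda>\<xi>. \<integral>\<^sup>+y. w y * h y \<partial>?\<Xi> \<xi>) \<in> borel_measurable \<mu>"
    if [measurable]: "h \<in> borel_measurable (tuples q borel)" for h
    by (rule borel_measurable_nn_integral_PiM_moving_subspace) (use sub in \<open>simp_all, measurable?\<close>)

  have \<nu>_inv: "\<nu> (\<lambda>y. f (\<lambda>j\<in>{..<q}. g (y j))) = \<nu> f" if g: "orthogonal_transformation g" for g
  proof -
    have g_meas [measurable]: "(`) g \<in> \<mu> \<rightarrow>\<^sub>M \<mu>"
      using measurable_orthogonal_image_grassmannian[OF g] by (simp add: sets_\<mu> cong: measurable_cong_sets)
    have "\<nu> f = (\<integral>\<^sup>+\<xi>. \<integral>\<^sup>+y. w y * f y \<partial>?\<Xi> \<xi> \<partial>distr \<mu> \<mu> ((`) g))" by (simp add: \<nu>_def inv[OF g])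
    also have "\<dots> = (\<integral>\<^sup>+\<xi>. \<integral>\<^sup>+y. w y * f y \<partial>?\<Xi> (g ` \<xi>) \<partial>\<mu>)"
      by (rule nn_integral_distr[OF g_meas]) (simp add: inner_meas)
    also have "\<dots> = (\<integral>\<^sup>+\<xi>. \<integral>\<^sup>+y. w (\<lambda>j\<in>{..<q}. g (y j)) * f (\<lambda>j\<in>{..<q}. g (y j)) \<partial>?\<Xi> \<xi> \<partial>\<mu>)"
      by (intro nn_integral_cong nn_integral_PiM_subspace_lborel_orthogonal[OF _ _ g, symmetric])
        (use sub in \<open>simp_all, measurable?\<close>)
    also have "\<dots> = (\<integral>\<^sup>+\<xi>. \<integral>\<^sup>+y. w y * f (\<lambda>j\<in>{..<q}. g (y j)) \<partial>?\<Xi> \<xi> \<partial>\<mu>)"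
    proof -
      have "w (\<lambda>j\<in>{..<q}. g (y j)) = w y" for y
        unfolding w_def using g by (subst parallelotope_volume_cong) (auto simp: orthogonal_transformation_def)
      then show ?thesis by simp
    qed
    finally show ?thesis by (simp add: \<nu>_def)
  qed

  \<comment> \<open>invariance for almost every frame, then exchange of the integrals\<close>
  have \<nu>_avg: "\<nu> f = \<nu> ?A"
  proof -
    interpret G\<mu>: pair_sigma_finite ?G \<mu> ..
    have "\<nu> f = (\<integral>\<^sup>+X. \<nu> f \<partial>?G)" by (simp add: G.emeasure_space_1)
    also have "\<dots> = (\<integral>\<^sup>+X. \<nu> (\<lambda>y. f (act X y)) \<partial>?G)"
    proof (rule nn_integral_cong_AE)
      have "AE X in ?G. \<forall>i<CARD('n). norm (gram_schmidt X i) = 1"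
        using AE_gram_schmidt[where 'a = "real^'n"] unfolding D .
      then show "AE X in ?G. \<nu> f = \<nu> (\<lambda>y. f (act X y))"
      proof eventually_elim
        case (elim X)
        then show ?case
          using \<nu>_inv[OF orthogonal_transformation_frame_map[where 'a = "real^'n", unfolded D, OF elim]] by (simp add: act_def)
      qed
    qed
    also have "\<dots> = (\<integral>\<^sup>+\<xi>. \<integral>\<^sup>+X. \<integral>\<^sup>+y. w y * f (act X y) \<partial>?\<Xi> \<xi> \<partial>?G \<partial>\<mu>)"
      unfolding \<nu>_def
    proof (rule G\<mu>.Fubini'[symmetric])
      have "(\<lambda>p. \<integral>\<^sup>+y. w y * f (act (fst p) y) \<partial>?\<Xi> (snd p)) \<in> borel_measurable (?G \<Otimes>\<^sub>M \<mu>)"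
        by (rule borel_measurable_nn_integral_PiM_moving_subspace)
          (use sub in \<open>auto simp: space_pair_measure, measurable?\<close>)
      then show "(\<lambda>(X, \<xi>). \<integral>\<^sup>+y. w y * f (act X y) \<partial>?\<Xi> \<xi>) \<in> borel_measurable (?G \<Otimes>\<^sub>M \<mu>)"
        by (simp add: split_beta')
    qed
    also have "\<dots> = (\<integral>\<^sup>+\<xi>. \<integral>\<^sup>+y. w y * ?A y \<partial>?\<Xi> \<xi> \<partial>\<mu>)"
    proof (rule nn_integral_cong)
      fix \<xi> assume "\<xi> \<in> space \<mu>"
      then interpret \<Xi>: sigma_finite_measure "?\<Xi> \<xi>" using sub by (intro sigma_finite_PiM_subspace_lborel) auto
      interpret p: pair_sigma_finite ?G "?\<Xi> \<xi>" ..
      have "(\<integral>\<^sup>+X. \<integral>\<^sup>+y. w y * f (act X y) \<partial>?\<Xi> \<xi> \<partial>?G) = (\<integral>\<^sup>+y. \<integral>\<^sup>+X. w y * f (act X y) \<partial>?G \<partial>?\<Xi> \<xi>)"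
        by (rule p.Fubini'[symmetric]) measurable
      also have "\<dots> = (\<integral>\<^sup>+y. w y * ?A y \<partial>?\<Xi> \<xi>)"
        unfolding A_def
      proof (intro nn_integral_cong nn_integral_cmult)
        fix y assume "y \<in> space (?\<Xi> \<xi>)"
        then have [measurable]: "y \<in> space (tuples q (borel :: (real^'n) measure))"
          by (simp add: space_PiM_UNIV)
        show "(\<lambda>X. f (act X y)) \<in> borel_measurable ?G" by measurable
      qed
      finally show "(\<integral>\<^sup>+X. \<integral>\<^sup>+y. w y * f (act X y) \<partial>?\<Xi> \<xi> \<partial>?G) = (\<integral>\<^sup>+y. w y * ?A y \<partial>?\<Xi> \<xi>)" .
    qed
    finally show ?thesis by (simp add: \<nu>_def)
  qed

  have lebesgue_avg: "(\<integral>\<^sup>+y. f y \<partial>?L) = (\<integral>\<^sup>+y. ?A y \<partial>?L)"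
  proof -
    interpret GL: pair_sigma_finite ?G ?L ..
    have "(\<integral>\<^sup>+y. f y \<partial>?L) = (\<integral>\<^sup>+X. \<integral>\<^sup>+y. f y \<partial>?L \<partial>?G)" by (simp add: G.emeasure_space_1)
    also have "\<dots> = (\<integral>\<^sup>+X. \<integral>\<^sup>+y. f (act X y) \<partial>?L \<partial>?G)"
    proof (rule nn_integral_cong_AE)
      have "AE X in ?G. \<forall>i<CARD('n). norm (gram_schmidt X i) = 1"
        using AE_gram_schmidt[where 'a = "real^'n"] unfolding D .
      then show "AE X in ?G. (\<integral>\<^sup>+y. f y \<partial>?L) = (\<integral>\<^sup>+y. f (act X y) \<partial>?L)"
      proof eventually_elim
        case (elim X)
        note o = orthogonal_transformation_frame_map[where 'a = "real^'n", unfolded D, OF elim]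
        show ?case
          using nn_integral_PiM_subspace_lborel_orthogonal[OF _ _ o f, of UNIV] orthogonal_transformation_surj[OF o]
          by (simp add: act_def)
      qed
    qed
    also have "\<dots> = (\<integral>\<^sup>+y. \<integral>\<^sup>+X. f (act X y) \<partial>?G \<partial>?L)"
      by (rule GL.Fubini'[symmetric]) measurable
    finally show ?thesis by (simp add: A_def)
  qed

  have "?C * \<nu> ?A = (\<integral>\<^sup>+\<xi>. ?C * (\<integral>\<^sup>+y. w y * ?A y \<partial>?\<Xi> \<xi>) \<partial>\<mu>)"
    unfolding \<nu>_def by (rule nn_integral_cmult[symmetric]) (rule inner_meas, measurable)
  also have "\<dots> = (\<integral>\<^sup>+\<xi>. (\<integral>\<^sup>+y. ?A y \<partial>?L) \<partial>\<mu>)"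
  proof (rule nn_integral_cong, goal_cases)
    case (1 \<xi>)
    note \<xi> = 1

    show ?case
      using nn_integral_dimension_change[OF sub[OF \<xi>] _ A_meas orthogonal_average_invariant[OF _ f]]
        q dim[OF \<xi>] by (simp add: w_def)
  qed
  also have "\<dots> = (\<integral>\<^sup>+y. f y \<partial>?L)" by (simp add: \<mu>.emeasure_space_1 lebesgue_avg)
  finally show ?thesis using \<nu>_avg by (simp add: \<nu>_def w_def)
qed

section \<open>Affine planes\<close>

lemma direction_translation:
  assumes S: "subspace S"
  shows "direction ((+) a ` S) = S"
proof (rule subset_antisym; rule subsetI)
  fix x assume "x \<in> direction ((+) a ` S)"
  then obtain u v where uv: "x = u - v" "u \<in> (+) a ` S" "v \<in> (+) a ` S"
    unfolding direction_def mem_Collect_eq by (elim exE conjE)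
  from uv(2) obtain s where s: "s \<in> S" "u = a + s" by (rule imageE)
  from uv(3) obtain t where t: "t \<in> S" "v = a + t" by (rule imageE)
  show "x \<in> S" using subspace_diff[OF S s(1) t(1)] by (simp add: uv(1) s(2) t(2))
next
  fix s assume s: "s \<in> S"
  have "s = (a + s) - (a + 0)" by simp
  moreover have "a + s \<in> (+) a ` S" using s by (rule imageI)
  moreover have "a + 0 \<in> (+) a ` S" using subspace_0[OF S] by (rule imageI)
  ultimately show "s \<in> direction ((+) a ` S)"
    unfolding direction_def mem_Collect_eq by (intro exI conjI)
qed

text \<open>
  Every point of the plane is the sum of the component of \<open>a\<close> orthogonal to \<open>S\<close> and a vector of \<open>S\<close>, so
  by Pythagoras that component is the shortest point.
\<close>
lemma closest_point_translation_0:
  fixes S :: "'a::euclidean_space set"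
  assumes S: "subspace S"
  shows "closest_point ((+) a ` S) 0 = a - closest_point S a"
proof (rule closest_point_unique[symmetric])
  show "a - closest_point S a \<in> (+) a ` S"
    by (rule image_eqI[of _ _ "- closest_point S a"])
      (simp_all add: closest_point_subspace_in[OF S] subspace_neg[OF S])
  show "convex ((+) a ` S)" using S by (simp add: convex_translation subspace_imp_convex)
  show "closed ((+) a ` S)" using S by (simp add: closed_translation closed_subspace)
  show "\<forall>z\<in>(+) a ` S. dist 0 (a - closest_point S a) \<le> dist 0 z"
  proof
    fix z assume "z \<in> (+) a ` S"
    then obtain s where s: "s \<in> S" "z = a + s" by auto
    have "(a - closest_point S a) \<bullet> (closest_point S a + s) = 0"
      using closest_point_subspace_in[OF S] s by (intro closest_point_subspace_orthogonal[OF S]) (simp add: subspace_add[OF S])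
    then have "(norm ((a - closest_point S a) + (closest_point S a + s)))\<^sup>2
        = (norm (a - closest_point S a))\<^sup>2 + (norm (closest_point S a + s))\<^sup>2"
      by (intro norm_add_Pythagorean) (simp add: orthogonal_def)
    moreover have "(a - closest_point S a) + (closest_point S a + s) = z" by (simp add: s)
    ultimately have "(norm (a - closest_point S a))\<^sup>2 \<le> (norm z)\<^sup>2" by simp
    then show "dist 0 (a - closest_point S a) \<le> dist 0 z" by (simp add: power2_le_iff_abs_le)
  qed
qed

lemma affine_grassmannian_iff:
  "\<tau> \<in> affine_grassmannian k \<longleftrightarrow> (\<exists>a. \<exists>\<xi>\<in>grassmannian k. \<tau> = (+) a ` \<xi>)" for \<tau> :: "(real^'n) set"
proof
  assume \<tau>: "\<tau> \<in> affine_grassmannian k"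
  then have "affine \<tau>" "\<tau> \<noteq> {}" and k: "aff_dim \<tau> = int k"
    by (auto simp: affine_grassmannian_def aff_dim_empty)
  then obtain a where "a \<in> \<tau>" by auto
  define \<xi> where "\<xi> = (+) (- a) ` \<tau>"
  have \<xi>: "subspace \<xi>"
    unfolding \<xi>_def using affine_diffs_subspace[OF \<open>affine \<tau>\<close> \<open>a \<in> \<tau>\<close>] by (simp add: image_def)
  moreover have "\<tau> = (+) a ` \<xi>" by (auto simp: \<xi>_def image_image)
  moreover have "dim \<xi> = k"
    using k aff_dim_subspace[OF \<xi>] by (simp add: \<xi>_def aff_dim_translation_eq_subtract)
  ultimately show "\<exists>a. \<exists>\<xi>\<in>grassmannian k. \<tau> = (+) a ` \<xi>"
    by (auto simp: grassmannian_def)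
next
  assume "\<exists>a. \<exists>\<xi>\<in>grassmannian k. \<tau> = (+) a ` \<xi>"
  then show "\<tau> \<in> affine_grassmannian k"
    by (auto simp: affine_grassmannian_def grassmannian_def affine_translation[symmetric]
        subspace_imp_affine aff_dim_translation_eq aff_dim_subspace)
qed

lemma affine_grassmannian_translation:
  assumes "\<tau> \<in> affine_grassmannian k"
  shows "subspace (direction \<tau>)" "\<tau> = (+) (closest_point \<tau> 0) ` direction \<tau>"
proof -
  from assms obtain a \<xi> where \<xi>: "\<xi> \<in> grassmannian k" "\<tau> = (+) a ` \<xi>"
    unfolding affine_grassmannian_iff by blast
  then have S: "subspace \<xi>" by (simp add: grassmannian_def)
  then show "subspace (direction \<tau>)" by (simp add: \<xi> direction_translation)
  let ?c = "a - closest_point \<xi> a"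
  have "(+) ?c ` \<xi> = (+) a ` \<xi>"
  proof (intro equalityI image_subsetI)
    fix s assume s: "s \<in> \<xi>"
    then have "closest_point \<xi> a + s \<in> \<xi>" "s - closest_point \<xi> a \<in> \<xi>"
      using closest_point_subspace_in[OF S, of a] S by (auto intro: subspace_add subspace_diff)
    moreover have "a + s = ?c + (closest_point \<xi> a + s)" "?c + s = a + (s - closest_point \<xi> a)" by simp_all
    ultimately show "?c + s \<in> (+) a ` \<xi>" "a + s \<in> (+) ?c ` \<xi>" by (metis imageI)+
  qed
  then show "\<tau> = (+) (closest_point \<tau> 0) ` direction \<tau>"
    by (simp add: \<xi> direction_translation[OF S] closest_point_translation_0[OF S])
qed

section \<open>Lebesgue measure on affine planes\<close>

lemma orthonormal_basis_properties:
  assumes "subspace \<xi>"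
  shows "orthonormal_basis \<xi> \<subseteq> \<xi>" "pairwise orthogonal (orthonormal_basis \<xi>)"
    "\<And>b. b \<in> orthonormal_basis \<xi> \<Longrightarrow> norm b = 1" "span (orthonormal_basis \<xi>) = \<xi>"
    "finite (orthonormal_basis \<xi>)"
proof -
  let ?P = "\<lambda>B. B \<subseteq> \<xi> \<and> pairwise orthogonal B \<and> (\<forall>b\<in>B. norm b = 1) \<and> span B = \<xi>"
  obtain B where "B \<subseteq> \<xi>" "pairwise orthogonal B" "\<And>x. x \<in> B \<Longrightarrow> norm x = 1"
    "independent B" "card B = dim \<xi>" "span B = \<xi>"
    by (rule orthonormal_basis_subspace[OF assms]) blast
  then have "\<exists>B. ?P B" by (intro exI[of _ B]) simp
  then have "?P (orthonormal_basis \<xi>)" unfolding orthonormal_basis_def by (rule someI_ex)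
  then show *: "orthonormal_basis \<xi> \<subseteq> \<xi>" "pairwise orthogonal (orthonormal_basis \<xi>)"
    "\<And>b. b \<in> orthonormal_basis \<xi> \<Longrightarrow> norm b = 1" "span (orthonormal_basis \<xi>) = \<xi>"
    by (elim conjE; simp)+
  have "0 \<notin> orthonormal_basis \<xi>" using *(3)[of 0] by auto
  then show "finite (orthonormal_basis \<xi>)"
    using pairwise_orthogonal_independent[OF *(2)] independent_imp_finite by simp
qed

lemma sets_flat_lborel [measurable_cong]: "sets (flat_lborel \<tau>) = sets (restrict_space borel \<tau>)"
  by (simp add: flat_lborel_def Let_def)

lemma space_flat_lborel: "space (flat_lborel \<tau>) = \<tau>"
  by (simp add: flat_lborel_def Let_def space_restrict_space)

text \<open>
  The chosen orthonormal basis drops out by \<open>nn_integral_span_orthonormal\<close>, and the chosen base point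
  because the measure on \<open>S\<close> is invariant under translations by vectors of \<open>S\<close>.
\<close>
lemma nn_integral_flat_lborel:
  fixes S :: "(real^'n) set" and f :: "real^'n \<Rightarrow> ennreal"
  assumes S: "subspace S" and [measurable]: "f \<in> borel_measurable borel"
  shows "(\<integral>\<^sup>+x. f x \<partial>flat_lborel ((+) a ` S)) = (\<integral>\<^sup>+u. f (a + u) \<partial>subspace_lborel S)"
proof -
  let ?B = "orthonormal_basis S" and ?c = "a - closest_point S a" and ?\<tau> = "(+) a ` S"
  let ?M = "\<Pi>\<^sub>M b\<in>?B. (lborel :: real measure)"
  note B = orthonormal_basis_properties[OF S]
  have in_\<tau>: "?c + (\<Sum>b\<in>?B. x b *\<^sub>R b) \<in> ?\<tau>" for x
  proof -
    have "- closest_point S a + (\<Sum>b\<in>?B. x b *\<^sub>R b) \<in> S"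
      using B(1) closest_point_subspace_in[OF S] S
      by (intro subspace_add subspace_neg subspace_sum subspace_scale) auto
    then have "a + (- closest_point S a + (\<Sum>b\<in>?B. x b *\<^sub>R b)) \<in> ?\<tau>" by blast
    then show ?thesis by (simp add: algebra_simps)
  qed
  have meas: "(\<lambda>c. ?c + (\<Sum>b\<in>?B. c b *\<^sub>R b)) \<in> ?M \<rightarrow>\<^sub>M restrict_space borel ?\<tau>"
    by (rule measurable_restrict_space2) (use in_\<tau> in \<open>simp, measurable\<close>)
  have "(\<integral>\<^sup>+x. f x \<partial>flat_lborel ?\<tau>) = (\<integral>\<^sup>+c. f (?c + (\<Sum>b\<in>?B. c b *\<^sub>R b)) \<partial>?M)"
    unfolding flat_lborel_def Let_def direction_translation[OF S] closest_point_translation_0[OF S]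
    by (rule nn_integral_distr[OF meas]) (auto intro: measurable_restrict_space1)
  also have "\<dots> = (\<integral>\<^sup>+u. f (?c + u) \<partial>subspace_lborel (span ?B))"
    by (rule nn_integral_span_orthonormal[OF B(5,2,3), symmetric]) measurable
  also have "\<dots> = (\<integral>\<^sup>+u. f (a + u) \<partial>subspace_lborel S)"
    using nn_integral_subspace_lborel_translation[OF S closest_point_subspace_in[OF S, of a], of "\<lambda>u. f (?c + u)"]
    by (simp add: B(4) algebra_simps)
  finally show ?thesis .
qed

lemma nn_integral_flat_lborel_subspace:
  fixes S :: "(real^'n) set" and f :: "real^'n \<Rightarrow> ennreal"
  assumes S: "subspace S" and f: "f \<in> borel_measurable borel"
  shows "(\<integral>\<^sup>+x. f x \<partial>flat_lborel S) = (\<integral>\<^sup>+u. f u \<partial>subspace_lborel S)"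
  using nn_integral_flat_lborel[OF S f, of 0] by simp

lemma sigma_finite_flat_lborel:
  fixes S :: "(real^'n) set"
  assumes S: "subspace S"
  shows "sigma_finite_measure (flat_lborel ((+) a ` S))"
proof
  let ?\<tau> = "(+) a ` S"
  let ?A = "range (\<lambda>n. cball 0 (real n) \<inter> ?\<tau>)"
  have sets: "cball 0 r \<inter> ?\<tau> \<in> sets (flat_lborel ?\<tau>)" for r
    unfolding sets_flat_lborel sets_restrict_space by (rule image_eqI[of _ _ "cball 0 r"]) auto
  have fin: "emeasure (flat_lborel ?\<tau>) (cball 0 r \<inter> ?\<tau>) < \<infinity>" for r
  proof -
    have "emeasure (flat_lborel ?\<tau>) (cball 0 r \<inter> ?\<tau>) = (\<integral>\<^sup>+x. indicator (cball 0 r \<inter> ?\<tau>) x \<partial>flat_lborel ?\<tau>)"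
      by (rule nn_integral_indicator[OF sets, symmetric])
    also have "\<dots> = (\<integral>\<^sup>+x. indicator (cball 0 r) x \<partial>flat_lborel ?\<tau>)"
      by (intro nn_integral_cong) (auto simp: space_flat_lborel indicator_def)
    also have "\<dots> = (\<integral>\<^sup>+u. indicator (cball 0 r) (a + u) \<partial>subspace_lborel S)"
      by (rule nn_integral_flat_lborel[OF S]) (rule borel_measurable_indicator, simp)
    also have "\<dots> \<le> (\<integral>\<^sup>+u. indicator (cball 0 (r + norm a)) u \<partial>subspace_lborel S)"
    proof (intro nn_integral_mono)
      fix u
      have "norm u \<le> norm (a + u) + norm a" using norm_triangle_ineq4[of "a + u" a] by simp
      then show "indicator (cball 0 r) (a + u) \<le> (indicator (cball 0 (r + norm a)) u :: ennreal)"
        by (auto simp: indicator_def)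
    qed
    also have "\<dots> < \<infinity>" using emeasure_subspace_lborel_cball_finite[OF S] by simp
    finally show ?thesis .
  qed
  have "\<Union> ?A = ?\<tau>" by (auto simp: real_arch_simple)
  then show "\<exists>A. countable A \<and> A \<subseteq> sets (flat_lborel ?\<tau>) \<and> \<Union> A = space (flat_lborel ?\<tau>) \<and>
     (\<forall>a\<in>A. emeasure (flat_lborel ?\<tau>) a \<noteq> \<infinity>)"
    using fin sets by (intro exI[of _ ?A]) (auto simp: space_flat_lborel less_top[symmetric])
qed

lemma measurable_PiM_flat_lborel:
  assumes "f \<in> (\<Pi>\<^sub>M j\<in>J. borel) \<rightarrow>\<^sub>M N"
  shows "f \<in> (\<Pi>\<^sub>M j\<in>J. flat_lborel \<tau>) \<rightarrow>\<^sub>M N"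
proof -
  have "(\<lambda>x. \<lambda>j\<in>J. x j) \<in> (\<Pi>\<^sub>M j\<in>J. flat_lborel \<tau>) \<rightarrow>\<^sub>M (\<Pi>\<^sub>M j\<in>J. borel)"
  proof (rule measurable_restrict)
    fix j assume "j \<in> J"
    have "(\<lambda>x. x) \<in> flat_lborel \<tau> \<rightarrow>\<^sub>M borel" 
      unfolding measurable_cong_sets[OF sets_flat_lborel refl] by (intro measurable_restrict_space1) simp
    then show "(\<lambda>x. x j) \<in> (\<Pi>\<^sub>M j\<in>J. flat_lborel \<tau>) \<rightarrow>\<^sub>M borel"
      by (rule measurable_compose[OF measurable_component_singleton[OF \<open>j \<in> J\<close>]])
  qed
  from measurable_compose[OF this assms]
  have "(\<lambda>x. f (\<lambda>j\<in>J. x j)) \<in> (\<Pi>\<^sub>M j\<in>J. flat_lborel \<tau>) \<rightarrow>\<^sub>M N" .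
  then show ?thesis
    by (rule measurable_cong[THEN iffD1, rotated]) (auto simp: space_PiM PiE_iff extensional_restrict)
qed

lemma nn_integral_PiM_flat_lborel:
  fixes S :: "(real^'n) set"
  assumes S: "subspace S" and J: "finite J" and f [measurable]: "f \<in> borel_measurable (\<Pi>\<^sub>M j\<in>J. borel)"
  shows "(\<integral>\<^sup>+x. f x \<partial>(\<Pi>\<^sub>M j\<in>J. flat_lborel ((+) a ` S)))
    = (\<integral>\<^sup>+u. f (\<lambda>j\<in>J. a + u j) \<partial>(\<Pi>\<^sub>M j\<in>J. subspace_lborel S))"
proof -
  let ?F = "flat_lborel ((+) a ` S)"
  have "(\<integral>\<^sup>+u. f (\<lambda>j\<in>J. a + u j) \<partial>(\<Pi>\<^sub>M j\<in>J. subspace_lborel S))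
      = (\<integral>\<^sup>+x. f (\<lambda>j\<in>J. a + (\<lambda>j\<in>J. x j - a) j) \<partial>(\<Pi>\<^sub>M j\<in>J. ?F))"
  proof (rule nn_integral_PiM_distr[OF J sigma_finite_flat_lborel[OF S] sigma_finite_subspace_lborel[OF S]])
    have "(\<lambda>x. x - a) \<in> restrict_space borel ((+) a ` S) \<rightarrow>\<^sub>M borel" by (intro measurable_restrict_space1) measurable
    then show "(\<lambda>x. x - a) \<in> ?F \<rightarrow>\<^sub>M subspace_lborel S"
      unfolding measurable_cong_sets[OF sets_flat_lborel sets_subspace_lborel] .
    show "(\<integral>\<^sup>+x. f x \<partial>subspace_lborel S) = (\<integral>\<^sup>+x. f (x - a) \<partial>?F)" if "f \<in> borel_measurable (subspace_lborel S)" for f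
    proof -
      have [measurable]: "f \<in> borel_measurable borel" using that by (simp cong: measurable_cong_sets)
      show ?thesis using nn_integral_flat_lborel[OF S, of "\<lambda>x. f (x - a)" a] by simp
    qed
  qed measurable
  also have "\<dots> = (\<integral>\<^sup>+x. f x \<partial>(\<Pi>\<^sub>M j\<in>J. ?F))"
  proof (rule nn_integral_cong)
    fix x assume "x \<in> space (\<Pi>\<^sub>M j\<in>J. ?F)"
    then have "(\<lambda>j\<in>J. a + (\<lambda>j\<in>J. x j - a) j) = x"
      by (auto simp: space_PiM PiE_iff extensional_def fun_eq_iff)
    then show "f (\<lambda>j\<in>J. a + (\<lambda>j\<in>J. x j - a) j) = f x" by simp
  qed
  finally show ?thesis ..
qed

section \<open>The measure on affine planes\<close>

lemma space_borel_affine_grassmannian [simp]: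
  "space (borel_affine_grassmannian k) = affine_grassmannian k"
  by (simp add: borel_affine_grassmannian_def)

lemma measurable_affine_grassmannian_coordinates:
  "(\<lambda>\<tau>. matrix (closest_point (direction \<tau>)) :: real^'n^'n) \<in> borel_measurable (borel_affine_grassmannian k)"
  "(\<lambda>\<tau>. closest_point \<tau> 0 :: real^'n) \<in> borel_measurable (borel_affine_grassmannian k)"
proof -
  have "(\<lambda>\<tau>. (matrix (closest_point (direction \<tau>)) :: real^'n^'n, closest_point \<tau> 0))
      \<in> borel_measurable (borel_affine_grassmannian k)"
    unfolding borel_affine_grassmannian_def by (rule measurable_vimage_algebra1) simp
  then have "(\<lambda>\<tau>. (matrix (closest_point (direction \<tau>)) :: real^'n^'n, closest_point \<tau> 0))
      \<in> borel_affine_grassmannian k \<rightarrow>\<^sub>M borel \<Otimes>\<^sub>M borel" by (simp add: borel_prod)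
  from measurable_compose[OF this measurable_fst] measurable_compose[OF this measurable_snd]
  show "(\<lambda>\<tau>. matrix (closest_point (direction \<tau>)) :: real^'n^'n) \<in> borel_measurable (borel_affine_grassmannian k)"
    "(\<lambda>\<tau>. closest_point \<tau> 0 :: real^'n) \<in> borel_measurable (borel_affine_grassmannian k)" by simp_all
qed

lemma borel_measurable_nn_integral_PiM_flat_lborel:
  fixes f :: "('j \<Rightarrow> real^'n) \<Rightarrow> ennreal"
  assumes J: "finite J" and [measurable]: "f \<in> borel_measurable (\<Pi>\<^sub>M j\<in>J. borel)"
  shows "(\<lambda>\<tau>. \<integral>\<^sup>+x. f x \<partial>(\<Pi>\<^sub>M j\<in>J. flat_lborel \<tau>)) \<in> borel_measurable (borel_affine_grassmannian k)"
proof -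
  note [measurable] = measurable_affine_grassmannian_coordinates
  have "(\<lambda>\<tau>. \<integral>\<^sup>+u. f (\<lambda>j\<in>J. closest_point \<tau> 0 + u j) \<partial>(\<Pi>\<^sub>M j\<in>J. subspace_lborel (direction \<tau>)))
     \<in> borel_measurable (borel_affine_grassmannian k)"
    by (rule borel_measurable_nn_integral_PiM_moving_subspace[OF _ J])
      (use affine_grassmannian_translation in \<open>simp_all, measurable?\<close>)
  moreover have "(\<integral>\<^sup>+x. f x \<partial>(\<Pi>\<^sub>M j\<in>J. flat_lborel \<tau>))
     = (\<integral>\<^sup>+u. f (\<lambda>j\<in>J. closest_point \<tau> 0 + u j) \<partial>(\<Pi>\<^sub>M j\<in>J. subspace_lborel (direction \<tau>)))"
    if "\<tau> \<in> affine_grassmannian k" for \<tau>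
    using nn_integral_PiM_flat_lborel[OF affine_grassmannian_translation(1)[OF that] J, of f "closest_point \<tau> 0"]
    by (simp add: affine_grassmannian_translation(2)[OF that, symmetric])
  ultimately show ?thesis by (subst measurable_cong) auto
qed

text \<open>The coordinates of the plane \<open>\<xi> + a\<close> are \<open>P\<close> and \<open>a - P a\<close>, with \<open>P\<close> the projection matrix of \<open>\<xi>\<close>.\<close>
lemma measurable_affine_plane:
  fixes V :: "'b \<Rightarrow> (real^'n) set"
  assumes V: "\<And>l. l \<in> space L \<Longrightarrow> V l \<in> grassmannian k"
    and [measurable]: "(\<lambda>l. matrix (closest_point (V l)) :: real^'n^'n) \<in> borel_measurable L"
    and [measurable]: "a \<in> borel_measurable L"
  shows "(\<lambda>l. (+) (a l) ` V l) \<in> L \<rightarrow>\<^sub>M borel_affine_grassmannian k"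
  unfolding borel_affine_grassmannian_def
proof (rule measurable_vimage_algebra2)
  show "(\<lambda>l. (+) (a l) ` V l) \<in> space L \<rightarrow> affine_grassmannian k"
    using V by (intro Pi_I affine_grassmannian_iff[THEN iffD2] exI bexI) auto
  have "(\<lambda>l. (matrix (closest_point (V l)) :: real^'n^'n, a l - matrix (closest_point (V l)) *v a l)) \<in> borel_measurable L"
    by measurable
  moreover have "(matrix (closest_point (direction ((+) (a l) ` V l))) :: real^'n^'n, closest_point ((+) (a l) ` V l) 0)
      = (matrix (closest_point (V l)), a l - matrix (closest_point (V l)) *v a l)" if "l \<in> space L" for l
  proof -
    have "subspace (V l)" using V[OF that] by (simp add: grassmannian_def)
    then show ?thesis
      by (simp add: direction_translation closest_point_translation_0 
          matrix_of_linear_apply[OF linear_closest_point_subspace])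
  qed
  ultimately show "(\<lambda>l. (matrix (closest_point (direction ((+) (a l) ` V l))) :: real^'n^'n, closest_point ((+) (a l) ` V l) 0))
     \<in> borel_measurable L" by (subst measurable_cong) auto
qed

lemma closest_point_orthogonal_comp:
  fixes \<xi> :: "'a::euclidean_space set"
  assumes \<xi>: "subspace \<xi>"
  shows "closest_point (orthogonal_comp \<xi>) x = x - closest_point \<xi> x"
proof (rule closest_point_subspace_eq)
  show "x - closest_point \<xi> x \<in> orthogonal_comp \<xi>"
    using closest_point_subspace_orthogonal[OF \<xi>, of _ x]
    by (auto simp: orthogonal_comp_def orthogonal_def inner_commute)
  show "(x - (x - closest_point \<xi> x)) \<bullet> v = 0" if "v \<in> orthogonal_comp \<xi>" for v
    using that closest_point_subspace_in[OF \<xi>] by (auto simp: orthogonal_comp_def orthogonal_def)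
qed (rule subspace_orthogonal_comp)

text \<open>
  That the defining formula is countably additive has to be shown. The projection onto the orthogonal complement
  of \<open>\<xi>\<close> is \<open>x - P x\<close>, so in the Gaussian description the formula is the image of the measure
  with density \<open>gauss (P x)\<close> on pairs \<open>(\<xi>, x)\<close> under the measurable map to \<open>\<xi> + (x - P x)\<close>.
\<close>
lemma
  fixes \<mu> :: "(real^'n) set measure"
  assumes \<mu>: "invariant_probability_grassmannian k \<mu>"
  shows sets_affine_grassmannian_measure:
      "sets (affine_grassmannian_measure k \<mu>) = sets (borel_affine_grassmannian k)" (is ?sets)
    and nn_integral_affine_grassmannian_measure:
      "\<And>H. H \<in> borel_measurable (borel_affine_grassmannian k) \<Longrightarrow>
        (\<integral>\<^sup>+\<tau>. H \<tau> \<partial>affine_grassmannian_measure k \<mu>)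
          = (\<integral>\<^sup>+\<xi>. \<integral>\<^sup>+z. H ((+) z ` \<xi>) \<partial>subspace_lborel (orthogonal_comp \<xi>) \<partial>\<mu>)"
proof -
  interpret \<mu>: prob_space \<mu> by (rule invariant_probability_grassmannianD[OF \<mu>])
  note sets_\<mu> [measurable_cong] = invariant_probability_grassmannianD(2)[OF \<mu>]
    and space_\<mu> = invariant_probability_grassmannianD(3)[OF \<mu>]
    and sub = invariant_probability_grassmannianD(4)[OF \<mu>]
    and P_meas [measurable] = invariant_probability_grassmannianD(5)[OF \<mu>]
  define p where "p \<xi> x = matrix (closest_point \<xi>) *v (x :: real^'n)" for \<xi> x
  have p: "p \<xi> x = closest_point \<xi> x" if "\<xi> \<in> space \<mu>" for \<xi> x
    unfolding p_def by (rule matrix_of_linear_apply[OF linear_closest_point_subspace[OF sub[OF that]]])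
  have p_meas [measurable]: "(\<lambda>l. p (F l) (G l)) \<in> borel_measurable M"
    if [measurable]: "F \<in> M \<rightarrow>\<^sub>M \<mu>" "G \<in> borel_measurable M" for F G and M :: "'z measure"
    unfolding p_def using measurable_compose[OF that(1) P_meas] by measurable
  define \<Psi> where "\<Psi> = (\<lambda>(\<xi>, x). (+) (x - p \<xi> x) ` \<xi>)"
  define D where "D = density (\<mu> \<Otimes>\<^sub>M lborel) (\<lambda>(\<xi>, x). ennreal (gauss (p \<xi> x)))"
  have sets_D [measurable_cong]: "sets D = sets (\<mu> \<Otimes>\<^sub>M borel)"
    unfolding D_def sets_density by (rule sets_pair_measure_cong) auto
  have \<Psi> [measurable]: "\<Psi> \<in> \<mu> \<Otimes>\<^sub>M borel \<rightarrow>\<^sub>M borel_affine_grassmannian k"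
    unfolding \<Psi>_def split_beta'
  proof (rule measurable_affine_plane)
    show "(\<lambda>l. matrix (closest_point (fst l)) :: real^'n^'n) \<in> borel_measurable (\<mu> \<Otimes>\<^sub>M borel)"
      by (rule measurable_compose[OF measurable_fst P_meas])
  qed (auto simp: space_pair_measure space_\<mu>, measurable)
  let ?P = "distr D (borel_affine_grassmannian k) \<Psi>"
  have int_P: "(\<integral>\<^sup>+\<tau>. H \<tau> \<partial>?P) = (\<integral>\<^sup>+\<xi>. \<integral>\<^sup>+z. H ((+) z ` \<xi>) \<partial>subspace_lborel (orthogonal_comp \<xi>) \<partial>\<mu>)"
    if H [measurable]: "H \<in> borel_measurable (borel_affine_grassmannian k)" for H
  proof -
    have [measurable]: "(\<lambda>x. gauss (p (fst x) (snd x)) * H (\<Psi> x)) \<in> borel_measurable (\<mu> \<Otimes>\<^sub>M lborel)"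
      "(\<lambda>x. H (\<Psi> x)) \<in> borel_measurable (\<mu> \<Otimes>\<^sub>M lborel)"
      "(\<lambda>x. ennreal (gauss (p (fst x) (snd x)))) \<in> borel_measurable (\<mu> \<Otimes>\<^sub>M lborel)"
      using sets_pair_measure_cong[OF refl sets_lborel, of \<mu>] by (simp_all cong: measurable_cong_sets)
    have "(\<integral>\<^sup>+\<tau>. H \<tau> \<partial>?P) = (\<integral>\<^sup>+x. H (\<Psi> x) \<partial>D)" by (rule nn_integral_distr) measurable
    also have "\<dots> = (\<integral>\<^sup>+x. gauss (p (fst x) (snd x)) * H (\<Psi> x) \<partial>(\<mu> \<Otimes>\<^sub>M lborel))"
      unfolding D_def split_beta' by (rule nn_integral_density) measurable
    also have "\<dots> = (\<integral>\<^sup>+\<xi>. \<integral>\<^sup>+x. gauss (p \<xi> x) * H (\<Psi> (\<xi>, x)) \<partial>lborel \<partial>\<mu>)"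
      by (subst lborel.nn_integral_fst[symmetric]) auto
    also have "\<dots> = (\<integral>\<^sup>+\<xi>. \<integral>\<^sup>+z. H ((+) z ` \<xi>) \<partial>subspace_lborel (orthogonal_comp \<xi>) \<partial>\<mu>)"
    proof (rule nn_integral_cong, goal_cases)
      case (1 \<xi>)
      note \<xi> = 1
      have [measurable]: "(\<lambda>z. (+) z ` \<xi>) \<in> borel \<rightarrow>\<^sub>M borel_affine_grassmannian k"
        by (rule measurable_affine_plane) (use \<xi> space_\<mu> in simp_all)
      show ?case
        by (subst nn_integral_subspace_lborel)
          (simp_all add: subspace_orthogonal_comp closest_point_orthogonal_comp[OF sub[OF \<xi>]] p[OF \<xi>] \<Psi>_def)
    qed
    finally show ?thesis .
  qed
  have eq: "affine_grassmannian_measure k \<mu> = ?P"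
  proof -
    have "(\<integral>\<^sup>+ \<xi>. (\<integral>\<^sup>+ z. indicator A ((+) z ` \<xi>) \<partial>flat_lborel (orthogonal_comp \<xi>)) \<partial>\<mu>) = emeasure ?P A"
      if A: "A \<in> sets (borel_affine_grassmannian k)" for A
    proof -
      have "emeasure ?P A = (\<integral>\<^sup>+\<tau>. indicator A \<tau> \<partial>?P)" using A by simp
      also have "\<dots> = (\<integral>\<^sup>+\<xi>. \<integral>\<^sup>+z. indicator A ((+) z ` \<xi>) \<partial>subspace_lborel (orthogonal_comp \<xi>) \<partial>\<mu>)"
        by (rule int_P) (rule borel_measurable_indicator[OF A])
      also have "\<dots> = (\<integral>\<^sup>+\<xi>. \<integral>\<^sup>+z. indicator A ((+) z ` \<xi>) \<partial>flat_lborel (orthogonal_comp \<xi>) \<partial>\<mu>)"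
      proof (rule nn_integral_cong, goal_cases)
        case (1 \<xi>)
        note \<xi> = 1
        have "(\<lambda>z. (+) z ` \<xi>) \<in> borel \<rightarrow>\<^sub>M borel_affine_grassmannian k"
          by (rule measurable_affine_plane) (use \<xi> space_\<mu> in simp_all)
        from measurable_compose[OF this borel_measurable_indicator[OF A]]
        show ?case
          by (intro nn_integral_flat_lborel_subspace[symmetric] subspace_orthogonal_comp)
      qed
      finally show ?thesis ..
    qed
    then have "affine_grassmannian_measure k \<mu>
        = measure_of (space (borel_affine_grassmannian k)) (sets (borel_affine_grassmannian k)) (emeasure ?P)"
      unfolding affine_grassmannian_measure_def space_borel_affine_grassmannian[symmetric, of k]
      by (intro measure_of_eq sets.space_closed) (simp only: sets.sigma_sets_eq)
    also have "\<dots> = ?P" using measure_of_of_measure[of ?P] by simp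
    finally show ?thesis .
  qed
  show ?sets by (simp add: eq)
  show "(\<integral>\<^sup>+\<tau>. H \<tau> \<partial>affine_grassmannian_measure k \<mu>)
      = (\<integral>\<^sup>+\<xi>. \<integral>\<^sup>+z. H ((+) z ` \<xi>) \<partial>subspace_lborel (orthogonal_comp \<xi>) \<partial>\<mu>)"
    if "H \<in> borel_measurable (borel_affine_grassmannian k)" for H
    unfolding eq by (rule int_P[OF that])
qed

section \<open>The affine formula for nonnegative functions\<close>

text \<open>
  The volume of the Stiefel manifold as a product of sphere areas in the dimensions \<open>m, m - 1, \<dots>\<close>, written
  with real differences so that it holds for all \<open>q\<close>.
\<close>
lemma stiefel_volume_eq_prod:
  "stiefel_volume m q = (\<Prod>j<q. 2 * pi powr ((real m - real j) / 2) / Gamma ((real m - real j) / 2))"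
proof (induction q)
  case 0
  then show ?case by (simp add: stiefel_volume_def Siegel_Gamma_def)
next
  case (Suc q)
  have e: "real m * real (Suc q) / 2 = real m * real q / 2 + real m / 2"
    "real (Suc q) * (real (Suc q) - 1) / 4 = real q * (real q - 1) / 4 + real q / 2"
    "(real m - real q) / 2 = real m / 2 - real q / 2"
    by (simp_all add: field_simps)
  have "stiefel_volume m (Suc q)
      = stiefel_volume m q * (2 * pi powr ((real m - real q) / 2) / Gamma ((real m - real q) / 2))"
    unfolding stiefel_volume_def Siegel_Gamma_def e powr_add powr_diff
    by (simp add: field_simps)
  then show ?case using Suc by simp
qed

lemma stiefel_volume_quotient:
  assumes "q \<le> k" "k \<le> n"
  shows "stiefel_volume n q / stiefel_volume k q = dimension_change_const n k q"
proof -
  have "stiefel_volume m q = (\<Prod>j<q. sphere_area (m - j))" if "q \<le> m" for m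
  proof -
    show ?thesis
      unfolding stiefel_volume_eq_prod
      using that by (intro prod.cong) (auto simp: sphere_area_def of_nat_diff)
  qed
  then show ?thesis using assms by (simp add: dimension_change_const_def prod_dividef)
qed

lemma simplex_volume_translation:
  "simplex_volume q (\<lambda>j\<in>{..<Suc q}. a + u j) = simplex_volume q u"
  unfolding simplex_volume_eq by (subst parallelotope_volume_cong[of q _ "\<lambda>j. u (Suc j) - u 0"]) auto

lemma simplex_volume_case_nat:
  "simplex_volume q (case_nat u (\<lambda>j\<in>{..<q}. u + y j)) = parallelotope_volume q y / fact q"
  unfolding simplex_volume_eq by (subst parallelotope_volume_cong[of q _ y]) auto

lemma simplex_volume_nonneg [simp]: "0 \<le> simplex_volume q x"
  by (simp add: simplex_volume_eq)

lemma measurable_simplex_volume [measurable]: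
  "simplex_volume q \<in> borel_measurable (tuples (Suc q) (borel :: (real^'n) measure))"
  unfolding simplex_volume_eq by measurable

lemma nn_integral_PiM_subspace_lborel_translation:
  fixes V :: "'a::euclidean_space set"
  assumes V: "subspace V" and J: "finite J" and v: "v \<in> V"
    and f [measurable]: "f \<in> borel_measurable (\<Pi>\<^sub>M j\<in>J. borel)"
  shows "(\<integral>\<^sup>+y. f (\<lambda>j\<in>J. v + y j) \<partial>(\<Pi>\<^sub>M j\<in>J. subspace_lborel V)) = (\<integral>\<^sup>+y. f y \<partial>(\<Pi>\<^sub>M j\<in>J. subspace_lborel V))"
proof (rule nn_integral_PiM_distr[OF J _ _ _ _, symmetric])
  show "sigma_finite_measure (subspace_lborel V)" "sigma_finite_measure (subspace_lborel V)"
    by (simp_all add: sigma_finite_subspace_lborel[OF V])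
  show "(\<integral>\<^sup>+x. f x \<partial>subspace_lborel V) = (\<integral>\<^sup>+x. f (v + x) \<partial>subspace_lborel V)"
    if "f \<in> borel_measurable (subspace_lborel V)" for f
    using nn_integral_subspace_lborel_translation[OF V v, of f] that by (simp cong: measurable_cong_sets)
qed measurable

text \<open>
  On the plane \<open>\<xi> + z\<close> write \<open>x\<^sub>0 = z + u\<close> and \<open>x\<^sub>j = x\<^sub>0 + y\<^sub>j\<close>. The inner integral over the \<open>y\<^sub>j\<close> becomes a
  function \<open>T\<close> of \<open>\<xi>\<close> and \<open>x\<^sub>0\<close> alone, and integrating \<open>T\<close> over \<open>u\<close> in \<open>\<xi>\<close> and \<open>z\<close> in its orthogonal complement is
  integrating over all \<open>x\<^sub>0\<close>. For fixed \<open>x\<^sub>0\<close> the linear formula applies.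
\<close>
lemma affine_blaschke_petkantschin_nn_integral:
  fixes \<mu> :: "(real^'n) set measure"
  assumes q: "q \<le> k" and k: "k \<le> CARD('n)" and \<mu>: "invariant_probability_grassmannian k \<mu>"
    and f [measurable]: "f \<in> borel_measurable (tuples (Suc q) borel)"
  shows "(\<integral>\<^sup>+x. f x \<partial>tuples (Suc q) (lborel :: (real^'n) measure)) =
    ennreal (fact q ^ (CARD('n) - k) * stiefel_volume CARD('n) q / stiefel_volume k q) *
    (\<integral>\<^sup>+\<tau>. \<integral>\<^sup>+x. f x * ennreal (simplex_volume q x ^ (CARD('n) - k)) \<partial>tuples (Suc q) (flat_lborel \<tau>)
      \<partial>affine_grassmannian_measure k \<mu>)"
proof -
  interpret \<mu>: prob_space \<mu> by (rule invariant_probability_grassmannianD[OF \<mu>])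
  note sets_\<mu> [measurable_cong] = invariant_probability_grassmannianD(2)[OF \<mu>]
    and space_\<mu> = invariant_probability_grassmannianD(3)[OF \<mu>]
    and sub = invariant_probability_grassmannianD(4)[OF \<mu>]
    and P_meas [measurable] = invariant_probability_grassmannianD(5)[OF \<mu>]
  note [measurable] = measurable_case_nat_PiM
  let ?m = "CARD('n) - k" and ?C = "dimension_change_const CARD('n) k q"
  let ?\<Xi> = "\<lambda>\<xi>. tuples q (subspace_lborel (\<xi> :: (real^'n) set))"
  let ?\<Delta> = "\<lambda>x. ennreal (simplex_volume q x ^ ?m)"
  define w where "w y = ennreal ((parallelotope_volume q y / fact q) ^ ?m)" for y :: "nat \<Rightarrow> real^'n"
  define F where "F x0 y = f (case_nat x0 (\<lambda>j\<in>{..<q}. x0 + y j))" for x0 and y :: "nat \<Rightarrow> real^'n"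
  define T where "T \<xi> x0 = (\<integral>\<^sup>+y. F x0 y * w y \<partial>?\<Xi> \<xi>)" for \<xi> x0
  have w [measurable]: "w \<in> borel_measurable (tuples q borel)"
    unfolding w_def by measurable
  have F [measurable]: "(\<lambda>l. F (a l) (b l)) \<in> borel_measurable M"
    if [measurable]: "a \<in> borel_measurable M" "b \<in> M \<rightarrow>\<^sub>M tuples q borel" for a b and M :: "'z measure"
    unfolding F_def by measurable

  have plane: "(\<integral>\<^sup>+x. f x * ?\<Delta> x \<partial>tuples (Suc q) (flat_lborel ((+) z ` \<xi>)))
      = (\<integral>\<^sup>+u. T \<xi> (z + u) \<partial>subspace_lborel \<xi>)" if \<xi>: "\<xi> \<in> space \<mu>" for \<xi> z
  proof -
    have "(\<integral>\<^sup>+x. f x * ?\<Delta> x \<partial>tuples (Suc q) (flat_lborel ((+) z ` \<xi>)))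
        = (\<integral>\<^sup>+u. f (\<lambda>j\<in>{..<Suc q}. z + u j) * ?\<Delta> u \<partial>tuples (Suc q) (subspace_lborel \<xi>))"
      by (subst nn_integral_PiM_flat_lborel[OF sub[OF \<xi>]]) (simp_all add: simplex_volume_translation)
    also have "\<dots> = (\<integral>\<^sup>+u. \<integral>\<^sup>+y. f (\<lambda>j\<in>{..<Suc q}. z + case_nat u y j) * ?\<Delta> (case_nat u y) \<partial>?\<Xi> \<xi> \<partial>subspace_lborel \<xi>)"
      by (rule nn_integral_PiM_Suc[OF sigma_finite_subspace_lborel[OF sub[OF \<xi>]]]) measurable
    also have "\<dots> = (\<integral>\<^sup>+u. T \<xi> (z + u) \<partial>subspace_lborel \<xi>)"
    proof (rule nn_integral_cong_AE, goal_cases)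
      case 1
      show ?case
        using AE_subspace_lborel[OF sub[OF \<xi>]]
      proof eventually_elim
        case (elim u)
        have "(\<integral>\<^sup>+y. f (\<lambda>j\<in>{..<Suc q}. z + case_nat u y j) * ?\<Delta> (case_nat u y) \<partial>?\<Xi> \<xi>)
          = (\<integral>\<^sup>+y. f (\<lambda>j\<in>{..<Suc q}. z + case_nat u (\<lambda>j\<in>{..<q}. u + y j) j) * ?\<Delta> (case_nat u (\<lambda>j\<in>{..<q}. u + y j)) \<partial>?\<Xi> \<xi>)"
          by (rule nn_integral_PiM_subspace_lborel_translation[OF sub[OF \<xi>] _ elim, symmetric]) (simp, measurable)
        moreover have "(\<lambda>j\<in>{..<Suc q}. z + case_nat u (\<lambda>j\<in>{..<q}. u + y j) j) = case_nat (z + u) (\<lambda>j\<in>{..<q}. z + u + y j)" for y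
          by (auto simp: fun_eq_iff split: nat.split)
        ultimately show ?case
          by (simp add: T_def F_def w_def simplex_volume_case_nat)
      qed
    qed
    finally show ?thesis .
  qed
  have T_meas: "(\<lambda>p. T (fst p) (snd p)) \<in> borel_measurable (\<mu> \<Otimes>\<^sub>M borel)"
    unfolding T_def
    by (rule borel_measurable_nn_integral_PiM_moving_subspace)
      (use sub in \<open>auto simp: space_pair_measure intro: measurable_compose[OF measurable_fst P_meas], measurable?\<close>)
  have T_meas': "T \<xi> \<in> borel_measurable borel" if "\<xi> \<in> space \<mu>" for \<xi>
    using measurable_compose[OF measurable_Pair1'[OF that] T_meas] by simp
  have "(\<integral>\<^sup>+\<tau>. \<integral>\<^sup>+x. f x * ?\<Delta> x \<partial>tuples (Suc q) (flat_lborel \<tau>) \<partial>affine_grassmannian_measure k \<mu>)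
     = (\<integral>\<^sup>+\<xi>. \<integral>\<^sup>+z. \<integral>\<^sup>+x. f x * ?\<Delta> x \<partial>tuples (Suc q) (flat_lborel ((+) z ` \<xi>))
         \<partial>subspace_lborel (orthogonal_comp \<xi>) \<partial>\<mu>)"
    by (rule nn_integral_affine_grassmannian_measure[OF \<mu>])
      (rule borel_measurable_nn_integral_PiM_flat_lborel, simp, measurable)
  also have "\<dots> = (\<integral>\<^sup>+\<xi>. \<integral>\<^sup>+x0. T \<xi> x0 \<partial>lborel \<partial>\<mu>)"
  proof (rule nn_integral_cong, goal_cases)
    case (1 \<xi>)
    note \<xi> = 1
    have "orthogonal_sum (orthogonal_comp \<xi>) \<xi> UNIV"
    proof (rule orthogonal_sumI)
      show "subspace (orthogonal_comp \<xi>)" by (rule subspace_orthogonal_comp)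
      show "\<exists>w\<in>orthogonal_comp \<xi>. v - w \<in> \<xi>" for v
        using closest_point_subspace_in[OF sub[OF \<xi>], of v]
          closest_point_subspace_in[OF subspace_orthogonal_comp, of \<xi> v]
        by (intro bexI[of _ "v - closest_point \<xi> v"]) (auto simp: closest_point_orthogonal_comp[OF sub[OF \<xi>]])
    qed (use sub[OF \<xi>] in \<open>auto simp: orthogonal_comp_def orthogonal_def inner_commute\<close>)
    from nn_integral_subspace_lborel_orthogonal_sum[OF this T_meas'[OF \<xi>]]
    show ?case
      by (simp add: plane[OF \<xi>])
  qed
  also have "\<dots> = (\<integral>\<^sup>+x0. \<integral>\<^sup>+\<xi>. T \<xi> x0 \<partial>\<mu> \<partial>lborel)"
  proof -
    interpret p: pair_sigma_finite \<mu> "lborel :: (real^'n) measure" ..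
    have "(\<lambda>(\<xi>, x0). T \<xi> x0) \<in> borel_measurable (\<mu> \<Otimes>\<^sub>M lborel)"
      using T_meas sets_pair_measure_cong[OF refl sets_lborel, of \<mu>]
      by (simp add: split_beta' cong: measurable_cong_sets)
    then show ?thesis by (rule p.Fubini'[symmetric])
  qed
  finally have RHS: "(\<integral>\<^sup>+\<tau>. \<integral>\<^sup>+x. f x * ?\<Delta> x \<partial>tuples (Suc q) (flat_lborel \<tau>) \<partial>affine_grassmannian_measure k \<mu>)
     = (\<integral>\<^sup>+x0. \<integral>\<^sup>+\<xi>. T \<xi> x0 \<partial>\<mu> \<partial>lborel)" .
  have const: "fact q ^ ?m * stiefel_volume CARD('n) q / stiefel_volume k q = ?C * fact q ^ ?m"
    by (simp flip: stiefel_volume_quotient[OF q k])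
  have linear: "ennreal (?C * fact q ^ ?m) * (\<integral>\<^sup>+\<xi>. T \<xi> x0 \<partial>\<mu>)
      = (\<integral>\<^sup>+y. F x0 y \<partial>tuples q (lborel :: (real^'n) measure))" for x0
  proof -
    have "ennreal (?C * fact q ^ ?m) * (\<integral>\<^sup>+\<xi>. T \<xi> x0 \<partial>\<mu>) = ennreal ?C * (ennreal (fact q ^ ?m) * (\<integral>\<^sup>+\<xi>. T \<xi> x0 \<partial>\<mu>))"
      using dimension_change_const_pos[OF q k] by (simp add: ennreal_mult' mult.assoc)
    also have "ennreal (fact q ^ ?m) * (\<integral>\<^sup>+\<xi>. T \<xi> x0 \<partial>\<mu>) = (\<integral>\<^sup>+\<xi>. ennreal (fact q ^ ?m) * T \<xi> x0 \<partial>\<mu>)"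
      using measurable_compose[OF measurable_Pair2'[of x0] T_meas]
      by (intro nn_integral_cmult[symmetric]) simp
    also have "\<dots> = (\<integral>\<^sup>+\<xi>. \<integral>\<^sup>+y. ennreal (parallelotope_volume q y ^ ?m) * F x0 y \<partial>?\<Xi> \<xi> \<partial>\<mu>)"
    proof (rule nn_integral_cong, goal_cases)
      case (1 \<xi>)
      note \<xi> = 1
      have "ennreal (fact q ^ ?m) * T \<xi> x0 = (\<integral>\<^sup>+y. ennreal (fact q ^ ?m) * (F x0 y * w y) \<partial>?\<Xi> \<xi>)"
        unfolding T_def by (rule nn_integral_cmult[symmetric]) measurable
      also have "\<dots> = (\<integral>\<^sup>+y. ennreal (parallelotope_volume q y ^ ?m) * F x0 y \<partial>?\<Xi> \<xi>)"
      proof (rule nn_integral_cong, goal_cases)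
        case (1 y)
        have "ennreal (fact q ^ ?m) * w y = ennreal (parallelotope_volume q y ^ ?m)"
          unfolding w_def by (subst ennreal_mult'[symmetric]) (simp_all add: power_divide)
        then show ?case
          by (simp only: mult.assoc[symmetric] mult.commute[of "F x0 y" "w y"])
      qed
      finally show ?case .
    qed
    finally show ?thesis
      using linear_blaschke_petkantschin[OF q k \<mu>, of "F x0"] by simp
  qed
  have "ennreal (?C * fact q ^ ?m) * (\<integral>\<^sup>+x0. \<integral>\<^sup>+\<xi>. T \<xi> x0 \<partial>\<mu> \<partial>lborel)
     = (\<integral>\<^sup>+x0. ennreal (?C * fact q ^ ?m) * (\<integral>\<^sup>+\<xi>. T \<xi> x0 \<partial>\<mu>) \<partial>lborel)"
  proof (rule nn_integral_cmult[symmetric])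
    have "(\<lambda>(x0, \<xi>). T \<xi> x0) \<in> borel_measurable (borel \<Otimes>\<^sub>M \<mu>)"
      using measurable_compose[OF measurable_pair_swap' T_meas] by (simp add: split_beta')
    then show "(\<lambda>x0. \<integral>\<^sup>+\<xi>. T \<xi> x0 \<partial>\<mu>) \<in> borel_measurable lborel" by measurable
  qed
  also have "\<dots> = (\<integral>\<^sup>+x0. \<integral>\<^sup>+y. f (case_nat x0 y) \<partial>tuples q (lborel :: (real^'n) measure) \<partial>lborel)"
  proof (rule nn_integral_cong, goal_cases)
    case (1 x0)
    have "(\<lambda>y. f (case_nat x0 y)) \<in> borel_measurable (tuples q borel)" by measurable
    from nn_integral_PiM_subspace_lborel_translation[OF subspace_UNIV _ _ this, of x0]
    show ?case
      unfolding linear unfolding F_def by simp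
  qed
  also have "\<dots> = (\<integral>\<^sup>+x. f x \<partial>tuples (Suc q) (lborel :: (real^'n) measure))"
    by (rule nn_integral_PiM_Suc[OF sigma_finite_lborel, symmetric]) (simp cong: measurable_cong_sets sets_PiM_cong)
  finally show ?thesis unfolding RHS const ..
qed

section \<open>Integrable functions\<close>

text \<open>The completion makes every function measurable that agrees almost everywhere with a measurable one.\<close>
lemma integrable_completion_AE_eq:
  fixes f g :: "'a \<Rightarrow> 'b::{banach, second_countable_topology}"
  assumes f: "integrable M f" and eq: "AE x in M. g x = f x"
  shows "integrable (completion M) g" "integral\<^sup>L (completion M) g = integral\<^sup>L M f"
proof -
  have f_meas: "f \<in> borel_measurable M" by (rule borel_measurable_integrable[OF f])
  have ae: "AE x in completion M. g x = f x" using eq by (rule AE_completion)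
  have g_meas: "g \<in> borel_measurable (completion M)"
  proof (rule measurableI)
    fix S :: "'b set" assume "S \<in> sets borel"
    with measurable_completion[OF f_meas] have A: "f -` S \<inter> space (completion M) \<in> sets (completion M)"
      by (rule measurable_sets)
    have "AE x in completion M. x \<in> f -` S \<inter> space (completion M) \<longleftrightarrow> x \<in> g -` S \<inter> space (completion M)"
      using ae by eventually_elim simp
    then show "g -` S \<inter> space (completion M) \<in> sets (completion M)"
      by (rule completion.in_sets_AE[OF _ A]) (rule Int_lower2)
  qed (simp only: space_borel UNIV_I)
  have f_meas': "f \<in> borel_measurable (completion M)" by (rule measurable_completion[OF f_meas])
  show "integrable (completion M) g"
    unfolding integrable_cong_AE[OF g_meas f_meas' ae] integrable_completion[OF f_meas] by (rule f)
  show "integral\<^sup>L (completion M) g = integral\<^sup>L M f"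
    unfolding integral_cong_AE[OF g_meas f_meas' ae] by (rule integral_completion[OF f_meas])
qed

lemma affine_constant_pos:
  "q \<le> k \<Longrightarrow> k \<le> n \<Longrightarrow> 0 < fact q ^ m * stiefel_volume n q / stiefel_volume k q"
  unfolding times_divide_eq_right[symmetric] stiefel_volume_quotient
  by (simp add: dimension_change_const_pos)

text \<open>
  On the exceptional planes the inner integrand need not be integrable. \<open>J\<close> is a measurable version of the
  inner integral: the difference of the integrals of the positive and the negative part of \<open>v\<close>,
  with infinite values replaced by 0.
\<close>
lemma affine_blaschke_petkantschin_real:
  fixes \<mu> :: "(real^'n) set measure" and v :: "(nat \<Rightarrow> real^'n) \<Rightarrow> real"
  assumes q: "q \<le> k" and k: "k \<le> CARD('n)" and \<mu>: "invariant_probability_grassmannian k \<mu>"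
    and v: "integrable (tuples (Suc q) lborel) v"
  obtains J where "integrable (affine_grassmannian_measure k \<mu>) J"
    "AE \<tau> in affine_grassmannian_measure k \<mu>.
       has_bochner_integral (tuples (Suc q) (flat_lborel \<tau>)) (\<lambda>x. v x * simplex_volume q x ^ (CARD('n) - k)) (J \<tau>)"
    "(LINT x|(tuples (Suc q) lborel). v x) =
       fact q ^ (CARD('n) - k) * stiefel_volume CARD('n) q / stiefel_volume k q *
       (LINT \<tau>|affine_grassmannian_measure k \<mu>. J \<tau>)"
proof -
  let ?L = "tuples (Suc q) (lborel :: (real^'n) measure)"
  let ?F = "\<lambda>\<tau>. tuples (Suc q) (flat_lborel (\<tau> :: (real^'n) set))"
  let ?A = "affine_grassmannian_measure k \<mu>" and ?m = "CARD('n) - k"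
  define c where "c = fact q ^ ?m * stiefel_volume CARD('n) q / stiefel_volume k q"
  have c: "0 < c"
    unfolding c_def by (rule affine_constant_pos[OF q k])
  have sets_L: "sets ?L = sets (tuples (Suc q) borel)" by (rule sets_PiM_cong) auto
  have v_meas [measurable]: "v \<in> borel_measurable (tuples (Suc q) borel)"
    using borel_measurable_integrable[OF v] unfolding measurable_cong_sets[OF sets_L refl] .
  define I where "I u \<tau> = (\<integral>\<^sup>+x. ennreal (u x) * ennreal (simplex_volume q x ^ ?m) \<partial>?F \<tau>)"
    for u :: "(nat \<Rightarrow> real^'n) \<Rightarrow> real" and \<tau>
  have part: "integrable ?A (\<lambda>\<tau>. enn2real (I u \<tau>))"
    "AE \<tau> in ?A. has_bochner_integral (?F \<tau>) (\<lambda>x. u x * simplex_volume q x ^ ?m) (enn2real (I u \<tau>))"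
    "(LINT x|?L. u x) = c * (LINT \<tau>|?A. enn2real (I u \<tau>))"
    if u: "integrable ?L u" "\<And>x. 0 \<le> u x" and [measurable]: "u \<in> borel_measurable (tuples (Suc q) borel)" for u
  proof -
    have "I u \<in> borel_measurable (borel_affine_grassmannian k)"
      unfolding I_def by (rule borel_measurable_nn_integral_PiM_flat_lborel) (simp, measurable)
    then have I_meas [measurable]: "I u \<in> borel_measurable ?A"
      unfolding measurable_cong_sets[OF sets_affine_grassmannian_measure[OF \<mu>] refl] .
    have eq: "(\<integral>\<^sup>+x. ennreal (u x) \<partial>?L) = ennreal c * (\<integral>\<^sup>+\<tau>. I u \<tau> \<partial>?A)"
      unfolding I_def c_def by (rule affine_blaschke_petkantschin_nn_integral[OF q k \<mu>]) measurable
    have int_u: "(\<integral>\<^sup>+x. ennreal (u x) \<partial>?L) = ennreal (LINT x|?L. u x)"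
      using u by (intro nn_integral_eq_integral) auto
    have fin: "(\<integral>\<^sup>+\<tau>. I u \<tau> \<partial>?A) \<noteq> \<infinity>"
    proof
      assume "(\<integral>\<^sup>+\<tau>. I u \<tau> \<partial>?A) = \<infinity>"
      then have "(\<integral>\<^sup>+x. ennreal (u x) \<partial>?L) = \<infinity>" using c unfolding eq by (simp add: ennreal_mult_top)
      then show False unfolding int_u by simp
    qed
    have ae: "AE \<tau> in ?A. I u \<tau> \<noteq> \<infinity>" by (rule nn_integral_noteq_infinite[OF I_meas fin])
    have int_I: "(\<integral>\<^sup>+\<tau>. ennreal (enn2real (I u \<tau>)) \<partial>?A) = (\<integral>\<^sup>+\<tau>. I u \<tau> \<partial>?A)"
      using ae by (intro nn_integral_cong_AE) (auto simp: less_top elim!: eventually_mono)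
    show int: "integrable ?A (\<lambda>\<tau>. enn2real (I u \<tau>))"
      using fin int_I by (intro integrableI_nonneg) (auto simp: less_top)
    show "AE \<tau> in ?A. has_bochner_integral (?F \<tau>) (\<lambda>x. u x * simplex_volume q x ^ ?m) (enn2real (I u \<tau>))"
      using ae
    proof eventually_elim
      case (elim \<tau>)
      have "(\<lambda>x. u x * simplex_volume q x ^ ?m) \<in> borel_measurable (?F \<tau>)"
        by (rule measurable_PiM_flat_lborel) measurable
      then show ?case
        using elim u(2) by (intro has_bochner_integral_nn_integral)
          (auto simp: I_def ennreal_mult' less_top)
    qed
    have "ennreal (LINT x|?L. u x) = ennreal (c * (LINT \<tau>|?A. enn2real (I u \<tau>)))"
      using eq unfolding int_u int_I[symmetric]
      by (subst (asm) nn_integral_eq_integral[OF int]) (use c in \<open>auto simp: ennreal_mult'\<close>)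
    then show "(LINT x|?L. u x) = c * (LINT \<tau>|?A. enn2real (I u \<tau>))"
      using c u(2) by (subst (asm) ennreal_inj) (auto intro!: mult_nonneg_nonneg integral_nonneg_AE)
  qed
  define vp vn where "vp x = max 0 (v x)" and "vn x = max 0 (- v x)" for x
  have v_eq: "v x = vp x - vn x" for x by (simp add: vp_def vn_def max_def)
  have ints: "integrable ?L vp" "integrable ?L vn"
    unfolding vp_def vn_def using v by auto
  have meas: "vp \<in> borel_measurable (tuples (Suc q) borel)" "vn \<in> borel_measurable (tuples (Suc q) borel)"
    unfolding vp_def vn_def by measurable
  note p = part[OF ints(1) _ meas(1)] and n = part[OF ints(2) _ meas(2)]
  have nonneg: "0 \<le> vp x" "0 \<le> vn x" for x by (simp_all add: vp_def vn_def)
  show ?thesis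
  proof (rule that[of "\<lambda>\<tau>. enn2real (I vp \<tau>) - enn2real (I vn \<tau>)"])
    show "integrable ?A (\<lambda>\<tau>. enn2real (I vp \<tau>) - enn2real (I vn \<tau>))"
      using p(1) n(1) nonneg by simp
    show "AE \<tau> in ?A. has_bochner_integral (?F \<tau>) (\<lambda>x. v x * simplex_volume q x ^ ?m)
        (enn2real (I vp \<tau>) - enn2real (I vn \<tau>))"
      using p(2)[OF nonneg(1)] n(2)[OF nonneg(2)]
    proof eventually_elim
      case (elim \<tau>)
      then show ?case unfolding v_eq left_diff_distrib by (rule has_bochner_integral_diff)
    qed
    show "(LINT x|?L. v x) = fact q ^ ?m * stiefel_volume CARD('n) q / stiefel_volume k q * (LINT \<tau>|?A. enn2real (I vp \<tau>) - enn2real (I vn \<tau>))"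
      unfolding v_eq c_def[symmetric] using ints p(1,3)[OF nonneg(1)] n(1,3)[OF nonneg(2)]
      by (simp add: right_diff_distrib)
  qed
qed

lemma lebesgue_columns_eq: "lebesgue_columns q = completion (tuples (Suc q) lborel)"
  by (simp add: lebesgue_columns_def atLeast0AtMost lessThan_Suc_atMost)

lemma lebesgue_flat_columns_eq: "lebesgue_flat_columns q \<tau> = completion (tuples (Suc q) (flat_lborel \<tau>))"
  by (simp add: lebesgue_flat_columns_def atLeast0AtMost lessThan_Suc_atMost)

text \<open>
  By the formula for the indicator of an exceptional null set \<open>N\<close>, the integral of the weight over \<open>N\<close> vanishes
  on almost every plane. Points where the weight is 0 are exempt; there the weighted integrand vanishes
  whatever its other factor is.
\<close>
lemma AE_flat_columns_weighted:
  fixes \<mu> :: "(real^'n) set measure"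
  assumes q: "q \<le> k" and k: "k \<le> CARD('n)" and \<mu>: "invariant_probability_grassmannian k \<mu>"
    and ae: "AE x in (tuples (Suc q) (lborel :: (real^'n) measure)). P x"
  shows "AE \<tau> in affine_grassmannian_measure k \<mu>. AE x in (tuples (Suc q) (flat_lborel \<tau>)).
    P x \<or> simplex_volume q x ^ (CARD('n) - k) = 0"
proof -
  let ?L = "tuples (Suc q) (lborel :: (real^'n) measure)"
  let ?F = "\<lambda>\<tau>. tuples (Suc q) (flat_lborel (\<tau> :: (real^'n) set))"
  let ?A = "affine_grassmannian_measure k \<mu>" and ?m = "CARD('n) - k"
  have sets_L: "sets ?L = sets (tuples (Suc q) borel)" by (rule sets_PiM_cong) auto
  have c: "0 < fact q ^ ?m * stiefel_volume CARD('n) q / stiefel_volume k q"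
    by (rule affine_constant_pos[OF q k])
  obtain N where N: "{x \<in> space ?L. \<not> P x} \<subseteq> N" "emeasure ?L N = 0" "N \<in> sets ?L"
    using ae by (rule AE_E)
  have N_meas [measurable]: "N \<in> sets (tuples (Suc q) borel)" using N(3) by (simp add: sets_L)
  define I where "I \<tau> = (\<integral>\<^sup>+x. indicator N x * ennreal (simplex_volume q x ^ ?m) \<partial>?F \<tau>)" for \<tau>
  have "I \<in> borel_measurable (borel_affine_grassmannian k)"
    unfolding I_def by (rule borel_measurable_nn_integral_PiM_flat_lborel) (simp, measurable)
  then have I_meas: "I \<in> borel_measurable ?A"
    unfolding measurable_cong_sets[OF sets_affine_grassmannian_measure[OF \<mu>] refl] .
  have "(\<integral>\<^sup>+x. indicator N x \<partial>?L) = ennreal (fact q ^ ?m * stiefel_volume CARD('n) q / stiefel_volume k q) * (\<integral>\<^sup>+\<tau>. I \<tau> \<partial>?A)"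
    unfolding I_def by (rule affine_blaschke_petkantschin_nn_integral[OF q k \<mu>]) measurable
  then have "(\<integral>\<^sup>+\<tau>. I \<tau> \<partial>?A) = 0" using N c by (simp add: ennreal_eq_0_iff not_le)
  then have "AE \<tau> in ?A. I \<tau> = 0" using I_meas by (simp add: nn_integral_0_iff_AE)
  then show ?thesis
  proof eventually_elim
    case (elim \<tau>)
    have "(\<lambda>x. indicator N x * ennreal (simplex_volume q x ^ ?m)) \<in> borel_measurable (?F \<tau>)"
      by (rule measurable_PiM_flat_lborel) measurable
    then have "AE x in ?F \<tau>. indicator N x * ennreal (simplex_volume q x ^ ?m) = 0"
      using elim by (simp only: I_def nn_integral_0_iff_AE)
    with AE_space[of "?F \<tau>"] show ?case
    proof eventually_elim
      case (elim x)
      have "x \<in> space ?L" using elim(1) by (auto simp: space_PiM PiE_iff)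
      moreover have "x \<notin> N \<or> simplex_volume q x ^ ?m = 0"
      proof -
        define d where "d = simplex_volume q x ^ ?m"
        have "0 \<le> d" "indicator N x * ennreal d = 0" using elim(2) by (simp_all add: d_def)
        then have "x \<notin> N \<or> d = 0" by (cases "x \<in> N") (auto simp: ennreal_eq_0_iff)
        then show ?thesis by (simp add: d_def)
      qed
      ultimately show ?case using N(1) by auto
    qed
  qed
qed

theorem theorem3p1:
  fixes k q :: nat
    and \<mu> :: "(real^'n) set measure"
    and F :: "(nat \<Rightarrow> real^'n) \<Rightarrow> complex"
  assumes "1 \<le> q" and "q \<le> k" and "k \<le> CARD('n)"
    and "invariant_probability_grassmannian k \<mu>"
    and "integrable (lebesgue_columns q) F"
  shows "(AE \<tau> in completion (affine_grassmannian_measure k \<mu>).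
      integrable (lebesgue_flat_columns q \<tau>)
        (\<lambda>x. F x * of_real (simplex_volume q x ^ (CARD('n) - k)))) \<and>
    integrable (completion (affine_grassmannian_measure k \<mu>))
      (\<lambda>\<tau>. LINT x|lebesgue_flat_columns q \<tau>.
        F x * of_real (simplex_volume q x ^ (CARD('n) - k))) \<and>
    (LINT x|lebesgue_columns q. F x) =
      of_real ((fact q) ^ (CARD('n) - k) * stiefel_volume CARD('n) q / stiefel_volume k q) *
      (LINT \<tau>|completion (affine_grassmannian_measure k \<mu>).
        LINT x|lebesgue_flat_columns q \<tau>.
          F x * of_real (simplex_volume q x ^ (CARD('n) - k)))"
proof -
  note q = assms(2) and k = assms(3) and \<mu> = assms(4)
  let ?L = "tuples (Suc q) (lborel :: (real^'n) measure)"
  let ?F = "\<lambda>\<tau>. tuples (Suc q) (flat_lborel (\<tau> :: (real^'n) set))"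
  let ?A = "affine_grassmannian_measure k \<mu>"
  let ?w = "\<lambda>x. simplex_volume q x ^ (CARD('n) - k)"
  let ?c = "fact q ^ (CARD('n) - k) * stiefel_volume CARD('n) q / stiefel_volume k q"
  have F: "integrable (completion ?L) F" using assms(5) by (simp add: lebesgue_columns_eq)
  obtain a b where a: "a \<in> borel_measurable ?L" "AE x in ?L. Re (F x) = a x"
    and b: "b \<in> borel_measurable ?L" "AE x in ?L. Im (F x) = b x"
    using completion_ex_borel_measurable_real[of "\<lambda>x. Re (F x)" ?L]
      completion_ex_borel_measurable_real[of "\<lambda>x. Im (F x)" ?L] borel_measurable_integrable[OF F] by auto
  have Fab: "AE x in ?L. F x = complex_of_real (a x) + \<i> * complex_of_real (b x)"
    using a(2) b(2) by eventually_elim (simp add: complex_eq_iff)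
  have int: "integrable ?L a" "integrable ?L b"
  proof -
    have [measurable]: "a \<in> borel_measurable (completion ?L)" "b \<in> borel_measurable (completion ?L)"
      "F \<in> borel_measurable (completion ?L)"
      using a b F by (auto intro: measurable_completion)
    have "integrable (completion ?L) a"
      by (rule integrable_cong_AE_imp[OF integrable_Re[OF F]]) (use a in \<open>auto simp: AE_completion_iff\<close>)
    moreover have "integrable (completion ?L) b"
      by (rule integrable_cong_AE_imp[OF integrable_Im[OF F]]) (use b in \<open>auto simp: AE_completion_iff\<close>)
    ultimately show "integrable ?L a" "integrable ?L b"
      using a(1) b(1) by (simp_all add: integrable_completion)
  qed
  obtain Ja where Ja: "integrable ?A Ja"
    "AE \<tau> in ?A. has_bochner_integral (?F \<tau>) (\<lambda>x. a x * ?w x) (Ja \<tau>)"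
    "(LINT x|?L. a x) = ?c * (LINT \<tau>|?A. Ja \<tau>)"
    by (rule affine_blaschke_petkantschin_real[OF q k \<mu> int(1)])
  obtain Jb where Jb: "integrable ?A Jb"
    "AE \<tau> in ?A. has_bochner_integral (?F \<tau>) (\<lambda>x. b x * ?w x) (Jb \<tau>)"
    "(LINT x|?L. b x) = ?c * (LINT \<tau>|?A. Jb \<tau>)"
    by (rule affine_blaschke_petkantschin_real[OF q k \<mu> int(2)])
  define J where "J \<tau> = complex_of_real (Ja \<tau>) + \<i> * complex_of_real (Jb \<tau>)" for \<tau>
  have J: "integrable ?A J" unfolding J_def using Ja(1) Jb(1) by simp
  have inner: "AE \<tau> in ?A. integrable (lebesgue_flat_columns q \<tau>) (\<lambda>x. F x * of_real (?w x)) \<and>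
      (LINT x|lebesgue_flat_columns q \<tau>. F x * of_real (?w x)) = J \<tau>"
    using Ja(2) Jb(2) AE_flat_columns_weighted[OF q k \<mu> Fab]
  proof eventually_elim
    case (elim \<tau>)
    let ?g = "\<lambda>x. complex_of_real (a x * ?w x) + \<i> * complex_of_real (b x * ?w x)"
    have g: "has_bochner_integral (?F \<tau>) ?g (J \<tau>)"
      unfolding J_def using elim(1,2)
      by (intro has_bochner_integral_add has_bochner_integral_mult_right has_bochner_integral_of_real) auto
    have "AE x in ?F \<tau>. F x * of_real (?w x) = ?g x"
      using elim(3)
    proof eventually_elim
      case (elim x)
      then show ?case
      proof
        assume "F x = complex_of_real (a x) + \<i> * complex_of_real (b x)"
        then show ?thesis by (simp add: algebra_simps)
      next
        assume "?w x = 0"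
        then show ?thesis by (simp only: mult_zero_right of_real_0 add_0)
      qed
    qed
    from integrable_completion_AE_eq[OF integrable.intros[OF g] this] has_bochner_integral_integral_eq[OF g]
    show ?case by (simp add: lebesgue_flat_columns_eq)
  qed
  have outer: "AE \<tau> in ?A. (LINT x|lebesgue_flat_columns q \<tau>. F x * of_real (?w x)) = J \<tau>"
    using inner by eventually_elim simp
  have "(LINT x|lebesgue_columns q. F x) = (LINT x|?L. complex_of_real (a x) + \<i> * complex_of_real (b x))"
    unfolding lebesgue_columns_eq by (rule integrable_completion_AE_eq(2)[OF _ Fab]) (use int in simp)
  also have "\<dots> = complex_of_real (LINT x|?L. a x) + \<i> * complex_of_real (LINT x|?L. b x)"
    using int by simp
  also have "\<dots> = of_real ?c * (LINT \<tau>|?A. J \<tau>)"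
    unfolding Ja(3) Jb(3) J_def using Ja(1) Jb(1) by (simp add: add_divide_distrib algebra_simps)
  also have "(LINT \<tau>|?A. J \<tau>) = (LINT \<tau>|completion ?A. LINT x|lebesgue_flat_columns q \<tau>. F x * of_real (?w x))"
    by (rule integrable_completion_AE_eq(2)[OF J outer, symmetric])
  finally have formula: "(LINT x|lebesgue_columns q. F x) = of_real ?c *
      (LINT \<tau>|completion ?A. LINT x|lebesgue_flat_columns q \<tau>. F x * of_real (?w x))" .
  show ?thesis
  proof (intro conjI)
    show "AE \<tau> in completion ?A. integrable (lebesgue_flat_columns q \<tau>) (\<lambda>x. F x * of_real (?w x))"
      unfolding AE_completion_iff using inner by eventually_elim simp
    show "integrable (completion ?A) (\<lambda>\<tau>. LINT x|lebesgue_flat_columns q \<tau>. F x * of_real (?w x))"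
      by (rule integrable_completion_AE_eq(1)[OF J outer])
  qed (rule formula)
qed

end
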